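(* Let $G(\lambda)$ be Hamiltonian and let $\mathcal S(\lambda)=\left[\begin{array}{c|c}P(\lambda)&B^TJ^T\\ \hline B&A-\lambda I_r\end{array}\right]$ be the system matrix of a minimal Hamiltonian realization $G(\lambda)=P(\lambda)+B^TJ^T(\lambda I_r-A)^{-1}B$, $r=2\ell$. Let $0\le h\le m-1$ be even, $\mathbf w$ the simple admissible tuple of $\{0:h\}$ with symmetric complement $\mathbf c_w$, $\mathbf z+m$ any admissible tuple of $\{0:m-h-1\}$ with symmetric complement $\mathbf c_z+m$, and $L(\lambda)=(\lambda M^P_{\mathbf z}-M^P_{\mathbf w})M^P_{\mathbf c_w}M^P_{\mathbf c_z}$. Let $Q$ be the (unique up to multiplication by $-1$) quasi-identity matrix such that $QL(\lambda)$ is $T$-even, and $\mathbf s$ the $(m-i_0(\mathbf w))$-th parameter of $Q$. Assume that $\mathrm{Ind}(\mathbf z+m)=0$ when the leading coefficient $A_m$ of $P(\lambda)$ is singular. Then $$\mathbb T(\lambda)=\left[\begin{array}{c|c}\mathbf s\,QL(\lambda)&e_{m-i_0(\mathbf w)}\otimes B^TJ^T\\ \hline e^T_{m-i_0(\mathbf w)}\otimes B&A-\lambda I_r\end{array}\right]$$ is Hamiltonian and is a Rosenbrock strong linearization of $G(\lambda)$. The transfer function $\mathbb G(\lambda)=\mathbf s\,QL(\lambda)+(e_{m-i_0(\mathbf w)}\otimes B^TJ^T)(\lambda I_r-A)^{-1}(e^T_{m-i_0(\mathbf w)}\otimes B)$ of $\mathbb T(\lambda)$ is Hamiltonian.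
   Context: Setting: a rational matrix or matrix polynomial $F(\lambda)$ is Hamiltonian (equivalently $T$-even) if $F(-\lambda)^T=F(\lambda)$. $P(\lambda)=\sum_{i=0}^m\lambda^iA_i$, $A_i\in\mathbb C^{n\times n}$, $A_m\ne0$, $m\ge1$. For $r=2\ell$, $J=\begin{bmatrix}0&I_\ell\\ -I_\ell&0\end{bmatrix}$ and $\mathbb J_{k,r}=\mathrm{diag}(I_k,J)$. A matrix $X\in\mathbb C^{r\times r}$ is Hamiltonian if $(JX)^T=JX$. A Hamiltonian realization of $G$ is $G(\lambda)=P(\lambda)+C(\lambda I_r-A)^{-1}B$ with $P$ $T$-even, $A\in\mathbb C^{r\times r}$ Hamiltonian, $r=2\ell$, and $JB=C^T$ (so $C=B^TJ^T$); minimal means $r$ is smallest possible among all realizations of $G$. An $(mn+r)\times(mn+r)$ system matrix $\mathbb T(\lambda)$ partitioned as in the claim is called Hamiltonian if $(\mathbb J_{mn,r}\mathbb T(-\lambda))^T=\mathbb J_{mn,r}\mathbb T(\lambda)$. $e_j$ is the $j$-th column of $I_m$. Fiedler matrices: $M_0^P=\mathrm{diag}(I_{(m-1)n},-A_0)$, $M_{-m}^P=\mathrm{diag}(A_m,I_{(m-1)n})$, and for $1\le i\le m-1$, $M_i^P=\mathrm{diag}\big(I_{(m-i-1)n},\begin{bmatrix}-A_i&I_n\\ I_n&0\end{bmatrix},I_{(i-1)n}\big)$, $M_{-i}^P=(M_i^P)^{-1}=\mathrm{diag}\big(I_{(m-i-1)n},\begin{bmatrix}0&I_n\\ I_n&A_i\end{bmatrix},I_{(i-1)n}\big)$.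 For a tuple $\mathbf t=(t_1,\dots,t_k)$, $M^P_{\mathbf t}=M^P_{t_1}\cdots M^P_{t_k}$ (empty product $=$ identity). Tuples: $(a:b)=(a,a+1,\dots,b)$ if $a\le b$, empty otherwise; tuples separated by commas are concatenated; $\mathbf t+k$ adds $k$ to each entry. $i_0(\mathbf w)$ is the largest $p\ge0$ such that $(p,\dots,1,0)$ is a subtuple of $\mathbf w$ (obtained by deleting entries). An admissible tuple of $\{0:k\}$ with index $p=\mathrm{Ind}(\mathbf w)$, $0\le p\le k$, $k-p$ even, is $\mathbf w=(k-1:k,\,k-3:k-2,\dots,p+1:p+2,\,0:p)$; it is simple if $p\in\{0,1\}$ ($p=0$ for $k$ even). Its symmetric complement is $\mathbf c_w=(k-1,k-3,\dots,p+3,p+1,(0:p)_{rev_c})$ if $p\ge1$, where $(0:p)_{rev_c}=(0:p-1,0:p-2,\dots,0:1,0)$; $\mathbf c_w=(k-1,k-3,\dots,1)$ if $p=0,k>0$; $\mathbf c_w=\emptyset$ if $k=0$. Quasi-identity: $Q\in\mathbb C^{mn\times mn}$ is a quasi-identity matrix if $Q=\epsilon_1I_n\oplus\cdots\oplus\epsilon_mI_n$ with $\epsilon_i\in\{\pm1\}$; $\epsilon_j$ is its $j$-th parameter. It is a known result that, for $P$ $T$-even and tuples as in the claim, there is, up to multiplication by $-1$, a unique quasi-identity $Q$ such that $QL(\lambda)$ is $T$-even. A matrix polynomial is unimodular if its determinant is a nonzero constant; a square rational matrix is biproper if its limit at $\infty$ exists and is nonsingular. Rosenbrock strong linearization of $G(\lambda)$: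 an $(mn+r)\times(mn+r)$ pencil $\mathbb T(\lambda)=\left[\begin{array}{c|c}\mathcal X-\lambda\mathcal Y&\mathcal C\\ \hline\mathcal B&H-\lambda K\end{array}\right]$ with $K\in\mathbb C^{r\times r}$ nonsingular, irreducible ($[\mathcal B\ \ H-\lambda K]$ and $\begin{bmatrix}\mathcal C\\ H-\lambda K\end{bmatrix}$ have rank $r$ for all $\lambda\in\mathbb C$), such that (i) $\mathrm{diag}(U(\lambda),U_0)\,\mathbb T(\lambda)\,\mathrm{diag}(V(\lambda),V_0)=\mathrm{diag}(I_{(m-1)n},\mathcal S(\lambda))$ for some $mn\times mn$ unimodular $U,V$ and nonsingular $U_0,V_0\in\mathbb C^{r\times r}$; (ii) $\mathcal O_\ell(\lambda)\lambda^{-1}\mathbb G(\lambda)\mathcal O_r(\lambda)=\mathrm{diag}(I_{(m-1)n},\lambda^{-m}G(\lambda))$ for some $mn\times mn$ biproper $\mathcal O_\ell,\mathcal O_r$, where $\mathbb G(\lambda)=\mathcal X-\lambda\mathcal Y+\mathcal C(\lambda K-H)^{-1}\mathcal B$ is the transfer function. *)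

theory Defs
  imports
    "Jordan_Normal_Form.Gauss_Jordan_Elimination"
    "Jordan_Normal_Form.DL_Rank"
    "HOL-Computational_Algebra.Computational_Algebra"
    "HOL-Computational_Algebra.Field_as_Ring"
    "HOL-Library.Sublist"
begin

section \<open>Polynomial and rational matrices over the complex numbers\<close>

text \<open>Matrix polynomials have type \<open>complex poly mat\<close>, rational matrices have type
  \<open>complex poly fract mat\<close>.\<close>

definition const_mat :: "complex mat \<Rightarrow> complex poly mat" where
  "const_mat = map_mat (\<lambda>c. [:c:])"

definition rat_mat :: "complex poly mat \<Rightarrow> complex poly fract mat" where
  "rat_mat = map_mat to_fract"

abbreviation const_rat_mat :: "complex mat \<Rightarrow> complex poly fract mat" where
  "const_rat_mat M \<equiv> rat_mat (const_mat M)"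

abbreviation pvar :: "complex poly" where "pvar \<equiv> [:0, 1:]"

abbreviation rvar :: "complex poly fract" where "rvar \<equiv> to_fract pvar"

definition matrix_polynomial :: "nat \<Rightarrow> nat \<Rightarrow> (nat \<Rightarrow> complex mat) \<Rightarrow> complex poly mat" where
  "matrix_polynomial n m As = mat n n (\<lambda>(i, j). \<Sum>k\<le>m. monom (As k $$ (i, j)) k)"

text \<open>The substitution of \<open>-\<lambda>\<close> for \<open>\<lambda>\<close>.\<close>

definition poly_reflect :: "complex poly \<Rightarrow> complex poly" where
  "poly_reflect p = pcompose p [:0, -1:]"

definition rat_reflect :: "complex poly fract \<Rightarrow> complex poly fract" where
  "rat_reflect f = Fract (poly_reflect (fst (quot_of_fract f))) (poly_reflect (snd (quot_of_fract f)))"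

definition even_poly_mat :: "complex poly mat \<Rightarrow> bool" where
  "even_poly_mat F \<longleftrightarrow> transpose_mat (map_mat poly_reflect F) = F"

definition even_rat_mat :: "complex poly fract mat \<Rightarrow> bool" where
  "even_rat_mat F \<longleftrightarrow> transpose_mat (map_mat rat_reflect F) = F"

definition unimodular :: "nat \<Rightarrow> complex poly mat \<Rightarrow> bool" where
  "unimodular k U \<longleftrightarrow> U \<in> carrier_mat k k \<and> (\<exists>c. c \<noteq> 0 \<and> det U = [:c:])"

text \<open>\<open>quot_of_fract\<close> is the reduced fraction; the value at a pole is irrelevant below,
  since only the behaviour at infinity is used.\<close>

definition rat_eval :: "complex poly fract \<Rightarrow> complex \<Rightarrow> complex" where
  "rat_eval f x = poly (fst (quot_of_fract f)) x / poly (snd (quot_of_fract f)) x"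

definition biproper :: "nat \<Rightarrow> complex poly fract mat \<Rightarrow> bool" where
  "biproper k F \<longleftrightarrow> F \<in> carrier_mat k k \<and>
    (\<exists>M \<in> carrier_mat k k.
       (\<forall>i < k. \<forall>j < k. (rat_eval (F $$ (i, j)) \<longlongrightarrow> M $$ (i, j)) at_infinity) \<and> invertible_mat M)"


section \<open>Realizations and system matrices\<close>

text \<open>\<open>P(\<lambda>) + C (\<lambda> K - H)\<^sup>-\<^sup>1 B\<close>; the inverse is taken over the field of rational functions.\<close>

definition transfer_function ::
  "complex poly mat \<Rightarrow> complex mat \<Rightarrow> complex mat \<Rightarrow> complex mat \<Rightarrow> complex mat
    \<Rightarrow> complex poly fract mat" where
  "transfer_function P C K H B =
     rat_mat P
     + const_rat_mat C * the (mat_inverse (rvar \<cdot>\<^sub>m const_rat_mat K - const_rat_mat H)) * const_rat_mat B"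

definition pencil :: "complex mat \<Rightarrow> complex mat \<Rightarrow> complex poly mat" where
  "pencil X Y = const_mat X - pvar \<cdot>\<^sub>m const_mat Y"

definition system_matrix ::
  "complex poly mat \<Rightarrow> complex mat \<Rightarrow> complex mat \<Rightarrow> complex mat \<Rightarrow> complex mat
    \<Rightarrow> complex poly mat" where
  "system_matrix P C B H K = four_block_mat P (const_mat C) (const_mat B) (pencil H K)"

definition realization ::
  "nat \<Rightarrow> nat \<Rightarrow> complex poly fract mat \<Rightarrow> complex poly mat \<Rightarrow> complex mat \<Rightarrow> complex mat
    \<Rightarrow> complex mat \<Rightarrow> bool" where
  "realization n r G P A B C \<longleftrightarrow>
     P \<in> carrier_mat n n \<and> A \<in> carrier_mat r r \<and> B \<in> carrier_mat r n \<and> C \<in> carrier_mat n r \<and>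
     G = transfer_function P C (1\<^sub>m r) A B"

definition minimal_realization ::
  "nat \<Rightarrow> nat \<Rightarrow> complex poly fract mat \<Rightarrow> complex poly mat \<Rightarrow> complex mat \<Rightarrow> complex mat
    \<Rightarrow> complex mat \<Rightarrow> bool" where
  "minimal_realization n r G P A B C \<longleftrightarrow>
     realization n r G P A B C \<and>
     (\<forall>r' P' A' B' C'. realization n r' G P' A' B' C' \<longrightarrow> r \<le> r')"

definition J_mat :: "nat \<Rightarrow> 'a::ring_1 mat" where
  "J_mat l = four_block_mat (0\<^sub>m l l) (1\<^sub>m l) (- 1\<^sub>m l) (0\<^sub>m l l)"

definition hamiltonian_mat :: "nat \<Rightarrow> complex mat \<Rightarrow> bool" where
  "hamiltonian_mat l X \<longleftrightarrow>
     X \<in> carrier_mat (2 * l) (2 * l) \<and> transpose_mat (J_mat l * X) = J_mat l * X"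

definition hamiltonian_realization ::
  "nat \<Rightarrow> nat \<Rightarrow> complex poly fract mat \<Rightarrow> complex poly mat \<Rightarrow> complex mat \<Rightarrow> complex mat
    \<Rightarrow> complex mat \<Rightarrow> bool" where
  "hamiltonian_realization n l G P A B C \<longleftrightarrow>
     realization n (2 * l) G P A B C \<and> even_poly_mat P \<and> hamiltonian_mat l A \<and>
     J_mat l * B = transpose_mat C"

text \<open>Here \<open>N\<close> is the size of the upper left block of the partition.\<close>

definition hamiltonian_system_matrix :: "nat \<Rightarrow> nat \<Rightarrow> complex poly mat \<Rightarrow> bool" where
  "hamiltonian_system_matrix N l T \<longleftrightarrow>
     T \<in> carrier_mat (N + 2 * l) (N + 2 * l) \<and>
     transpose_mat (diag_block_mat [1\<^sub>m N, J_mat l] * map_mat poly_reflect T)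
       = diag_block_mat [1\<^sub>m N, J_mat l] * T"


section \<open>Rosenbrock strong linearizations\<close>

definition irreducible_system ::
  "nat \<Rightarrow> nat \<Rightarrow> complex mat \<Rightarrow> complex mat \<Rightarrow> complex mat \<Rightarrow> complex mat \<Rightarrow> bool" where
  "irreducible_system N r C B H K \<longleftrightarrow>
     (\<forall>x::complex.
        vec_space.rank r
          (four_block_mat B (H - x \<cdot>\<^sub>m K) (0\<^sub>m 0 (dim_col B)) (0\<^sub>m 0 (dim_col H))) = r \<and>
        vec_space.rank (N + r) (C @\<^sub>r (H - x \<cdot>\<^sub>m K)) = r)"

text \<open>\<open>S\<close> is the system matrix of the minimal realization of the \<open>n \<times> n\<close> matrix \<open>G\<close> with state
  dimension \<open>r\<close>, and \<open>m\<close> is the degree of the polynomial part of \<open>G\<close>. The blocks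
  \<open>X, Y, C, B, H, K\<close> are determined by \<open>T\<close> and the sizes.\<close>

definition rosenbrock_strong_linearization ::
  "nat \<Rightarrow> nat \<Rightarrow> nat \<Rightarrow> complex poly mat \<Rightarrow> complex poly fract mat \<Rightarrow> complex poly mat \<Rightarrow> bool" where
  "rosenbrock_strong_linearization n m r S G T \<longleftrightarrow>
     (\<exists>X Y C B H K.
        X \<in> carrier_mat (m * n) (m * n) \<and> Y \<in> carrier_mat (m * n) (m * n) \<and>
        C \<in> carrier_mat (m * n) r \<and> B \<in> carrier_mat r (m * n) \<and>
        H \<in> carrier_mat r r \<and> K \<in> carrier_mat r r \<and> invertible_mat K \<and>
        T = system_matrix (pencil X Y) C B H K \<and>
        irreducible_system (m * n) r C B H K \<and>
        (\<exists>U V U\<^sub>0 V\<^sub>0.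
           unimodular (m * n) U \<and> unimodular (m * n) V \<and>
           U\<^sub>0 \<in> carrier_mat r r \<and> invertible_mat U\<^sub>0 \<and>
           V\<^sub>0 \<in> carrier_mat r r \<and> invertible_mat V\<^sub>0 \<and>
           diag_block_mat [U, const_mat U\<^sub>0] * T * diag_block_mat [V, const_mat V\<^sub>0]
             = diag_block_mat [1\<^sub>m ((m - 1) * n), S]) \<and>
        (\<exists>Ol Or.
           biproper (m * n) Ol \<and> biproper (m * n) Or \<and>
           Ol * (inverse rvar \<cdot>\<^sub>m transfer_function (pencil X Y) C K H B) * Or
             = diag_block_mat [1\<^sub>m ((m - 1) * n), inverse rvar ^ m \<cdot>\<^sub>m G]))"


section \<open>Fiedler matrices\<close>

text \<open>Meaningful for \<open>-m \<le> i \<le> m - 1\<close>; the last case is \<open>-m < i < 0\<close>.\<close>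

definition fiedler_mat :: "nat \<Rightarrow> nat \<Rightarrow> (nat \<Rightarrow> complex mat) \<Rightarrow> int \<Rightarrow> complex mat" where
  "fiedler_mat n m As i =
     (if i = 0 then diag_block_mat [1\<^sub>m ((m - 1) * n), - As 0]
      else if i = - int m then diag_block_mat [As m, 1\<^sub>m ((m - 1) * n)]
      else let k = nat \<bar>i\<bar> in
        diag_block_mat
          [1\<^sub>m ((m - k - 1) * n),
           if i > 0 then four_block_mat (- As k) (1\<^sub>m n) (1\<^sub>m n) (0\<^sub>m n n)
           else four_block_mat (0\<^sub>m n n) (1\<^sub>m n) (1\<^sub>m n) (As k),
           1\<^sub>m ((k - 1) * n)])"

definition fiedler_prod :: "nat \<Rightarrow> nat \<Rightarrow> (nat \<Rightarrow> complex mat) \<Rightarrow> int list \<Rightarrow> complex mat" where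
  "fiedler_prod n m As t = foldr (\<lambda>i M. fiedler_mat n m As i * M) t (1\<^sub>m (m * n))"


section \<open>Admissible tuples\<close>

text \<open>\<open>w = (k-1:k, k-3:k-2, \<dots>, p+1:p+2, 0:p)\<close>, with index \<open>p\<close>.\<close>

definition admissible_tuple :: "nat \<Rightarrow> nat \<Rightarrow> int list \<Rightarrow> bool" where
  "admissible_tuple k p w \<longleftrightarrow>
     p \<le> k \<and> even (k - p) \<and>
     w = concat (map (\<lambda>j. [int k - 2 * int j - 1 .. int k - 2 * int j]) [0..<(k - p) div 2])
         @ [0 .. int p]"

definition simple_admissible_tuple :: "nat \<Rightarrow> nat \<Rightarrow> int list \<Rightarrow> bool" where
  "simple_admissible_tuple k p w \<longleftrightarrow> admissible_tuple k p w \<and> p \<in> {0, 1}"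

text \<open>The tuple \<open>(0:p-1, 0:p-2, \<dots>, 0:1, 0)\<close>, which is empty for \<open>p = 0\<close>.\<close>

definition rev_c :: "nat \<Rightarrow> int list" where
  "rev_c p = concat (map (\<lambda>j. [0 .. int p - 1 - int j]) [0..<p])"

text \<open>The symmetric complement \<open>(k-1, k-3, \<dots>, p+1)\<close>, followed by \<open>rev_c p\<close>, of the admissible
  tuple of \<open>{0:k}\<close> with index \<open>p\<close>. For \<open>p = 0\<close> this is \<open>(k-1, k-3, \<dots>, 1)\<close>, which is empty for \<open>k = 0\<close>.\<close>

definition symmetric_complement :: "nat \<Rightarrow> nat \<Rightarrow> int list" where
  "symmetric_complement k p = map (\<lambda>j. int k - 1 - 2 * int j) [0..<(k - p) div 2] @ rev_c p"

text \<open>The largest \<open>p\<close> such that \<open>(p, \<dots>, 1, 0)\<close> is a subtuple of \<open>w\<close>.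
  It exists whenever \<open>w\<close> contains 0.\<close>

definition i0 :: "int list \<Rightarrow> nat" where
  "i0 w = (GREATEST p. subseq (rev [0 .. int p]) w)"


section \<open>Quasi-identities and Kronecker products\<close>

definition quasi_identity :: "nat \<Rightarrow> nat \<Rightarrow> (nat \<Rightarrow> complex) \<Rightarrow> complex mat \<Rightarrow> bool" where
  "quasi_identity n m eps Q \<longleftrightarrow>
     (\<forall>i \<in> {1..m}. eps i \<in> {1, -1}) \<and>
     Q = diag_block_mat (map (\<lambda>i. eps i \<cdot>\<^sub>m 1\<^sub>m n) [1..<m + 1])"

definition kronecker :: "'a::semiring_1 mat \<Rightarrow> 'a mat \<Rightarrow> 'a mat" where
  "kronecker A B = mat (dim_row A * dim_row B) (dim_col A * dim_col B)
     (\<lambda>(i, j). A $$ (i div dim_row B, j div dim_col B) * B $$ (i mod dim_row B, j mod dim_col B))"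

text \<open>\<open>e_col m j\<close> is the \<open>j\<close>-th column of \<open>I\<^sub>m\<close> as an \<open>m \<times> 1\<close> matrix, for \<open>1 \<le> j \<le> m\<close>.\<close>

definition e_col :: "nat \<Rightarrow> nat \<Rightarrow> 'a::semiring_1 mat" where
  "e_col m j = mat_of_cols m [unit_vec m (j - 1)]"

end

theory Submission
  imports Defs
begin

text \<open>Write \<open>D = diag(0, \<dots>, 0, I\<^sub>n)\<close> for the projection to the last block, the one in which
  \<open>M\<^sub>0\<close> carries \<open>A\<^sub>0\<close>. Both equivalences follow from one statement about Fiedler pencils
  (\<open>fiedler_pencil_linearizes\<close>). Let \<open>M\<^sub>\<sigma> = M\<^sub>a M\<^sub>0 M\<^sub>b\<close> be a product of the Fiedler matrices of indices
  \<open>0, \<dots>, m - 1\<close> in any order, over a commutative ring, and let a subring contain \<open>x\<close> and the entries of all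
  \<open>A\<^sub>i\<close>. Then there are \<open>U, V\<close>, invertible over this subring, with
  \<open>U (x M\<^sub>-\<^sub>m - M\<^sub>\<sigma>) V = diag(I, P(x))\<close> and, moreover, \<open>U M\<^sub>a D = D\<close> and \<open>D M\<^sub>b V = D\<close>. The proof is by
  induction on \<open>m\<close>: the factor of largest index can be moved to one end of the product, where it is eliminated, and
  this replaces the two highest coefficients by \<open>x A\<^sub>m + A\<^sub>m\<^sub>-\<^sub>1\<close>, as in Horner's scheme.

  Up to invertible constant factors the pencil \<open>L\<close> is a Fiedler pencil. All factors of \<open>M\<^sub>z\<close> but \<open>M\<^sub>-\<^sub>m\<close>
  are invertible, with \<open>M\<^sub>i\<inverse> = M\<^sub>-\<^sub>i\<close>; moving them to \<open>M\<^sub>w\<close> turns the negative indices of \<open>z\<close> into the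
  positive ones missing in \<open>w\<close>. The factors \<open>Q\<close>, \<open>M\<^sub>c\<^sub>w\<close>, \<open>M\<^sub>c\<^sub>z\<close> are invertible as well; \<open>M\<^sub>c\<^sub>z\<close> can contain
  \<open>M\<^sub>-\<^sub>m\<close> only if \<open>Ind(z + m) > 0\<close>, and then \<open>A\<^sub>m\<close> is nonsingular by hypothesis. The border blocks of the system
  matrix are carried along. Write \<open>j = m - i\<^sub>0(w)\<close>. As \<open>h\<close> is even, \<open>w = (a, 0)\<close> where \<open>a\<close> is empty or ends in
  \<open>(1, 2)\<close>, and the tail decides both \<open>i\<^sub>0(w) \<in> {0, 1}\<close> and that \<open>M\<^sub>a\<close> maps \<open>e\<^sub>m \<otimes> C\<close> to \<open>e\<^sub>j \<otimes> C\<close>. Likewise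
  \<open>(e\<^sub>m\<^sup>T \<otimes> B) M\<^sub>c\<^sub>w M\<^sub>c\<^sub>z = e\<^sub>j\<^sup>T \<otimes> B\<close>, and the sign \<open>s\<close> makes the \<open>j\<close>-th block of \<open>s Q\<close> the
  identity. The conditions on \<open>D\<close> say that \<open>U\<close> and \<open>V\<close> fit to these borders, so that the whole system matrix is
  brought to \<open>diag(I, S)\<close> by unimodular factors, with \<open>U\<^sub>0 = V\<^sub>0 = I\<close> (\<open>unimodular_equivalence\<close>).

  At infinity, put \<open>\<Phi> = C (\<lambda>I - A)\<inverse> B\<close>, which is proper. The transfer function is
  \<open>s Q L + e\<^sub>j e\<^sub>j\<^sup>T \<otimes> \<Phi>\<close>, and by the same transport of blocks this is the pencil \<open>s Q L\<close> formed with
  \<open>A\<^sub>0 + \<Phi>\<close> in place of \<open>A\<^sub>0\<close>, that is, with \<open>G\<close> in place of \<open>P\<close>. Dividing by \<open>\<lambda>\<close> and reversing the order of rows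
  and columns yields a Fiedler pencil in \<open>1/\<lambda>\<close> for the reversed coefficients. The statement above, now over the
  ring of proper rational functions, gives the biproper equivalence (\<open>equivalence_at_infinity\<close>).

  Irreducibility expresses minimality: a left eigenvector of \<open>A\<close> that annihilates \<open>B\<close> would allow a realization
  with one state less, and \<open>J\<close> turns right eigenvectors into left ones. The two Hamiltonian properties are direct:
  \<open>s Q L\<close>, \<open>P\<close> and \<open>G\<close> are even, hence so is \<open>\<Phi> = G - P\<close>, and the borders satisfy \<open>J B = C\<^sup>T\<close>.\<close>

section \<open>Invertible matrices over a subring\<close>

definition dsum :: "'a::zero mat \<Rightarrow> 'a mat \<Rightarrow> 'a mat" where
  "dsum A B = four_block_mat A (0\<^sub>m (dim_row A) (dim_col B)) (0\<^sub>m (dim_row B) (dim_col A)) B"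

lemma dsum_dim [simp]:
  "dim_row (dsum A B) = dim_row A + dim_row B" "dim_col (dsum A B) = dim_col A + dim_col B"
  by (auto simp: dsum_def)

lemma dsum_carrier [simp, intro]:
  "A \<in> carrier_mat a b \<Longrightarrow> B \<in> carrier_mat c d \<Longrightarrow> dsum A B \<in> carrier_mat (a + c) (b + d)"
  by (auto simp: dsum_def)

lemma uminus_zero_mat [simp]: "- 0\<^sub>m a b = (0\<^sub>m a b :: 'a::group_add mat)"
  by (rule eq_matI) auto

lemma dsum_assoc: "dsum A (dsum B C) = dsum (dsum A B) C"
  unfolding dsum_def using assoc_four_block_mat[of A B C] by simp

lemma dsum_mult:
  fixes A :: "'a::semiring_0 mat"
  assumes "A \<in> carrier_mat a b" "B \<in> carrier_mat c d" "A' \<in> carrier_mat b e" "B' \<in> carrier_mat d f"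
  shows "dsum A B * dsum A' B' = dsum (A * A') (B * B')"
proof -
  have "dsum A B * dsum A' B' = four_block_mat A (0\<^sub>m a d) (0\<^sub>m c b) B * four_block_mat A' (0\<^sub>m b f) (0\<^sub>m d e) B'"
    using assms by (auto simp: dsum_def)
  also have "\<dots> = dsum (A * A') (B * B')"
    by (subst mult_four_block_mat[of A a b _ d _ c], use assms in \<open>auto simp: dsum_def\<close>)
  finally show ?thesis .
qed

lemma dsum_one [simp]: "dsum (1\<^sub>m a) (1\<^sub>m b) = 1\<^sub>m (a + b)"
  by (auto simp: dsum_def)

lemma dsum_zero [simp]: "dsum (0\<^sub>m a b) (0\<^sub>m c d) = 0\<^sub>m (a + c) (b + d)"
  by (auto simp: dsum_def)

lemma dsum_transpose: "transpose_mat (dsum A B) = dsum (transpose_mat A) (transpose_mat B)"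
  by (rule eq_matI) (auto simp: dsum_def)

lemma dsum_map: "f 0 = 0 \<Longrightarrow> map_mat f (dsum A B) = dsum (map_mat f A) (map_mat f B)"
  by (rule eq_matI) (auto simp: dsum_def)

lemma dsum_diag_block: "diag_block_mat [A, B] = dsum A B"
proof -
  have "diag_block_mat [A, B] = dsum A (diag_block_mat [B])"
    unfolding diag_block_mat.simps(2)[of A] dsum_def Let_def ..
  then show ?thesis by (simp only: diag_block_mat_singleton)
qed

text \<open>The elimination is done once, with matrices over a subring. For the full ring of polynomials the invertible
  matrices are the unimodular ones, for the proper rational functions inside the rational functions they are the
  biproper ones.\<close>

locale scalar_subring =
  fixes R :: "'a::comm_ring_1 set"
  assumes one_closed [simp]: "1 \<in> R"
    and diff_closed: "x \<in> R \<Longrightarrow> y \<in> R \<Longrightarrow> x - y \<in> R"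
    and mult_closed [intro]: "x \<in> R \<Longrightarrow> y \<in> R \<Longrightarrow> x * y \<in> R"
begin

lemma zero_closed [simp]: "0 \<in> R"
  using diff_closed[OF one_closed one_closed] by simp

lemma uminus_closed [intro]: "x \<in> R \<Longrightarrow> - x \<in> R"
  using diff_closed[OF zero_closed] by fastforce

lemma add_closed [intro]: "x \<in> R \<Longrightarrow> y \<in> R \<Longrightarrow> x + y \<in> R"
  using diff_closed[of x "- y"] by auto

lemma sum_closed: "(\<And>i. i \<in> I \<Longrightarrow> f i \<in> R) \<Longrightarrow> sum f I \<in> R"
  by (induction I rule: infinite_finite_induct) auto

lemma prod_closed: "(\<And>i. i \<in> I \<Longrightarrow> f i \<in> R) \<Longrightarrow> prod f I \<in> R"
  by (induction I rule: infinite_finite_induct) auto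

definition mats :: "nat \<Rightarrow> nat \<Rightarrow> 'a mat set" where
  "mats k l = {M \<in> carrier_mat k l. \<forall>i<k. \<forall>j<l. M $$ (i, j) \<in> R}"

definition GL :: "nat \<Rightarrow> 'a mat set" where
  "GL k = {U \<in> mats k k. \<exists>U' \<in> mats k k. U * U' = 1\<^sub>m k \<and> U' * U = 1\<^sub>m k}"

lemma matsI: "M \<in> carrier_mat k l \<Longrightarrow> (\<And>i j. i < k \<Longrightarrow> j < l \<Longrightarrow> M $$ (i, j) \<in> R) \<Longrightarrow> M \<in> mats k l"
  by (simp add: mats_def)

lemma matsD: "M \<in> mats k l \<Longrightarrow> i < k \<Longrightarrow> j < l \<Longrightarrow> M $$ (i, j) \<in> R"
  by (simp add: mats_def)

lemma mats_carrier [dest]: "M \<in> mats k l \<Longrightarrow> M \<in> carrier_mat k l"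
  by (simp add: mats_def)

lemma mats_one [simp]: "1\<^sub>m k \<in> mats k k"
  by (auto simp: mats_def)

lemma mats_zero [simp]: "0\<^sub>m k l \<in> mats k l"
  by (auto simp: mats_def)

lemma mats_add: "A \<in> mats k l \<Longrightarrow> B \<in> mats k l \<Longrightarrow> A + B \<in> mats k l"
  using mats_carrier[of A k l] mats_carrier[of B k l] by (intro matsI) (auto intro: matsD)

lemma mats_uminus: "A \<in> mats k l \<Longrightarrow> - A \<in> mats k l"
  using mats_carrier[of A k l] by (intro matsI) (auto intro: matsD)

lemma mats_smult: "A \<in> mats k l \<Longrightarrow> x \<in> R \<Longrightarrow> x \<cdot>\<^sub>m A \<in> mats k l"
  using mats_carrier[of A k l] by (intro matsI) (auto intro: matsD)

lemma mats_mult: "A \<in> mats k l \<Longrightarrow> B \<in> mats l p \<Longrightarrow> A * B \<in> mats k p"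
  using mats_carrier[of A k l] mats_carrier[of B l p]
  by (intro matsI) (auto simp: scalar_prod_def intro!: sum_closed mult_closed intro: matsD)

lemma mats_transpose: "A \<in> mats k l \<Longrightarrow> transpose_mat A \<in> mats l k"
  by (auto simp: mats_def)

lemma mats_four_block:
  "A \<in> mats k l \<Longrightarrow> B \<in> mats k l' \<Longrightarrow> C \<in> mats k' l \<Longrightarrow> D \<in> mats k' l' \<Longrightarrow>
    four_block_mat A B C D \<in> mats (k + k') (l + l')"
  by (auto simp: mats_def)

lemma mats_dsum: "A \<in> mats k l \<Longrightarrow> B \<in> mats k' l' \<Longrightarrow> dsum A B \<in> mats (k + k') (l + l')"
  unfolding dsum_def using mats_carrier[of A k l] mats_carrier[of B k' l']
  by (auto intro!: mats_four_block)

lemma GL_carrier [dest]: "U \<in> GL k \<Longrightarrow> U \<in> carrier_mat k k"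
  by (auto simp: GL_def)

lemma GL_I: "U \<in> mats k k \<Longrightarrow> U' \<in> mats k k \<Longrightarrow> U * U' = 1\<^sub>m k \<Longrightarrow> U' * U = 1\<^sub>m k \<Longrightarrow> U \<in> GL k"
  by (auto simp: GL_def)

lemma GL_mult:
  assumes "U \<in> GL k" "V \<in> GL k"
  shows "U * V \<in> GL k"
proof -
  obtain U' V' where *: "U' \<in> mats k k" "U * U' = 1\<^sub>m k" "U' * U = 1\<^sub>m k"
    "V' \<in> mats k k" "V * V' = 1\<^sub>m k" "V' * V = 1\<^sub>m k"
    using assms by (auto simp: GL_def)
  have c: "U \<in> carrier_mat k k" "V \<in> carrier_mat k k" "U' \<in> carrier_mat k k" "V' \<in> carrier_mat k k"
    using assms * by auto
  have "U * V * (V' * U') = U * (V * V') * U'" "V' * U' * (U * V) = V' * (U' * U) * V"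
    using c by (simp_all add: assoc_mult_mat[of _ k k _ k _ k])
  then have "U * V * (V' * U') = 1\<^sub>m k" "V' * U' * (U * V) = 1\<^sub>m k"
    using * c by simp_all
  then show ?thesis
    using assms * by (intro GL_I[of _ _ "V' * U'"]) (auto intro: mats_mult simp: GL_def)
qed

lemma GL_one [simp]: "1\<^sub>m k \<in> GL k"
  by (rule GL_I[of _ _ "1\<^sub>m k"]) auto

lemma GL_transpose:
  assumes "U \<in> GL k"
  shows "transpose_mat U \<in> GL k"
proof -
  obtain U' where *: "U \<in> mats k k" "U' \<in> mats k k" "U * U' = 1\<^sub>m k" "U' * U = 1\<^sub>m k"
    using assms by (auto simp: GL_def)
  have c: "U \<in> carrier_mat k k" "U' \<in> carrier_mat k k" using * by auto
  have "transpose_mat U' * transpose_mat U = 1\<^sub>m k"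
    using transpose_mult[OF c] *(3) by simp
  moreover have "transpose_mat U * transpose_mat U' = 1\<^sub>m k"
    using transpose_mult[OF c(2,1)] *(4) by simp
  ultimately have "transpose_mat U' * transpose_mat U = 1\<^sub>m k" "transpose_mat U * transpose_mat U' = 1\<^sub>m k"
    by blast+
  then show ?thesis
    using * by (intro GL_I[of _ _ "transpose_mat U'"]) (auto intro!: mats_transpose)
qed

lemma GL_dsum:
  assumes "U \<in> GL k" "V \<in> GL l"
  shows "dsum U V \<in> GL (k + l)"
proof -
  obtain U' V' where *: "U \<in> mats k k" "U' \<in> mats k k" "U * U' = 1\<^sub>m k" "U' * U = 1\<^sub>m k"
    "V \<in> mats l l" "V' \<in> mats l l" "V * V' = 1\<^sub>m l" "V' * V = 1\<^sub>m l"
    using assms by (auto simp: GL_def)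
  show ?thesis
    using * mats_carrier[of _ k k] mats_carrier[of _ l l] by (intro GL_I[of _ _ "dsum U' V'"])
      (auto intro!: mats_dsum simp: dsum_mult[of _ k k _ l l _ k _ l])
qed

end

section \<open>Fiedler pencils\<close>

text \<open>The block column \<open>e\<^sub>1 \<otimes> I\<^sub>n\<close> with \<open>m\<close> block rows.\<close>

definition first_unit :: "nat \<Rightarrow> nat \<Rightarrow> 'a::comm_ring_1 mat" where
  "first_unit n m = mat (m * n) n (\<lambda>(i, j). if i = j then 1 else 0)"

text \<open>The Fiedler matrix of index \<open>-(m + 1)\<close> of a polynomial of degree \<open>m + 1\<close> with leading coefficient \<open>X\<close>.\<close>

definition lead :: "nat \<Rightarrow> nat \<Rightarrow> 'a::comm_ring_1 mat \<Rightarrow> 'a mat" where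
  "lead n m X = dsum X (1\<^sub>m (m * n))"

definition last_proj :: "nat \<Rightarrow> nat \<Rightarrow> 'a::comm_ring_1 mat" where
  "last_proj n m = dsum (0\<^sub>m (m * n) (m * n)) (1\<^sub>m n)"

text \<open>The Fiedler matrix of largest positive index, with coefficient \<open>X\<close>, in \<open>m + 2\<close> block rows. Writing the
  identity blocks with \<open>e\<^sub>1\<close> allows calculations with two by two blocks.\<close>

definition top_factor :: "nat \<Rightarrow> nat \<Rightarrow> 'a::comm_ring_1 mat \<Rightarrow> 'a mat" where
  "top_factor n m X =
     four_block_mat (- X) (transpose_mat (first_unit n (Suc m))) (first_unit n (Suc m)) (lead n m (0\<^sub>m n n))"

text \<open>The inverse of \<open>top_factor n m X\<close>, which has the shape of a Fiedler matrix of negative index.\<close>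

definition top_clear :: "nat \<Rightarrow> nat \<Rightarrow> 'a::comm_ring_1 mat \<Rightarrow> 'a mat" where
  "top_clear n m X =
     four_block_mat (0\<^sub>m n n) (transpose_mat (first_unit n (Suc m))) (first_unit n (Suc m)) (lead n m X)"

text \<open>The Fiedler matrices of index \<open>i \<le> m\<close> for a polynomial of degree \<open>m + 1\<close>, whose leading coefficient does not
  enter them. A smaller index acts as in degree \<open>m\<close>, below an identity block.\<close>

primrec factor :: "nat \<Rightarrow> (nat \<Rightarrow> 'a::comm_ring_1 mat) \<Rightarrow> nat \<Rightarrow> nat \<Rightarrow> 'a mat" where
  "factor n A 0 i = - A 0"
| "factor n A (Suc m) i =
     (if i = Suc m then top_factor n m (A (Suc m)) else dsum (1\<^sub>m n) (factor n A m i))"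

definition factors :: "nat \<Rightarrow> (nat \<Rightarrow> 'a::comm_ring_1 mat) \<Rightarrow> nat \<Rightarrow> nat list \<Rightarrow> 'a mat" where
  "factors n A m xs = foldr (\<lambda>i M. factor n A m i * M) xs (1\<^sub>m (Suc m * n))"

definition mpoly_at :: "nat \<Rightarrow> nat \<Rightarrow> (nat \<Rightarrow> 'a::comm_ring_1 mat) \<Rightarrow> 'a \<Rightarrow> 'a mat" where
  "mpoly_at n m A x = mat n n (\<lambda>(i, j). \<Sum>k\<le>m. x ^ k * A k $$ (i, j))"

lemma first_unit_carrier [simp]: "first_unit n m \<in> carrier_mat (m * n) n"
  by (simp add: first_unit_def)

lemma lead_carrier [simp]: "X \<in> carrier_mat n n \<Longrightarrow> lead n m X \<in> carrier_mat (n + m * n) (n + m * n)"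
  by (simp add: lead_def)

lemma last_proj_carrier [simp]: "last_proj n m \<in> carrier_mat (n + m * n) (n + m * n)"
  unfolding last_proj_def by (metis add.commute dsum_carrier one_carrier_mat zero_carrier_mat)

lemma sum_if_less_if_eq:
  assumes "finite I"
  shows "(\<Sum>a\<in>I. if a < n then if a = i then c a else 0 else 0) = (if i \<in> I \<and> i < n then c i else (0::'a::comm_monoid_add))"
    "(\<Sum>a\<in>I. if a < n then if i = a then c a else 0 else 0) = (if i \<in> I \<and> i < n then c i else (0::'a::comm_monoid_add))"
proof -
  have "(\<Sum>a\<in>I. if a < n then if a = i then c a else 0 else 0) = (\<Sum>a\<in>I. if a = i then if i < n then c i else 0 else 0)"
    by (rule sum.cong) auto
  then show "(\<Sum>a\<in>I. if a < n then if a = i then c a else 0 else 0) = (if i \<in> I \<and> i < n then c i else 0)"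
    using assms by simp
  moreover have "(\<Sum>a\<in>I. if a < n then if i = a then c a else 0 else 0) = (\<Sum>a\<in>I. if a < n then if a = i then c a else 0 else 0)"
    by (rule sum.cong) auto
  ultimately show "(\<Sum>a\<in>I. if a < n then if i = a then c a else 0 else 0) = (if i \<in> I \<and> i < n then c i else 0)"
    by simp
qed

lemma first_unit_transpose_mult: "transpose_mat (first_unit n (Suc m)) * first_unit n (Suc m) = 1\<^sub>m n"
  by (rule eq_matI)
    (auto simp: first_unit_def scalar_prod_def if_distrib[of "\<lambda>x. x * _"] cong: if_cong)

lemma first_unit_mult_transpose:
  "first_unit n (Suc m) * transpose_mat (first_unit n (Suc m)) + lead n m (0\<^sub>m n n) = 1\<^sub>m (n + m * n)"
  by (rule eq_matI)
    (auto simp: first_unit_def scalar_prod_def lead_def dsum_def if_distrib[of "\<lambda>x. x * _"] cong: if_cong)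

lemma lead_first_unit:
  "X \<in> carrier_mat n n \<Longrightarrow> lead n m X * first_unit n (Suc m) = first_unit n (Suc m) * X"
  by (rule eq_matI)
    (auto simp: first_unit_def scalar_prod_def lead_def dsum_def if_distrib[of "\<lambda>x. x * _"] 
       if_distrib[of "\<lambda>x. _ * x"] sum_if_less_if_eq cong: if_cong)

lemma first_unit_lead:
  "X \<in> carrier_mat n n \<Longrightarrow>
    transpose_mat (first_unit n (Suc m)) * lead n m X = X * transpose_mat (first_unit n (Suc m))"
  by (rule eq_matI)
    (auto simp: first_unit_def scalar_prod_def lead_def dsum_def if_distrib[of "\<lambda>x. x * _"] 
       if_distrib[of "\<lambda>x. _ * x"] sum_if_less_if_eq cong: if_cong)

lemma lead_mult:
  "X \<in> carrier_mat n n \<Longrightarrow> Y \<in> carrier_mat n n \<Longrightarrow> lead n m X * lead n m Y = lead n m (X * Y)"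
  unfolding lead_def by (subst dsum_mult[of _ n n _ "m * n" "m * n" _ n _ "m * n"]) auto

lemma top_factor_carrier [simp]:
  "X \<in> carrier_mat n n \<Longrightarrow> top_factor n m X \<in> carrier_mat (n + (n + m * n)) (n + (n + m * n))"
  unfolding top_factor_def by (rule four_block_carrier_mat) auto

lemma top_clear_carrier [simp]:
  "X \<in> carrier_mat n n \<Longrightarrow> top_clear n m X \<in> carrier_mat (n + (n + m * n)) (n + (n + m * n))"
  unfolding top_clear_def by (rule four_block_carrier_mat) auto

lemma first_unit_carrier' [simp]: "first_unit n (Suc m) \<in> carrier_mat (n + m * n) n"
  using first_unit_carrier[of n "Suc m"] by simp

text \<open>When the coefficients differ, the product is still block unitriangular; this is what lets the elimination clear a
  factor with coefficient \<open>Y\<close> by the inverse of a factor with another one.\<close>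

lemma top_clear_top_factor:
  assumes X: "X \<in> carrier_mat n n" and Y: "Y \<in> carrier_mat n n"
  shows "top_clear n m X * top_factor n m Y =
    four_block_mat (1\<^sub>m n) (0\<^sub>m n (n + m * n)) (first_unit n (Suc m) * (X - Y)) (1\<^sub>m (n + m * n))"
proof -
  let ?N = "n + m * n"
  define e where "e = (first_unit n (Suc m) :: 'a mat)"
  define et where "et = transpose_mat e"
  note rules = first_unit_transpose_mult[of n m, where 'a = 'a, folded e_def, folded et_def]
    first_unit_mult_transpose[of n m, where 'a = 'a, folded e_def, folded et_def]
    lead_first_unit[of _ n m, where 'a = 'a, folded e_def]
    first_unit_lead[of _ n m, where 'a = 'a, folded e_def, folded et_def]
  have c: "e \<in> carrier_mat ?N n" and ct: "et \<in> carrier_mat n ?N" by (simp_all add: e_def et_def)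
  have z: "(0\<^sub>m n n :: 'a mat) \<in> carrier_mat n n" by simp
  have 1: "0\<^sub>m n n * (- Y) + et * e = 1\<^sub>m n"
    using Y by (simp add: rules)
  have 2: "0\<^sub>m n n * et + et * lead n m (0\<^sub>m n n) = 0\<^sub>m n ?N"
    using ct by (simp add: rules)
  have 3: "e * (- Y) + lead n m X * e = e * (X - Y)"
    unfolding rules(3)[OF X] using X Y c
    by (simp add: mult_minus_distrib_mat[of _ ?N n _ n] comm_add_mat[of _ ?N n] minus_add_uminus_mat[of _ ?N n])
  have 4: "e * et + lead n m X * lead n m (0\<^sub>m n n) = 1\<^sub>m ?N"
    using X by (simp add: lead_mult rules)
  show ?thesis
    unfolding top_clear_def top_factor_def e_def[symmetric] et_def[symmetric]
    by (subst mult_four_block_mat[of _ n n _ ?N _ ?N _ _ n _ ?N]) (use X Y c ct 1 2 3 4 in auto)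
qed

lemma top_factor_top_clear:
  assumes X: "X \<in> carrier_mat n n"
  shows "top_factor n m X * top_clear n m X = 1\<^sub>m (n + (n + m * n))"
proof -
  let ?N = "n + m * n"
  define e where "e = (first_unit n (Suc m) :: 'a mat)"
  define et where "et = transpose_mat e"
  note rules = first_unit_transpose_mult[of n m, where 'a = 'a, folded e_def, folded et_def]
    first_unit_mult_transpose[of n m, where 'a = 'a, folded e_def, folded et_def]
    lead_first_unit[of _ n m, where 'a = 'a, folded e_def]
    first_unit_lead[of _ n m, where 'a = 'a, folded e_def, folded et_def]
  have c: "e \<in> carrier_mat ?N n" and ct: "et \<in> carrier_mat n ?N" by (simp_all add: e_def et_def)
  have 1: "(- X) * 0\<^sub>m n n + et * e = 1\<^sub>m n"
    using X by (simp add: rules)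
  have 2: "(- X) * et + et * lead n m X = 0\<^sub>m n ?N"
    unfolding rules(4)[OF X] using mult_carrier_mat[OF X ct] X ct
    by (simp add: uminus_l_inv_mat[of _ n ?N])
  have 3: "e * 0\<^sub>m n n + lead n m (0\<^sub>m n n) * e = 0\<^sub>m ?N n"
    using c by (simp add: rules)
  have 4: "e * et + lead n m (0\<^sub>m n n) * lead n m X = 1\<^sub>m ?N"
    using X by (simp add: lead_mult rules)
  show ?thesis
    unfolding top_clear_def top_factor_def e_def[symmetric] et_def[symmetric]
    by (subst mult_four_block_mat[of _ n n _ ?N _ ?N _ _ n _ ?N]) (use X c ct 1 2 3 4 in auto)
qed

lemma top_clear_top_factor_same:
  assumes X: "X \<in> carrier_mat n n"
  shows "top_clear n m X * top_factor n m X = 1\<^sub>m (n + (n + m * n))"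
  unfolding top_clear_top_factor[OF X X] using X by (simp add: right_mult_zero_mat[OF first_unit_carrier'])

text \<open>The sign in the corner is there because the elimination leaves \<open>-I\<close> in the top left block.\<close>

definition col_clear :: "nat \<Rightarrow> nat \<Rightarrow> 'a::comm_ring_1 \<Rightarrow> 'a mat" where
  "col_clear n m x = four_block_mat (- 1\<^sub>m n) (x \<cdot>\<^sub>m transpose_mat (first_unit n (Suc m)))
     (0\<^sub>m (n + m * n) n) (1\<^sub>m (n + m * n))"

lemma col_clear_carrier [simp]: "col_clear n m x \<in> carrier_mat (n + (n + m * n)) (n + (n + m * n))"
  unfolding col_clear_def by (rule four_block_carrier_mat) auto

lemma col_clear_inverse: "col_clear n m x * col_clear n m x = 1\<^sub>m (n + (n + m * n))"
proof -
  let ?N = "n + m * n"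
  define E where "E = (x \<cdot>\<^sub>m transpose_mat (first_unit n (Suc m)) :: 'a mat)"
  have c: "E \<in> carrier_mat n ?N" by (simp add: E_def)
  have 1: "- 1\<^sub>m n * - 1\<^sub>m n + E * 0\<^sub>m ?N n = 1\<^sub>m n"
    using c by auto
  have 2: "- 1\<^sub>m n * E + E * 1\<^sub>m ?N = 0\<^sub>m n ?N" using c by (auto simp: uminus_l_inv_mat[of _ n ?N])
  show ?thesis
    unfolding col_clear_def E_def[symmetric]
    by (subst mult_four_block_mat[of _ n n _ ?N _ ?N _ _ n _ ?N]) (use 1 2 c in auto)
qed

text \<open>One step of the elimination. Clearing with the coefficient \<open>x A\<^sub>2 + A\<^sub>1\<close> in place of \<open>A\<^sub>1\<close> makes the first block
  column of the two summands cancel except for the corner, so that the first block splits off; what remains has the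
  leading coefficient \<open>x A\<^sub>2 + A\<^sub>1\<close>.\<close>

lemma fiedler_step:
  fixes x :: "'a::comm_ring_1"
  assumes A1: "A1 \<in> carrier_mat n n" and A2: "A2 \<in> carrier_mat n n"
    and M: "M \<in> carrier_mat (n + m * n) (n + m * n)"
  defines "X \<equiv> x \<cdot>\<^sub>m A2 + A1"
  shows "top_clear n m X * (x \<cdot>\<^sub>m lead n (Suc m) A2 - top_factor n m A1 * dsum (1\<^sub>m n) M) * col_clear n m x
    = dsum (1\<^sub>m n) (x \<cdot>\<^sub>m lead n m X - M)"
proof -
  let ?N = "n + m * n"
  define e where "e = (first_unit n (Suc m) :: 'a mat)"
  define et where "et = transpose_mat e"
  note rules = first_unit_transpose_mult[of n m, where 'a = 'a, folded e_def, folded et_def]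
    first_unit_mult_transpose[of n m, where 'a = 'a, folded e_def, folded et_def]
    lead_first_unit[of _ n m, where 'a = 'a, folded e_def]
    first_unit_lead[of _ n m, where 'a = 'a, folded e_def, folded et_def]
  have c: "e \<in> carrier_mat ?N n" and ct: "et \<in> carrier_mat n ?N" by (simp_all add: e_def et_def)
  have X: "X \<in> carrier_mat n n" using A1 A2 by (simp add: X_def)
  have XA: "X - A1 = x \<cdot>\<^sub>m A2" unfolding X_def using A1 A2 by auto
  let ?D = "dsum (1\<^sub>m n) M" and ?L = "lead n (Suc m) A2" and ?T = "top_factor n m A1" and ?S = "top_clear n m X"
  let ?F = "e * (x \<cdot>\<^sub>m A2)"
  have F: "?F \<in> carrier_mat ?N n" using A2 c by auto
  have cD: "?D \<in> carrier_mat (n + ?N) (n + ?N)" using M by auto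
  have L: "?L = four_block_mat A2 (0\<^sub>m n ?N) (0\<^sub>m ?N n) (1\<^sub>m ?N)"
    using A2 by (auto simp: lead_def dsum_def)
  have cL: "?L \<in> carrier_mat (n + ?N) (n + ?N)" using lead_carrier[OF A2, of "Suc m"] by simp
  have SL: "?S * (x \<cdot>\<^sub>m ?L) = four_block_mat (0\<^sub>m n n) (x \<cdot>\<^sub>m et) ?F (x \<cdot>\<^sub>m lead n m X)"
  proof -
    have b: "lead n m X * 0\<^sub>m ?N n = 0\<^sub>m ?N n" "lead n m X * 1\<^sub>m ?N = lead n m X"
      using lead_carrier[OF X, of m] by (rule right_mult_zero_mat, rule right_mult_one_mat)
    have "?S * ?L = four_block_mat (0\<^sub>m n n) (et) (e * A2) (lead n m X)"
      unfolding top_clear_def L e_def[symmetric] et_def[symmetric]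
      by (subst mult_four_block_mat[of _ n n _ ?N _ ?N _ _ n _ ?N]) (use X A2 c ct b in auto)
    moreover have "?S * (x \<cdot>\<^sub>m ?L) = x \<cdot>\<^sub>m (?S * ?L)"
      using top_clear_carrier[OF X] cL by (rule mult_smult_distrib)
    moreover have "x \<cdot>\<^sub>m (e * A2) = ?F" using c A2 by (simp add: mult_smult_distrib)
    moreover have "x \<cdot>\<^sub>m four_block_mat (0\<^sub>m n n) et (e * A2) (lead n m X) =
        four_block_mat (x \<cdot>\<^sub>m 0\<^sub>m n n) (x \<cdot>\<^sub>m et) (x \<cdot>\<^sub>m (e * A2)) (x \<cdot>\<^sub>m lead n m X)"
      by (rule smult_four_block_mat[of _ n n _ ?N _ ?N])
        (use c ct A2 lead_carrier[OF X, of m] in auto)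
    ultimately show ?thesis by simp
  qed
  have STD: "?S * (?T * ?D) = four_block_mat (1\<^sub>m n) (0\<^sub>m n ?N) ?F M"
  proof -
    have b: "?F * 1\<^sub>m n = ?F" "?F * 0\<^sub>m n ?N = 0\<^sub>m ?N ?N"
      using F by (rule right_mult_one_mat, rule right_mult_zero_mat)
    have "?S * (?T * ?D) = (?S * ?T) * ?D"
      using top_clear_carrier[OF X] top_factor_carrier[OF A1] cD
      by (simp add: assoc_mult_mat[of _ "n + ?N" "n + ?N" _ "n + ?N" _ "n + ?N"])
    also have "\<dots> = four_block_mat (1\<^sub>m n) (0\<^sub>m n ?N) ?F (1\<^sub>m ?N) * four_block_mat (1\<^sub>m n) (0\<^sub>m n ?N) (0\<^sub>m ?N n) M"
      unfolding top_clear_top_factor[OF X A1] XA e_def[symmetric] using M by (auto simp: dsum_def)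
    also have "\<dots> = four_block_mat (1\<^sub>m n) (0\<^sub>m n ?N) ?F M"
      by (subst mult_four_block_mat[of _ n n _ ?N _ ?N _ _ n _ ?N]) (use F M b in auto)
    finally show ?thesis .
  qed
  have "?S * (x \<cdot>\<^sub>m ?L - ?T * ?D) = ?S * (x \<cdot>\<^sub>m ?L) - ?S * (?T * ?D)"
    by (rule mult_minus_distrib_mat[of _ "n + ?N" "n + ?N" _ "n + ?N"])
      (use top_clear_carrier[OF X] mult_carrier_mat[OF top_factor_carrier[OF A1] cD] cL in auto)
  also have "\<dots> = four_block_mat (- 1\<^sub>m n) (x \<cdot>\<^sub>m et) (0\<^sub>m ?N n) (x \<cdot>\<^sub>m lead n m X - M)"
    unfolding SL STD using F M ct lead_carrier[OF X, of m] by (intro eq_matI) auto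
  finally have eq: "?S * (x \<cdot>\<^sub>m ?L - ?T * ?D) = \<dots>" .
  have cF: "x \<cdot>\<^sub>m lead n m X - M \<in> carrier_mat ?N ?N" using lead_carrier[OF X, of m] M by auto
  define E where "E = x \<cdot>\<^sub>m et"
  have E: "x \<cdot>\<^sub>m et \<in> carrier_mat n ?N" and E': "E \<in> carrier_mat n ?N" using ct by (simp_all add: E_def)
  have 1: "- 1\<^sub>m n * - 1\<^sub>m n + E * 0\<^sub>m ?N n = 1\<^sub>m n"
    using E' by auto
  have 2: "- 1\<^sub>m n * E + E * 1\<^sub>m ?N = 0\<^sub>m n ?N" using E' by (auto simp: uminus_l_inv_mat[of _ n ?N])
  show ?thesis
    unfolding eq unfolding col_clear_def e_def[symmetric] et_def[symmetric] E_def[symmetric]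
    by (subst mult_four_block_mat[of _ n n _ ?N _ ?N _ _ n _ ?N]) (use 1 2 E' cF in \<open>auto simp: dsum_def\<close>)
qed

lemma top_factor_transpose:
  "X \<in> carrier_mat n n \<Longrightarrow> transpose_mat (top_factor n m X) = top_factor n m (transpose_mat X)"
  unfolding top_factor_def lead_def
  by (subst transpose_four_block_mat[of _ n n _ "n + m * n" _ "n + m * n"])
    (auto simp: dsum_transpose transpose_uminus)

lemma lead_transpose: "transpose_mat (lead n m X) = lead n m (transpose_mat X)"
  by (simp add: lead_def dsum_transpose)

lemma last_proj_transpose: "transpose_mat (last_proj n m) = last_proj n m"
  by (simp add: last_proj_def dsum_transpose)

lemma mpoly_at_transpose:
  "(\<And>i. i \<le> m \<Longrightarrow> A i \<in> carrier_mat n n) \<Longrightarrow>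
    transpose_mat (mpoly_at n m A x) = mpoly_at n m (\<lambda>i. transpose_mat (A i)) x"
  by (rule eq_matI) (fastforce simp: mpoly_at_def intro!: sum.cong)+

lemma mpoly_at_carrier [simp]: "mpoly_at n m A x \<in> carrier_mat n n"
  by (simp add: mpoly_at_def)

lemma mpoly_at_horner:
  assumes "\<And>i. i \<le> Suc m \<Longrightarrow> A i \<in> carrier_mat n n"
  shows "mpoly_at n m (A(m := x \<cdot>\<^sub>m A (Suc m) + A m)) x = mpoly_at n (Suc m) A x"
proof (rule eq_matI)
  fix i j assume "i < dim_row (mpoly_at n (Suc m) A x)" "j < dim_col (mpoly_at n (Suc m) A x)"
  then have ij: "i < n" "j < n" by (simp_all add: mpoly_at_def)
  let ?A' = "A(m := x \<cdot>\<^sub>m A (Suc m) + A m)"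
  have "(\<Sum>k\<le>m. x ^ k * ?A' k $$ (i, j)) = (\<Sum>k<m. x ^ k * A k $$ (i, j)) + x ^ m * (x * A (Suc m) $$ (i, j) + A m $$ (i, j))"
    using ij assms[of m] assms[of "Suc m"]
    by (simp add: lessThan_Suc_atMost[symmetric])
  also have "\<dots> = (\<Sum>k\<le>Suc m. x ^ k * A k $$ (i, j))"
    by (simp add: lessThan_Suc_atMost[symmetric] algebra_simps)
  finally show "mpoly_at n m ?A' x $$ (i, j) = mpoly_at n (Suc m) A x $$ (i, j)"
    using ij by (simp add: mpoly_at_def)
qed (auto simp: mpoly_at_def)

lemma factor_carrier [simp]:
  "(\<And>i. i \<le> m \<Longrightarrow> A i \<in> carrier_mat n n) \<Longrightarrow> factor n A m i \<in> carrier_mat (n + m * n) (n + m * n)"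
  by (induction m) auto

lemma factor_cong: "(\<And>i. i \<le> m \<Longrightarrow> A i = B i) \<Longrightarrow> factor n A m i = factor n B m i"
  by (induction m) auto

lemma factor_transpose:
  "(\<And>i. i \<le> m \<Longrightarrow> A i \<in> carrier_mat n n) \<Longrightarrow>
    transpose_mat (factor n A m i) = factor n (\<lambda>i. transpose_mat (A i)) m i"
  by (induction m) (auto simp: top_factor_transpose dsum_transpose transpose_uminus)

lemma last_proj_Suc: "last_proj n (Suc m) = dsum (0\<^sub>m n n) (last_proj n m)"
  by (simp add: last_proj_def dsum_assoc)

text \<open>The factor of index \<open>i\<close> differs from the identity in at most two adjacent block rows and columns, and these are
  disjoint for indices that differ by at least two.\<close>

lemma factor_commute:
  assumes "\<And>i. i \<le> m \<Longrightarrow> A i \<in> carrier_mat n n" "Suc i < j" "j \<le> m"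
  shows "factor n A m i * factor n A m j = factor n A m j * factor n A m i"
  using assms
proof (induction m)
  case 0
  then show ?case by simp
next
  case (Suc m)
  let ?N = "n + m * n"
  show ?case
  proof (cases "j = Suc m")
    case False
    have c: "factor n A m k \<in> carrier_mat ?N ?N" for k using Suc.prems by simp
    show ?thesis
      using False Suc.prems Suc.IH by (simp add: dsum_mult[of _ n n _ ?N ?N _ n _ ?N] c)
  next
    case True
    then obtain k where m: "m = Suc k" and i: "i \<le> k" using Suc.prems by (cases m) auto
    let ?K = "n + k * n"
    define F where "F = factor n A k i"
    have F: "F \<in> carrier_mat ?K ?K" using Suc.prems m by (simp add: F_def)
    define X where "X = A (Suc m)"
    have X: "X \<in> carrier_mat n n" using Suc.prems by (simp add: X_def)
    have eq: "factor n A (Suc m) i = dsum (1\<^sub>m (n + n)) F"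
      using i m by (simp add: F_def dsum_assoc)
    have D: "dsum (1\<^sub>m (n + n)) F \<in> carrier_mat ((n + n) + ?K) ((n + n) + ?K)" using F by simp
    have "top_factor n m X = dsum (four_block_mat (- X) (1\<^sub>m n) (1\<^sub>m n) (0\<^sub>m n n)) (1\<^sub>m ?K)"
      using X unfolding m by (intro eq_matI) (auto simp: top_factor_def dsum_def lead_def first_unit_def)
    moreover have B: "four_block_mat (- X) (1\<^sub>m n) (1\<^sub>m n) (0\<^sub>m n n) \<in> carrier_mat (n + n) (n + n)"
      using X by auto
    ultimately have "dsum (1\<^sub>m (n + n)) F * top_factor n m X = top_factor n m X * dsum (1\<^sub>m (n + n)) F"
      using F left_mult_one_mat[OF B] right_mult_one_mat[OF B] by (simp add: dsum_mult[of _ "n + n" "n + n" _ ?K ?K _ "n + n" _ ?K])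
    then show ?thesis
      unfolding eq using True by (simp add: X_def)
  qed
qed

text \<open>With at least three block rows the factor of largest index does not meet the last one.\<close>

lemma top_factor_last_proj:
  assumes X: "X \<in> carrier_mat n n"
  shows "top_factor n (Suc m) X * last_proj n (Suc (Suc m)) = last_proj n (Suc (Suc m))"
    and "last_proj n (Suc (Suc m)) * top_factor n (Suc m) X = last_proj n (Suc (Suc m))"
proof -
  let ?K = "n + m * n"
  let ?B = "four_block_mat (- X) (1\<^sub>m n) (1\<^sub>m n) (0\<^sub>m n n)"
  have T: "top_factor n (Suc m) X = dsum ?B (1\<^sub>m ?K)"
    using X by (intro eq_matI) (auto simp: top_factor_def dsum_def lead_def first_unit_def)
  have B: "?B \<in> carrier_mat (n + n) (n + n)" using X by auto
  have L: "last_proj n (Suc (Suc m)) = dsum (0\<^sub>m (n + n) (n + n)) (last_proj n m)"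
    by (simp add: last_proj_Suc dsum_assoc)
  have one: "1\<^sub>m ?K * last_proj n m = (last_proj n m :: 'a mat)" "last_proj n m * 1\<^sub>m ?K = (last_proj n m :: 'a mat)"
    by (simp_all add: left_mult_one_mat[of _ ?K ?K] right_mult_one_mat[of _ ?K ?K])
  show "top_factor n (Suc m) X * last_proj n (Suc (Suc m)) = last_proj n (Suc (Suc m))"
    "last_proj n (Suc (Suc m)) * top_factor n (Suc m) X = last_proj n (Suc (Suc m))"
    unfolding T L using B right_mult_zero_mat[OF B, of "n + n"] left_mult_zero_mat[OF B, of "n + n"]
      one
    by (simp_all add: dsum_mult[of _ "n + n" "n + n" _ ?K ?K _ "n + n" _ ?K])
qed

lemma factors_Nil [simp]: "factors n A m [] = 1\<^sub>m (n + m * n)"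
  by (simp add: factors_def)

lemma factors_Cons: "factors n A m (i # xs) = factor n A m i * factors n A m xs"
  by (simp add: factors_def)

context
  fixes A :: "nat \<Rightarrow> 'a::comm_ring_1 mat" and n m :: nat
  assumes A: "\<And>i. i \<le> m \<Longrightarrow> A i \<in> carrier_mat n n"
begin

lemma factors_carrier [simp]: "factors n A m xs \<in> carrier_mat (n + m * n) (n + m * n)"
  by (induction xs) (use A in \<open>auto simp: factors_Cons intro!: mult_carrier_mat[of _ _ "n + m * n"]\<close>)

lemma factors_append: "factors n A m (xs @ ys) = factors n A m xs * factors n A m ys"
proof (induction xs)
  case (Cons i xs)
  have "factor n A m i * (factors n A m xs * factors n A m ys) = factor n A m i * factors n A m xs * factors n A m ys"
    by (rule assoc_mult_mat[symmetric, of _ "n + m * n" "n + m * n" _ "n + m * n" _ "n + m * n"]) (use A in auto)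
  then show ?case by (simp add: factors_Cons Cons.IH)
qed (simp add: left_mult_one_mat[OF factors_carrier])

lemma factors_commute:
  assumes "t \<le> m" "\<And>i. i \<in> set xs \<Longrightarrow> i \<le> m \<and> (Suc i < t \<or> Suc t < i)"
  shows "factors n A m xs * factor n A m t = factor n A m t * factors n A m xs"
  using assms(2)
proof (induction xs)
  case Nil
  then show ?case using A by (simp add: left_mult_one_mat[OF factor_carrier] right_mult_one_mat[OF factor_carrier])
next
  case (Cons i xs)
  let ?N = "n + m * n"
  define F G H where defs: "F = factor n A m i" "G = factor n A m t" "H = factors n A m xs"
  have c: "F \<in> carrier_mat ?N ?N" "G \<in> carrier_mat ?N ?N" "H \<in> carrier_mat ?N ?N" using A by (auto simp: defs)
  have FG: "F * G = G * F"
    unfolding defs using Cons.prems[of i] assms(1)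
      factor_commute[of m A n i t] factor_commute[of m A n t i] A by auto
  have "F * H * G = F * (H * G)" using c by simp
  also have "H * G = G * H" using Cons.IH Cons.prems by (simp add: defs)
  also have "F * (G * H) = F * G * H" using c by simp
  also have "\<dots> = G * (F * H)" using c by (simp add: FG)
  finally show ?case by (simp add: factors_Cons defs)
qed

end

lemma factors_Suc:
  assumes A: "\<And>i. i \<le> Suc m \<Longrightarrow> A i \<in> carrier_mat n n" and "Suc m \<notin> set xs"
  shows "factors n A (Suc m) xs = dsum (1\<^sub>m n) (factors n A m xs)"
  using assms(2)
proof (induction xs)
  case (Cons i xs)
  have "dsum (1\<^sub>m n) (factor n A m i) * dsum (1\<^sub>m n) (factors n A m xs) = dsum (1\<^sub>m n) (factor n A m i * factors n A m xs)"
    by (subst dsum_mult[of _ n n _ "n + m * n" "n + m * n" _ n _ "n + m * n"]) (use A in auto)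
  then show ?case using Cons by (simp add: factors_Cons)
qed auto

lemma factors_cong: "(\<And>i. i \<le> m \<Longrightarrow> A i = B i) \<Longrightarrow> factors n A m xs = factors n B m xs"
  unfolding factors_def using factor_cong[of m A B n] by (auto intro: foldr_cong)

lemma factors_transpose:
  assumes A: "\<And>i. i \<le> m \<Longrightarrow> A i \<in> carrier_mat n n"
  shows "transpose_mat (factors n A m xs) = factors n (\<lambda>i. transpose_mat (A i)) m (rev xs)"
proof (induction xs)
  case (Cons i xs)
  let ?N = "n + m * n" and ?A = "\<lambda>i. transpose_mat (A i)"
  have A': "?A i \<in> carrier_mat n n" if "i \<le> m" for i using A[OF that] by simp
  have c: "factor n A m i \<in> carrier_mat ?N ?N" "factors n A m xs \<in> carrier_mat ?N ?N"
    "factor n ?A m i \<in> carrier_mat ?N ?N"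
    using A A' by simp_all
  have "transpose_mat (factors n A m (i # xs)) = factors n ?A m (rev xs) * factor n ?A m i"
    using transpose_mult[OF c(1,2)] Cons by (simp add: factors_Cons factor_transpose[OF A])
  also have "factor n ?A m i = factors n ?A m [i]"
    by (simp only: factors_Cons factors_Nil right_mult_one_mat[OF c(3)])
  also have "factors n ?A m (rev xs) * factors n ?A m [i] = factors n ?A m (rev xs @ [i])"
    using A' by (intro factors_append[symmetric])
  finally show ?case by simp
qed simp

context scalar_subring
begin

lemma first_unit_mats: "first_unit n (Suc m) \<in> mats (n + m * n) n"
  by (auto simp: mats_def first_unit_def)

lemma lead_mats: "X \<in> mats n n \<Longrightarrow> lead n m X \<in> mats (n + m * n) (n + m * n)"
  unfolding lead_def by (auto intro: mats_dsum)

lemma top_clear_GL: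
  assumes X: "X \<in> mats n n"
  shows "top_clear n m X \<in> GL (n + (n + m * n))"
proof (rule GL_I)
  have X': "X \<in> carrier_mat n n" using X by auto
  show "top_clear n m X \<in> mats (n + (n + m * n)) (n + (n + m * n))"
    unfolding top_clear_def using X
    by (intro mats_four_block mats_transpose first_unit_mats lead_mats) auto
  show "top_factor n m X \<in> mats (n + (n + m * n)) (n + (n + m * n))"
    unfolding top_factor_def using X
    by (intro mats_four_block mats_transpose first_unit_mats lead_mats) (auto intro: mats_uminus)
  show "top_clear n m X * top_factor n m X = 1\<^sub>m (n + (n + m * n))"
    by (rule top_clear_top_factor_same[OF X'])
  show "top_factor n m X * top_clear n m X = 1\<^sub>m (n + (n + m * n))"
    by (rule top_factor_top_clear[OF X'])
qed

lemma col_clear_GL: "x \<in> R \<Longrightarrow> col_clear n m x \<in> GL (n + (n + m * n))"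
proof -
  assume "x \<in> R"
  then have "col_clear n m x \<in> mats (n + (n + m * n)) (n + (n + m * n))"
    unfolding col_clear_def
    by (intro mats_four_block mats_smult mats_transpose first_unit_mats mats_uminus mats_one mats_zero)
  then show ?thesis by (intro GL_I[of _ _ "col_clear n m x"] col_clear_inverse)
qed

text \<open>Here \<open>M\<close> stands for a product of Fiedler matrices, and \<open>Na\<close>, \<open>Nb\<close> for the parts to the left and to the right of
  the factor of index 0. The last two conditions control how \<open>U\<close> and \<open>V\<close> act on blocks bordering the pencil, which
  the equivalence of pencils alone leaves open.\<close>

definition linearizes ::
  "nat \<Rightarrow> nat \<Rightarrow> (nat \<Rightarrow> 'a mat) \<Rightarrow> 'a \<Rightarrow> 'a mat \<Rightarrow> 'a mat \<Rightarrow> 'a mat \<Rightarrow> bool" where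
  "linearizes n m A x M Na Nb \<longleftrightarrow>
     (\<exists>U \<in> GL (n + m * n). \<exists>V \<in> GL (n + m * n).
        U * (x \<cdot>\<^sub>m lead n m (A (Suc m)) - M) * V = dsum (1\<^sub>m (m * n)) (mpoly_at n (Suc m) A x) \<and>
        U * Na * last_proj n m = last_proj n m \<and> last_proj n m * Nb * V = last_proj n m)"

text \<open>Transposition reverses products, hence exchanges \<open>Na\<close> and \<open>Nb\<close>. It reduces every statement about a factor on
  the right to one about a factor on the left.\<close>

lemma linearizes_transpose:
  assumes A: "\<And>i. i \<le> Suc m \<Longrightarrow> A i \<in> carrier_mat n n"
    and c: "M \<in> carrier_mat (n + m * n) (n + m * n)" "Na \<in> carrier_mat (n + m * n) (n + m * n)"
      "Nb \<in> carrier_mat (n + m * n) (n + m * n)"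
    and lin: "linearizes n m (\<lambda>i. transpose_mat (A i)) x (transpose_mat M) (transpose_mat Nb) (transpose_mat Na)"
  shows "linearizes n m A x M Na Nb"
proof -
  let ?N = "n + m * n"
  define F where "F = x \<cdot>\<^sub>m lead n m (A (Suc m)) - M"
  define G where "G = dsum (1\<^sub>m (m * n)) (mpoly_at n (Suc m) A x)"
  define L where "L = (last_proj n m :: 'a mat)"
  have F: "F \<in> carrier_mat ?N ?N" using A c by (auto simp: F_def)
  have G: "G \<in> carrier_mat ?N ?N" unfolding G_def using dsum_carrier[of "1\<^sub>m (m * n)" "m * n" "m * n"]
    by (metis add.commute mpoly_at_carrier one_carrier_mat)
  have L: "L \<in> carrier_mat ?N ?N" "transpose_mat L = L" by (auto simp: L_def last_proj_transpose)
  have Ft: "transpose_mat F = x \<cdot>\<^sub>m lead n m (transpose_mat (A (Suc m))) - transpose_mat M"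
    unfolding F_def using lead_carrier[OF A[of "Suc m"], of m] c by (intro eq_matI) (auto simp: lead_transpose[symmetric])
  have Gt: "transpose_mat G = dsum (1\<^sub>m (m * n)) (mpoly_at n (Suc m) (\<lambda>i. transpose_mat (A i)) x)"
    unfolding G_def using A by (simp add: dsum_transpose mpoly_at_transpose)
  obtain U V where UV: "U \<in> GL ?N" "V \<in> GL ?N"
    and e: "U * transpose_mat F * V = transpose_mat G"
      "U * transpose_mat Nb * L = L" "L * transpose_mat Na * V = L"
    using lin unfolding linearizes_def Ft Gt L_def by blast
  have cUV: "U \<in> carrier_mat ?N ?N" "V \<in> carrier_mat ?N ?N" using UV by auto
  have tr: "transpose_mat (X * Y * Z) = transpose_mat Z * transpose_mat Y * transpose_mat X"
    if "X \<in> carrier_mat ?N ?N" "Y \<in> carrier_mat ?N ?N" "Z \<in> carrier_mat ?N ?N" for X Y Z :: "'a mat"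
    using that by (simp add: transpose_mult[of _ ?N ?N _ ?N] assoc_mult_mat[of _ ?N ?N _ ?N _ ?N])
  have "transpose_mat V * F * transpose_mat U = G"
    using tr[of U "transpose_mat F" V] F cUV unfolding e(1) by simp
  moreover have "L * Nb * transpose_mat U = L"
    using tr[of U "transpose_mat Nb" L] c cUV L unfolding e(2) by simp
  moreover have "transpose_mat V * Na * L = L"
    using tr[of L "transpose_mat Na" V] c cUV L unfolding e(3) by simp
  ultimately show ?thesis
    unfolding linearizes_def F_def G_def L_def using GL_transpose[OF UV(1)] GL_transpose[OF UV(2)] by blast
qed

text \<open>The equivalence is \<open>fiedler_step\<close> followed by the equivalence of the smaller pencil. The border conditions
  survive because the clearing matrices, after cancellation with the new factor, fix whatever vanishes in the first
  block.\<close>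

lemma linearizes_left_step:
  assumes A: "\<And>i. i \<le> Suc (Suc m) \<Longrightarrow> A i \<in> mats n n" and x: "x \<in> R"
    and c: "M \<in> carrier_mat (n + m * n) (n + m * n)" "Na \<in> carrier_mat (n + m * n) (n + m * n)"
      "Nb \<in> carrier_mat (n + m * n) (n + m * n)"
    and lin: "linearizes n m (A(Suc m := x \<cdot>\<^sub>m A (Suc (Suc m)) + A (Suc m))) x M Na Nb"
  shows "linearizes n (Suc m) A x (top_factor n m (A (Suc m)) * dsum (1\<^sub>m n) M)
    (top_factor n m (A (Suc m)) * dsum (1\<^sub>m n) Na) (dsum (1\<^sub>m n) Nb)"
proof -
  let ?N = "n + m * n"
  let ?N' = "n + ?N"
  define X where "X = x \<cdot>\<^sub>m A (Suc (Suc m)) + A (Suc m)"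
  have X: "X \<in> mats n n" using A x by (auto simp: X_def intro!: mats_add mats_smult)
  have Ac: "A i \<in> carrier_mat n n" if "i \<le> Suc (Suc m)" for i using A[OF that] by auto
  have Xc: "X \<in> carrier_mat n n" using X by auto
  define S where "S = top_clear n m X"
  define T where "T = top_factor n m (A (Suc m))"
  define C where "C = col_clear n m x"
  define F where "F = x \<cdot>\<^sub>m lead n m X - M"
  define F' where "F' = x \<cdot>\<^sub>m lead n (Suc m) (A (Suc (Suc m))) - T * dsum (1\<^sub>m n) M"
  define L where "L = (last_proj n m :: 'a mat)"
  define D where "D = (\<lambda>Y::'a mat. dsum (1\<^sub>m n) Y)"
  have P: "mpoly_at n (Suc m) (A(Suc m := X)) x = mpoly_at n (Suc (Suc m)) A x"
    unfolding X_def by (rule mpoly_at_horner) (use Ac in auto)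
  obtain U V where UV: "U \<in> GL ?N" "V \<in> GL ?N"
    and e: "U * F * V = dsum (1\<^sub>m (m * n)) (mpoly_at n (Suc (Suc m)) A x)"
      "U * Na * L = L" "L * Nb * V = L"
    using lin unfolding linearizes_def X_def[symmetric] P L_def F_def by auto
  have cUV: "U \<in> carrier_mat ?N ?N" "V \<in> carrier_mat ?N ?N" using UV by auto
  have cD: "D Y \<in> carrier_mat ?N' ?N'" if "Y \<in> carrier_mat ?N ?N" for Y using that by (simp add: D_def)
  have mD: "D Y * D Z = D (Y * Z)" if "Y \<in> carrier_mat ?N ?N" "Z \<in> carrier_mat ?N ?N" for Y Z
    unfolding D_def using that by (simp add: dsum_mult[of _ n n _ ?N ?N _ n _ ?N])
  define L' where "L' = dsum (0\<^sub>m n n) L"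
  have L: "L \<in> carrier_mat ?N ?N" by (simp add: L_def)
  have mDL: "D Y * dsum (0\<^sub>m n n) Z = dsum (0\<^sub>m n n) (Y * Z)"
    "dsum (0\<^sub>m n n) Z * D Y = dsum (0\<^sub>m n n) (Z * Y)"
    if "Y \<in> carrier_mat ?N ?N" "Z \<in> carrier_mat ?N ?N" for Y Z
    unfolding D_def using that by (simp_all add: dsum_mult[of _ n n _ ?N ?N _ n _ ?N])
  have cS: "S \<in> carrier_mat ?N' ?N'" and cT: "T \<in> carrier_mat ?N' ?N'" and cC: "C \<in> carrier_mat ?N' ?N'"
    using Xc Ac by (simp_all add: S_def T_def C_def)
  have cF: "F \<in> carrier_mat ?N ?N" unfolding F_def by (rule minus_carrier_mat[OF c(1)])
  have cF': "F' \<in> carrier_mat ?N' ?N'"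
    using cD[OF c(1)] cT by (auto simp: F'_def D_def intro!: minus_carrier_mat mult_carrier_mat[of _ ?N' ?N'])
  have step: "S * F' * C = D F"
    unfolding S_def F'_def C_def D_def F_def T_def X_def by (rule fiedler_step) (use Ac c in auto)
  have cDU: "D U \<in> carrier_mat ?N' ?N'" "D V \<in> carrier_mat ?N' ?N'" using cD cUV by auto
  have "(D U * S) * F' * (C * D V) = D U * (S * F' * C) * D V"
    using cDU cS cF' cC by (simp add: assoc_mult_mat[of _ ?N' ?N' _ ?N' _ ?N'])
  also have "\<dots> = D (U * F * V)"
    unfolding step using cUV cF by (simp add: mD)
  also have "\<dots> = dsum (1\<^sub>m (Suc m * n)) (mpoly_at n (Suc (Suc m)) A x)"
    unfolding e D_def by (simp add: dsum_assoc)
  finally have 1: "(D U * S) * F' * (C * D V) = \<dots>" .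
  define K where "K = first_unit n (Suc m) * (X - A (Suc m))"
  have K: "K \<in> carrier_mat ?N n"
    unfolding K_def using first_unit_carrier'[of n m] Xc Ac[of "Suc m"] by (auto intro!: mult_carrier_mat)
  have NaL: "Na * L \<in> carrier_mat ?N ?N" and LNb: "L * Nb \<in> carrier_mat ?N ?N" using c L by auto
  have ST: "S * T = four_block_mat (1\<^sub>m n) (0\<^sub>m n ?N) K (1\<^sub>m ?N)"
    unfolding S_def T_def K_def by (rule top_clear_top_factor) (use Xc Ac in auto)
  have "(D U * S) * (T * D Na) * L' = D U * ((S * T) * (D Na * L'))"
    using cDU cS cT cD[OF c(2)] L by (simp add: assoc_mult_mat[of _ ?N' ?N' _ ?N' _ ?N'] L'_def)
  also have "D Na * L' = dsum (0\<^sub>m n n) (Na * L)" unfolding L'_def using mDL c L by simp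
  also have "(S * T) * dsum (0\<^sub>m n n) (Na * L) = dsum (0\<^sub>m n n) (Na * L)"
  proof -
    have "dsum (0\<^sub>m n n) (Na * L) = four_block_mat (0\<^sub>m n n) (0\<^sub>m n ?N) (0\<^sub>m ?N n) (Na * L)"
      using c L by (auto simp: dsum_def)
    moreover have "four_block_mat (1\<^sub>m n) (0\<^sub>m n ?N) K (1\<^sub>m ?N) * \<dots> = \<dots>"
      by (subst mult_four_block_mat[of _ n n _ ?N _ ?N _ _ n _ ?N])
        (use K NaL right_mult_zero_mat[OF K] left_mult_one_mat[OF NaL] left_mult_zero_mat[OF NaL] in auto)
    ultimately show ?thesis by (simp add: ST)
  qed
  also have "D U * dsum (0\<^sub>m n n) (Na * L) = L'"
    unfolding L'_def using mDL(1)[OF cUV(1) NaL] e(2) cUV c L by simp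
  finally have 2: "(D U * S) * (T * D Na) * L' = L'" .
  have "L' * D Nb * (C * D V) = ((L' * D Nb) * C) * D V"
    using cDU cC cD[OF c(3)] L by (simp add: assoc_mult_mat[of _ ?N' ?N' _ ?N' _ ?N'] L'_def)
  moreover have "L' * D Nb = dsum (0\<^sub>m n n) (L * Nb)" unfolding L'_def using mDL c L by simp
  moreover have "dsum (0\<^sub>m n n) (L * Nb) * C = dsum (0\<^sub>m n n) (L * Nb)"
  proof -
    define E where "E = x \<cdot>\<^sub>m transpose_mat (first_unit n (Suc m))"
    have E: "E \<in> carrier_mat n ?N" by (simp add: E_def)
    have "dsum (0\<^sub>m n n) (L * Nb) = four_block_mat (0\<^sub>m n n) (0\<^sub>m n ?N) (0\<^sub>m ?N n) (L * Nb)"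
      using c L by (auto simp: dsum_def)
    moreover have "\<dots> * four_block_mat (- 1\<^sub>m n) E (0\<^sub>m ?N n) (1\<^sub>m ?N) = \<dots>"
      by (subst mult_four_block_mat[of _ n n _ ?N _ ?N _ _ n _ ?N])
        (use E LNb left_mult_zero_mat[OF E] right_mult_one_mat[OF LNb] right_mult_zero_mat[OF LNb] in auto)
    ultimately show ?thesis unfolding C_def col_clear_def E_def[symmetric] by simp
  qed
  moreover have "dsum (0\<^sub>m n n) (L * Nb) * D V = L'"
    unfolding L'_def using mDL(2)[OF cUV(2) LNb] e(3) by simp
  ultimately have 3: "L' * D Nb * (C * D V) = L'" by (simp only:)
  have gl: "D U * S \<in> GL ?N'" "C * D V \<in> GL ?N'"
    using UV X x by (auto simp: D_def S_def C_def intro!: GL_mult GL_dsum top_clear_GL col_clear_GL)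
  show ?thesis
    unfolding linearizes_def last_proj_Suc L_def[symmetric] L'_def[symmetric] T_def[symmetric]
    using gl 1 2 3 unfolding F'_def D_def by auto
qed

lemma linearizes_right_step:
  assumes A: "\<And>i. i \<le> Suc (Suc m) \<Longrightarrow> A i \<in> mats n n" and x: "x \<in> R"
    and c: "M \<in> carrier_mat (n + m * n) (n + m * n)" "Na \<in> carrier_mat (n + m * n) (n + m * n)"
      "Nb \<in> carrier_mat (n + m * n) (n + m * n)"
    and lin: "linearizes n m (A(Suc m := x \<cdot>\<^sub>m A (Suc (Suc m)) + A (Suc m))) x M Na Nb"
  shows "linearizes n (Suc m) A x (dsum (1\<^sub>m n) M * top_factor n m (A (Suc m)))
    (dsum (1\<^sub>m n) Na) (dsum (1\<^sub>m n) Nb * top_factor n m (A (Suc m)))"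
proof -
  let ?N = "n + m * n"
  let ?t = "transpose_mat :: 'a mat \<Rightarrow> 'a mat"
  let ?X = "x \<cdot>\<^sub>m A (Suc (Suc m)) + A (Suc m)"
  have Ac: "A i \<in> carrier_mat n n" if "i \<le> Suc (Suc m)" for i using A[OF that] by auto
  have X: "?t ?X = x \<cdot>\<^sub>m ?t (A (Suc (Suc m))) + ?t (A (Suc m))"
    using Ac[of "Suc (Suc m)"] Ac[of "Suc m"] by (intro eq_matI) auto
  define B where "B = A(Suc m := ?X)"
  have Bc: "B i \<in> carrier_mat n n" if "i \<le> Suc m" for i
    using Ac[of "Suc (Suc m)"] Ac[of i] Ac[of "Suc m"] that by (simp add: B_def)
  have "linearizes n m (\<lambda>i. ?t (B i)) x (?t M) (?t Nb) (?t Na)"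
    by (rule linearizes_transpose) (use Bc c lin in \<open>auto simp: B_def[symmetric]\<close>)
  also have "(\<lambda>i. ?t (B i)) = (\<lambda>i. ?t (A i))(Suc m := x \<cdot>\<^sub>m ?t (A (Suc (Suc m))) + ?t (A (Suc m)))"
    using X by (auto simp: B_def)
  finally have lt0: "linearizes n m ((\<lambda>i. ?t (A i))(Suc m := x \<cdot>\<^sub>m ?t (A (Suc (Suc m))) + ?t (A (Suc m)))) x (?t M) (?t Nb) (?t Na)" .
  have lt: "linearizes n (Suc m) (\<lambda>i. ?t (A i)) x (top_factor n m (?t (A (Suc m))) * dsum (1\<^sub>m n) (?t M))
    (top_factor n m (?t (A (Suc m))) * dsum (1\<^sub>m n) (?t Nb)) (dsum (1\<^sub>m n) (?t Na))"
    by (rule linearizes_left_step[OF _ x _ _ _ lt0]) (use A c in \<open>auto intro: mats_transpose\<close>)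
  let ?T = "top_factor n m (A (Suc m))"
  have T: "?T \<in> carrier_mat (n + ?N) (n + ?N)" "?t ?T = top_factor n m (?t (A (Suc m)))"
    using Ac top_factor_transpose[of "A (Suc m)" n m] by auto
  have DT: "?t (dsum (1\<^sub>m n) Y * ?T) = ?t ?T * dsum (1\<^sub>m n) (?t Y)"
    "dsum (1\<^sub>m n) Y * ?T \<in> carrier_mat (n + ?N) (n + ?N)" if "Y \<in> carrier_mat ?N ?N" for Y
    using that T(1) dsum_carrier[of "1\<^sub>m n" n n Y ?N ?N] mult_carrier_mat[of "dsum (1\<^sub>m n) Y" "n + ?N" "n + ?N" ?T "n + ?N"]
    by (simp_all add: transpose_mult[of _ "n + ?N" "n + ?N" _ "n + ?N"] dsum_transpose)
  show ?thesis
    by (rule linearizes_transpose)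
      (use Ac c T DT lt in \<open>auto simp: dsum_transpose\<close>)
qed

text \<open>Only the action of \<open>Na\<close> and \<open>Nb\<close> on the last block matters. This is used when a factor changes from one side
  of the factor of index 0 to the other.\<close>

lemma linearizes_cong:
  assumes "linearizes n m A x M Na Nb"
    and "Na \<in> carrier_mat (n + m * n) (n + m * n)" "Nb \<in> carrier_mat (n + m * n) (n + m * n)"
      "Na' \<in> carrier_mat (n + m * n) (n + m * n)" "Nb' \<in> carrier_mat (n + m * n) (n + m * n)"
    and "Na' * last_proj n m = Na * last_proj n m" "last_proj n m * Nb' = last_proj n m * Nb"
  shows "linearizes n m A x M Na' Nb'"
proof -
  let ?N = "n + m * n"
  obtain U V where UV: "U \<in> GL ?N" "V \<in> GL ?N"
    and e: "U * (x \<cdot>\<^sub>m lead n m (A (Suc m)) - M) * V = dsum (1\<^sub>m (m * n)) (mpoly_at n (Suc m) A x)"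
      "U * Na * last_proj n m = last_proj n m" "last_proj n m * Nb * V = last_proj n m"
    using assms(1) unfolding linearizes_def by blast
  have c: "U \<in> carrier_mat ?N ?N" "V \<in> carrier_mat ?N ?N" "last_proj n m \<in> carrier_mat ?N ?N"
    using UV by auto
  have "U * Na' * last_proj n m = U * (Na' * last_proj n m)"
    using c assms(2-5) by (intro assoc_mult_mat)
  also have "\<dots> = U * Na * last_proj n m"
    using c assms(2-5) unfolding assms(6) by (intro assoc_mult_mat[symmetric])
  finally have "U * Na' * last_proj n m = last_proj n m" using e by simp
  moreover have "last_proj n m * Nb' * V = last_proj n m"
    using assms(7) e by simp
  ultimately show ?thesis unfolding linearizes_def using UV e by blast
qed

text \<open>The factor \<open>T\<close> of largest index \<open>m + 1\<close> commutes with all others except that of index \<open>m\<close>. If the index \<open>m\<close>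
  does not occur before it, \<open>T\<close> moves to the left end. Otherwise \<open>T\<close> moves to the right end and thereby across the
  factor of index 0; then \<open>m > 0\<close>, and \<open>T\<close> fixes the last block.\<close>

lemma linearizes_insert_left:
  assumes A: "\<And>i. i \<le> Suc (Suc m) \<Longrightarrow> A i \<in> mats n n" and x: "x \<in> R"
    and IH: "\<And>A a b. (\<And>i. i \<le> Suc m \<Longrightarrow> A i \<in> mats n n) \<Longrightarrow> distinct (a @ 0 # b) \<Longrightarrow>
      set (a @ 0 # b) = {0..m} \<Longrightarrow>
      linearizes n m A x (factors n A m (a @ 0 # b)) (factors n A m a) (factors n A m b)"
    and dist: "distinct (a @ 0 # b)" and set_ab: "set (a @ 0 # b) = {0..Suc m}" and in_a: "Suc m \<in> set a"
  shows "linearizes n (Suc m) A x (factors n A (Suc m) (a @ 0 # b)) (factors n A (Suc m) a)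
    (factors n A (Suc m) b)"
proof -
  let ?N = "n + m * n"
  let ?N' = "n + (n + m * n)"
  define t where "t = Suc m"
  define T where "T = top_factor n m (A t)"
  define A' where "A' = A(Suc m := x \<cdot>\<^sub>m A (Suc (Suc m)) + A (Suc m))"
  let ?F = "factors n A (Suc m)" and ?F' = "factors n A' m"
  define L where "L = (last_proj n (Suc m) :: 'a mat)"
  have Am: "A i \<in> carrier_mat n n" if "i \<le> Suc m" for i using A[of i] that by auto
  have A'm: "A' i \<in> mats n n" if "i \<le> Suc m" for i
    using A[of i] A[of "Suc (Suc m)"] A[of "Suc m"] that x
    by (auto simp: A'_def intro!: mats_add mats_smult)
  have cF: "?F ys \<in> carrier_mat ?N' ?N'" for ys using factors_carrier[of "Suc m" A n ys] Am by simp
  have cF': "?F' ys \<in> carrier_mat ?N ?N" for ys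
    by (rule factors_carrier) (rule mats_carrier[OF A'm], simp)
  have cT: "T \<in> carrier_mat ?N' ?N'" using Am by (simp add: T_def t_def)
  have cL: "L \<in> carrier_mat ?N' ?N'" unfolding L_def using last_proj_carrier[of n "Suc m"] by simp
  have F: "?F ys = dsum (1\<^sub>m n) (?F' ys)" if "t \<notin> set ys" for ys
  proof -
    have "factors n A m ys = ?F' ys" by (rule factors_cong) (simp add: A'_def)
    then show ?thesis using factors_Suc[of m A n ys] Am that by (simp add: t_def)
  qed
  have FT: "?F (ys @ t # zs) = ?F ys * (T * ?F zs)" for ys zs
    using Am by (simp add: factors_append factors_Cons T_def t_def)
  have comm: "?F ys * T = T * ?F ys" if "set ys \<subseteq> {0..t}" "m \<notin> set ys" "t \<notin> set ys" for ys
  proof -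
    have less: "i < m" if "i \<in> set ys" for i
    proof -
      have "i \<le> Suc m" "i \<noteq> m" "i \<noteq> Suc m" using that \<open>set ys \<subseteq> {0..t}\<close> \<open>m \<notin> set ys\<close> \<open>t \<notin> set ys\<close> by (auto simp: t_def)
      then show ?thesis by simp
    qed
    have "?F ys * factor n A (Suc m) t = factor n A (Suc m) t * ?F ys"
      by (rule factors_commute) (use less Am in \<open>fastforce simp: t_def\<close>)+
    then show ?thesis by (simp add: T_def t_def)
  qed
  have TL: "T * L = L" "L * T = L" if "m \<noteq> 0"
  proof -
    obtain k where "m = Suc k" using \<open>m \<noteq> 0\<close> by (cases m) auto
    then show "T * L = L" "L * T = L"
      unfolding T_def L_def t_def using top_factor_last_proj[of "A (Suc m)" n k] Am[of "Suc m"] by auto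
  qed
  have app: "?F (ys @ zs) = ?F ys * ?F zs" for ys zs using Am by (simp add: factors_append)
  note as = assoc_mult_mat[of _ ?N' ?N' _ ?N' _ ?N']
  have swap: "X * (Y * Z) = Y * (X * Z)"
    if "X * Y = Y * X" "X \<in> carrier_mat ?N' ?N'" "Y \<in> carrier_mat ?N' ?N'" "Z \<in> carrier_mat ?N' ?N'" for X Y Z
    using that as[of X Y Z] as[of Y X Z] by simp
  have swap': "X * (Y * Z) = (X * Z) * Y"
    if "Y * Z = Z * Y" "X \<in> carrier_mat ?N' ?N'" "Y \<in> carrier_mat ?N' ?N'" "Z \<in> carrier_mat ?N' ?N'" for X Y Z
    using that as[of X Z Y] by simp
  have lin: "linearizes n m A' x (?F' (a' @ 0 # b')) (?F' a') (?F' b')"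
    if "distinct (a' @ 0 # b')" "set (a' @ 0 # b') = {0..m}" for a' b'
    using IH[of A' a' b'] A'm that by blast
  have left: "linearizes n (Suc m) A x (T * ?F (a' @ 0 # b')) (T * ?F a') (?F b')"
    if "distinct (a' @ 0 # b')" "set (a' @ 0 # b') = {0..m}" for a' b'
  proof -
    have "t \<notin> set (a' @ 0 # b')" using that by (auto simp: t_def)
    then have "t \<notin> set (a' @ 0 # b')" "t \<notin> set a'" "t \<notin> set b'" by auto
    with linearizes_left_step[of m A n x, OF A x cF' cF' cF', folded A'_def, OF _ lin[OF that]]
    show ?thesis by (simp add: F T_def t_def)
  qed
  have right: "linearizes n (Suc m) A x (?F (a' @ 0 # b') * T) (?F a') (?F b' * T)"
    if "distinct (a' @ 0 # b')" "set (a' @ 0 # b') = {0..m}" for a' b'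
  proof -
    have "t \<notin> set (a' @ 0 # b')" using that by (auto simp: t_def)
    then have "t \<notin> set (a' @ 0 # b')" "t \<notin> set a'" "t \<notin> set b'" by auto
    with linearizes_right_step[of m A n x, OF A x cF' cF' cF', folded A'_def, OF _ lin[OF that]]
    show ?thesis by (simp add: F T_def t_def)
  qed
  have cTF: "T * ?F ys \<in> carrier_mat ?N' ?N'" "?F ys * T \<in> carrier_mat ?N' ?N'" for ys
    using cT cF by (auto intro: mult_carrier_mat)
  have set0: "set (a @ 0 # b) = {0..t}" using set_ab by (simp add: t_def)
  obtain a1 a2 where a: "a = a1 @ t # a2" using in_a by (auto simp: t_def dest: split_list)
  have d: "distinct ((a1 @ a2) @ 0 # b)" using dist by (auto simp: a)
  have s: "set ((a1 @ a2) @ 0 # b) = {0..m}"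
  proof -
    have "insert t (set ((a1 @ a2) @ 0 # b)) = {0..t}" unfolding set0[symmetric] by (auto simp: a)
    moreover have "t \<notin> set ((a1 @ a2) @ 0 # b)" using dist by (auto simp: a)
    moreover have "{0..t} - {t} = {0..m}" by (auto simp: t_def)
    ultimately show ?thesis by (metis Diff_insert_absorb)
  qed
  have le: "i \<le> m" if "i \<in> set a1 \<union> set a2 \<union> set b" for i
  proof -
    have "i \<in> set ((a1 @ a2) @ 0 # b)" using that by auto
    then show ?thesis unfolding s by simp
  qed
  have sub: "set a1 \<subseteq> {0..t}" "set a2 \<subseteq> {0..t}" "set b \<subseteq> {0..t}" "set (0 # b) \<subseteq> {0..t}"
    "t \<notin> set a1" "t \<notin> set a2" "t \<notin> set b" "t \<notin> set (0 # b)"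
    by (auto simp: t_def dest!: le[OF UnI1, OF UnI1] le[OF UnI1, OF UnI2] le[OF UnI2])
  show ?thesis
  proof (cases "m \<in> set a1")
    case False
    have c1: "?F a1 * T = T * ?F a1" using comm[OF sub(1) False sub(5)] .
    have e: "?F (a1 @ t # zs) = T * ?F (a1 @ zs)" for zs
      unfolding FT app[of a1 zs] by (rule swap[OF c1 cF cT cF])
    have "?F (a @ 0 # b) = T * ?F ((a1 @ a2) @ 0 # b)" "?F a = T * ?F (a1 @ a2)"
      using e[of "a2 @ 0 # b"] e[of a2] by (simp_all add: a)
    then show ?thesis using left[OF d s] by simp
  next
    case True
    then have nm: "m \<notin> set a2" "m \<notin> set (0 # b)" "m \<notin> set b" "m \<noteq> 0" using d by auto
    have c2: "T * ?F a2 = ?F a2 * T" "T * ?F (0 # b) = ?F (0 # b) * T" "T * ?F b = ?F b * T"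
      using comm[OF sub(2) nm(1) sub(6)] comm[OF sub(4) nm(2) sub(8)] comm[OF sub(3) nm(3) sub(7)] by simp_all
    have Fa: "?F a = ?F (a1 @ a2) * T"
      unfolding a FT app[of a1 a2] by (rule swap'[OF c2(1) cF cT cF])
    have "?F (a @ 0 # b) = ?F (a1 @ a2) * T * ?F (0 # b)" by (simp add: app Fa)
    also have "\<dots> = ?F (a1 @ a2) * ?F (0 # b) * T" using cF cT cTF by (simp add: as c2)
    finally have M: "?F (a @ 0 # b) = ?F ((a1 @ a2) @ 0 # b) * T" by (simp only: app)
    have "?F a * L = ?F (a1 @ a2) * (T * L)" unfolding Fa using cF cT cL by (simp add: as)
    then have na: "?F a * L = ?F (a1 @ a2) * L" using TL nm by simp
    have "L * (?F b * T) = L * T * ?F b" unfolding c2(3)[symmetric] using cF cT cL by (simp add: as)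
    then have nb: "L * ?F b = L * (?F b * T)" using TL nm by simp
    show ?thesis
      unfolding M by (rule linearizes_cong[OF right[OF d s]]) (use na nb cF cTF in \<open>auto simp: L_def\<close>)
  qed
qed

text \<open>Induction on the degree, removing the largest index wherever it stands. If it stands to the right of the index 0,
  transposition brings it to the left.\<close>

theorem fiedler_pencil_linearizes:
  assumes "\<And>i. i \<le> Suc m \<Longrightarrow> A i \<in> mats n n" and x: "x \<in> R"
    and "distinct (a @ 0 # b)" "set (a @ 0 # b) = {0..m}"
  shows "linearizes n m A x (factors n A m (a @ 0 # b)) (factors n A m a) (factors n A m b)"
  using assms(1,3,4)
proof (induction m arbitrary: A a b)
  case 0
  have A: "A 0 \<in> carrier_mat n n" "A (Suc 0) \<in> carrier_mat n n" using 0(1)[of 0] 0(1)[of 1] by auto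
  have "set a \<subseteq> {0}" "set b \<subseteq> {0}" "0 \<notin> set a" "0 \<notin> set b" using 0 by auto
  then have ab: "a = []" "b = []" by (auto simp: subset_singleton_iff)
  have 1: "lead n 0 X = X" if "X \<in> carrier_mat n n" for X :: "'a mat"
    using that unfolding lead_def by (intro eq_matI) (auto simp: dsum_def)
  have 2: "dsum (1\<^sub>m 0) X = X" if "X \<in> carrier_mat n n" for X :: "'a mat"
    using that by (intro eq_matI) (auto simp: dsum_def)
  have 3: "last_proj n 0 = (1\<^sub>m n :: 'a mat)"
    unfolding last_proj_def by (intro eq_matI) (auto simp: dsum_def)
  have 4: "x \<cdot>\<^sub>m A (Suc 0) - (- A 0) = mpoly_at n (Suc 0) A x"
    using A by (intro eq_matI) (auto simp: mpoly_at_def)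
  have 5: "(- A 0) * 1\<^sub>m n = - A 0" using A by simp
  have 6: "1\<^sub>m n * mpoly_at n (Suc 0) A x * 1\<^sub>m n = mpoly_at n (Suc 0) A x"
    by (simp add: right_mult_one_mat[of _ n n] left_mult_one_mat[of _ n n])
  show ?case
    unfolding linearizes_def
    by (rule bexI[of _ "1\<^sub>m n"], rule bexI[of _ "1\<^sub>m n"])
      (use A in \<open>auto simp: ab 1 2 3 4 5 6 factors_Cons\<close>)
next
  case (Suc m)
  note insert_left = linearizes_insert_left[OF _ x Suc.IH]
  have "Suc m \<in> set (a @ 0 # b)" unfolding Suc.prems(3) by simp
  then consider "Suc m \<in> set a" | "Suc m \<in> set b" by auto
  then show ?case
  proof cases
    case 1
    then show ?thesis using insert_left Suc.prems by blast
  next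
    case 2
    let ?A = "\<lambda>i. transpose_mat (A i)" and ?N = "n + Suc m * n"
    have Ac: "A i \<in> carrier_mat n n" if "i \<le> Suc (Suc m)" for i using Suc.prems(1)[OF that] by auto
    have c: "factors n A (Suc m) ys \<in> carrier_mat ?N ?N" for ys using Ac by (intro factors_carrier) simp
    have tr: "transpose_mat (factors n A (Suc m) ys) = factors n ?A (Suc m) (rev ys)" for ys
      using Ac by (intro factors_transpose) simp
    have "linearizes n (Suc m) ?A x (factors n ?A (Suc m) (rev b @ 0 # rev a))
      (factors n ?A (Suc m) (rev b)) (factors n ?A (Suc m) (rev a))"
    proof (rule insert_left)
      show "distinct (rev b @ 0 # rev a)" using Suc.prems(2) by auto
      have "set (rev b @ 0 # rev a) = set (a @ 0 # b)" by auto
      then show "set (rev b @ 0 # rev a) = {0..Suc m}" by (simp only: Suc.prems(3))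
    qed (use 2 Suc.prems(1) in \<open>auto intro: mats_transpose\<close>)
    moreover have "rev (a @ 0 # b) = rev b @ 0 # rev a" by simp
    ultimately have "linearizes n (Suc m) ?A x (transpose_mat (factors n A (Suc m) (a @ 0 # b)))
      (transpose_mat (factors n A (Suc m) b)) (transpose_mat (factors n A (Suc m) a))"
      unfolding tr by (simp only:)
    then show ?thesis by (rule linearizes_transpose[OF _ c c c, rotated]) (rule Ac)
  qed
qed

end

section \<open>Fiedler matrices over a commutative ring\<close>

text \<open>The matrices of the problem with coefficients in an arbitrary ring: polynomial and rational coefficients, and the
  coefficient \<open>A\<^sub>0 + \<Phi>\<close>, occur below.\<close>

definition fiedler :: "nat \<Rightarrow> nat \<Rightarrow> (nat \<Rightarrow> 'a::comm_ring_1 mat) \<Rightarrow> int \<Rightarrow> 'a mat" where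
  "fiedler n m A i =
     (if i = 0 then dsum (1\<^sub>m ((m - 1) * n)) (- A 0)
      else if i = - int m then dsum (A m) (1\<^sub>m ((m - 1) * n))
      else let k = nat \<bar>i\<bar> in
        dsum (1\<^sub>m ((m - k - 1) * n)) (dsum
          (if i > 0 then four_block_mat (- A k) (1\<^sub>m n) (1\<^sub>m n) (0\<^sub>m n n)
           else four_block_mat (0\<^sub>m n n) (1\<^sub>m n) (1\<^sub>m n) (A k))
          (1\<^sub>m ((k - 1) * n))))"

definition fiedlers :: "nat \<Rightarrow> nat \<Rightarrow> (nat \<Rightarrow> 'a::comm_ring_1 mat) \<Rightarrow> int list \<Rightarrow> 'a mat" where
  "fiedlers n m A t = foldr (\<lambda>i M. fiedler n m A i * M) t (1\<^sub>m (m * n))"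

lemma diag_block_mat_three: "diag_block_mat [A, B, C] = dsum A (dsum B C)"
proof -
  have "diag_block_mat [A, B, C] = dsum A (diag_block_mat [B, C])"
    unfolding diag_block_mat.simps(2)[of A] dsum_def Let_def ..
  then show ?thesis by (simp only: dsum_diag_block)
qed

lemma fiedler_mat_eq: "fiedler_mat n m As = fiedler n m As"
  unfolding fiedler_mat_def fiedler_def fun_eq_iff dsum_diag_block diag_block_mat_three by simp

lemma fiedler_prod_eq: "fiedler_prod n m As = fiedlers n m As"
  unfolding fiedler_prod_def fiedlers_def fun_eq_iff fiedler_mat_eq by simp

lemma (in comm_ring_hom) map_fiedler:
  assumes "\<And>i. i \<le> m \<Longrightarrow> A i \<in> carrier_mat n n" "\<bar>i\<bar> \<le> int m"
  shows "map_mat hom (fiedler n m A i) = fiedler n m (\<lambda>i. map_mat hom (A i)) i"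
proof -
  have u: "map_mat hom (- A k) = - map_mat hom (A k)" for k
    by (rule eq_matI) (auto simp: hom_uminus)
  have z: "map_mat hom (0\<^sub>m n n) = 0\<^sub>m n n" by (rule eq_matI) auto
  define k where "k = nat \<bar>i\<bar>"
  have c: "A k \<in> carrier_mat n n" using assms by (auto simp: k_def)
  have b: "map_mat hom (four_block_mat (- A k) (1\<^sub>m n) (1\<^sub>m n) (0\<^sub>m n n))
      = four_block_mat (- map_mat hom (A k)) (1\<^sub>m n) (1\<^sub>m n) (0\<^sub>m n n)"
    "map_mat hom (four_block_mat (0\<^sub>m n n) (1\<^sub>m n) (1\<^sub>m n) (A k))
      = four_block_mat (0\<^sub>m n n) (1\<^sub>m n) (1\<^sub>m n) (map_mat hom (A k))"
    using c by (subst map_four_block_mat[of _ n n _ n _ n]; simp add: u z mat_hom_one)+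
  show ?thesis
    unfolding fiedler_def Let_def k_def[symmetric] by (auto simp: dsum_map mat_hom_one u b)
qed

lemma dsum_empty_one [simp]: "dsum (1\<^sub>m 0) X = X"
  by (rule eq_matI) (auto simp: dsum_def)

lemma dsum_one_empty [simp]: "dsum X (1\<^sub>m 0) = X"
  by (rule eq_matI) (auto simp: dsum_def)

lemma block_sizes: "0 < k \<Longrightarrow> k < m \<Longrightarrow> (m - k - 1) * n + ((n + n) + (k - 1) * n) = m * n"
  for k m n :: nat
proof -
  assume "0 < k" "k < m"
  then have "m = (m - k - 1) + (2 + (k - 1))" by simp
  then have "m * n = ((m - k - 1) + (2 + (k - 1))) * n" by simp
  then show ?thesis by (simp only: distrib_right)
qed

lemma fiedler_carrier:
  assumes "\<And>i. i \<le> m \<Longrightarrow> A i \<in> carrier_mat n n" "- int m \<le> i" "i < int m"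
  shows "fiedler n m A i \<in> carrier_mat (m * n) (m * n)"
proof -
  define k where "k = nat \<bar>i\<bar>"
  have c: "A k \<in> carrier_mat n n" "A 0 \<in> carrier_mat n n" "A m \<in> carrier_mat n n"
    using assms by (auto simp: k_def)
  have m: "m * n = (m - 1) * n + n" "m * n = n + (m - 1) * n"
    using assms by (cases m; simp)+
  have k: "m * n = (m - k - 1) * n + ((n + n) + (k - 1) * n)" if "i \<noteq> 0" "i \<noteq> - int m"
    using block_sizes[of k m n] that assms by (simp add: k_def)
  consider "i = 0" | "i \<noteq> 0" "i = - int m" | "i \<noteq> 0" "i \<noteq> - int m" by blast
  then show ?thesis
  proof cases
    case 1
    then show ?thesis using c m by (intro carrier_matI) (auto simp: fiedler_def)
  next
    case 2
    then show ?thesis using c m by (intro carrier_matI) (auto simp: fiedler_def)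
  next
    case 3
    then show ?thesis using c k[OF 3] unfolding fiedler_def Let_def k_def[symmetric] by (intro carrier_matI) auto
  qed
qed

lemma top_factor_dsum:
  assumes "X \<in> carrier_mat n n"
  shows "top_factor n m X = dsum (four_block_mat (- X) (1\<^sub>m n) (1\<^sub>m n) (0\<^sub>m n n)) (1\<^sub>m (m * n))"
  using assms by (intro eq_matI) (auto simp: top_factor_def dsum_def lead_def first_unit_def)

lemma factor_eq_fiedler:
  assumes "\<And>i. i \<le> m \<Longrightarrow> A i \<in> carrier_mat n n" "i \<le> m"
  shows "factor n A m i = fiedler n (Suc m) A (int i)"
  using assms
proof (induction m)
  case 0
  then show ?case by (simp add: fiedler_def)
next
  case (Suc m)
  consider "i = Suc m" | "i = 0" | "0 < i" "i \<le> m" using Suc.prems by linarith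
  then show ?case
  proof cases
    case 1
    then show ?thesis using Suc.prems(1)[of "Suc m"]
      by (simp add: fiedler_def top_factor_dsum del: of_nat_Suc)
  next
    case 2
    then show ?thesis using Suc by (simp add: fiedler_def dsum_assoc)
  next
    case 3
    then have s: "Suc m - i = Suc (m - i)" by simp
    from 3 Suc have "factor n A (Suc m) i = dsum (1\<^sub>m n) (fiedler n (Suc m) A (int i))" by simp
    also have "\<dots> = fiedler n (Suc (Suc m)) A (int i)"
      using 3 by (simp add: fiedler_def Let_def dsum_assoc s)
    finally show ?thesis .
  qed
qed

lemma fiedler_lead: "fiedler n (Suc m) A (- int (Suc m)) = lead n m (A (Suc m))"
  by (simp add: fiedler_def lead_def del: of_nat_Suc)

lemma fiedler_inverse:
  assumes "\<And>i. i \<le> m \<Longrightarrow> A i \<in> carrier_mat n n" "i \<noteq> 0" "\<bar>i\<bar> < int m"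
  shows "fiedler n m A i * fiedler n m A (- i) = 1\<^sub>m (m * n)"
proof -
  define k where "k = nat \<bar>i\<bar>"
  have k: "0 < k" "k < m" using assms by (auto simp: k_def)
  let ?a = "(m - k - 1) * n" and ?b = "(k - 1) * n"
  let ?X = "four_block_mat (- A k) (1\<^sub>m n) (1\<^sub>m n) (0\<^sub>m n n)"
  let ?Y = "four_block_mat (0\<^sub>m n n) (1\<^sub>m n) (1\<^sub>m n) (A k)"
  have Ak: "A k \<in> carrier_mat n n" using assms k by simp
  have c: "?X \<in> carrier_mat (n + n) (n + n)" "?Y \<in> carrier_mat (n + n) (n + n)" using Ak by auto
  have XY: "?X * ?Y = 1\<^sub>m (n + n)" "?Y * ?X = 1\<^sub>m (n + n)"
    using Ak by (subst mult_four_block_mat[of _ n n _ n _ n _ _ n _ n]; simp add: uminus_l_inv_mat[of _ n n])+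
  have "dsum (1\<^sub>m ?a) (dsum Z (1\<^sub>m ?b)) * dsum (1\<^sub>m ?a) (dsum Z' (1\<^sub>m ?b)) = 1\<^sub>m (?a + ((n + n) + ?b))"
    if "Z * Z' = 1\<^sub>m (n + n)" "Z \<in> carrier_mat (n + n) (n + n)" "Z' \<in> carrier_mat (n + n) (n + n)" for Z Z' :: "'a mat"
  proof -
    have "dsum Z (1\<^sub>m ?b) * dsum Z' (1\<^sub>m ?b) = 1\<^sub>m ((n + n) + ?b)"
      using that by (subst dsum_mult[of _ "n + n" "n + n" _ ?b ?b _ "n + n" _ ?b]) auto
    then show ?thesis
      using that by (subst dsum_mult[of _ ?a ?a _ "(n + n) + ?b" "(n + n) + ?b" _ ?a _ "(n + n) + ?b"]) auto
  qed
  note * = this[OF XY(1) c] this[OF XY(2) c(2,1)]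
  have m: "?a + ((n + n) + ?b) = m * n" using k by (rule block_sizes)
  have ne: "i \<noteq> - int m" "- i \<noteq> - int m" using assms by auto
  show ?thesis
    using * assms(2) ne unfolding m by (cases "i > 0") (simp_all add: fiedler_def Let_def k_def)
qed

context
  fixes A :: "nat \<Rightarrow> 'a::comm_ring_1 mat" and n m :: nat
  assumes A: "\<And>i. i \<le> m \<Longrightarrow> A i \<in> carrier_mat n n"
begin

lemma fiedlers_carrier:
  "(\<And>i. i \<in> set t \<Longrightarrow> - int m \<le> i \<and> i < int m) \<Longrightarrow> fiedlers n m A t \<in> carrier_mat (m * n) (m * n)"
proof (induction t)
  case (Cons i t)
  have "fiedler n m A i \<in> carrier_mat (m * n) (m * n)"
    using A Cons.prems by (intro fiedler_carrier) auto
  with Cons show ?case unfolding fiedlers_def by (auto intro: mult_carrier_mat)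
qed (simp add: fiedlers_def)

lemma fiedlers_Cons: "fiedlers n m A (i # t) = fiedler n m A i * fiedlers n m A t"
  by (simp add: fiedlers_def)

lemma fiedlers_append:
  assumes "\<And>i. i \<in> set (s @ t) \<Longrightarrow> - int m \<le> i \<and> i < int m"
  shows "fiedlers n m A (s @ t) = fiedlers n m A s * fiedlers n m A t"
  using assms
proof (induction s)
  case Nil
  then show ?case using fiedlers_carrier[of t] by (simp add: fiedlers_def)
next
  case (Cons i s)
  have c: "fiedler n m A i \<in> carrier_mat (m * n) (m * n)"
    using A Cons.prems by (intro fiedler_carrier) auto
  have cs: "fiedlers n m A s \<in> carrier_mat (m * n) (m * n)" "fiedlers n m A t \<in> carrier_mat (m * n) (m * n)"
    using Cons.prems by (intro fiedlers_carrier; auto)+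
  then show ?case using Cons c by (simp add: fiedlers_Cons assoc_mult_mat[OF c cs])
qed

lemma fiedlers_inverse:
  assumes "\<And>i. i \<in> set t \<Longrightarrow> i \<noteq> 0 \<and> \<bar>i\<bar> < int m"
  shows "fiedlers n m A t * fiedlers n m A (map uminus (rev t)) = 1\<^sub>m (m * n)"
    and "fiedlers n m A (map uminus (rev t)) * fiedlers n m A t = 1\<^sub>m (m * n)"
proof -
  have "fiedlers n m A t * fiedlers n m A (map uminus (rev t)) = 1\<^sub>m (m * n)"
    if "\<And>i. i \<in> set t \<Longrightarrow> i \<noteq> 0 \<and> \<bar>i\<bar> < int m" for t
    using that
  proof (induction t)
    case (Cons i t)
    let ?N = "m * n"
    define F F' T T' where defs: "F = fiedler n m A i" "F' = fiedler n m A (- i)" "T = fiedlers n m A t"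
      "T' = fiedlers n m A (map uminus (rev t))"
    have rng: "- int m \<le> j \<and> j < int m" if "j \<in> set (i # t)" for j using Cons.prems[OF that] by auto
    have rng': "- int m \<le> j \<and> j < int m" if "j \<in> set (map uminus (rev (i # t)))" for j using Cons.prems that by force
    have c: "F \<in> carrier_mat ?N ?N" "F' \<in> carrier_mat ?N ?N" "T \<in> carrier_mat ?N ?N" "T' \<in> carrier_mat ?N ?N"
      unfolding defs using A rng rng' by (auto intro!: fiedler_carrier fiedlers_carrier)
    have "fiedlers n m A (map uminus (rev (i # t))) = T' * fiedlers n m A [- i]"
      using rng' fiedlers_append[of "map uminus (rev t)" "[- i]"] by (simp add: defs)
    also have "fiedlers n m A [- i] = F'" using c by (simp add: fiedlers_def defs)
    finally have "fiedlers n m A (i # t) * fiedlers n m A (map uminus (rev (i # t))) = F * T * (T' * F')"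
      by (simp add: fiedlers_Cons defs)
    also have "\<dots> = F * (T * T') * F'" using c by (simp add: assoc_mult_mat[of _ ?N ?N _ ?N _ ?N])
    also have "T * T' = 1\<^sub>m ?N" using Cons by (simp add: defs)
    also have "F * 1\<^sub>m ?N * F' = 1\<^sub>m ?N"
      using c fiedler_inverse[of m A n i] A Cons.prems by (simp add: defs)
    finally show ?case .
  qed (simp add: fiedlers_def)
  note * = this
  have "i \<noteq> 0 \<and> \<bar>i\<bar> < int m" if "i \<in> set (map uminus (rev t))" for i
    using that assms by force
  from *[of t] *[of "map uminus (rev t)", OF this] assms
  show "fiedlers n m A t * fiedlers n m A (map uminus (rev t)) = 1\<^sub>m (m * n)"
    "fiedlers n m A (map uminus (rev t)) * fiedlers n m A t = 1\<^sub>m (m * n)"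
    by (auto simp: rev_map comp_def)
qed

end

lemma (in comm_ring_hom) map_fiedlers:
  assumes A: "\<And>i. i \<le> m \<Longrightarrow> A i \<in> carrier_mat n n" and t: "\<And>i. i \<in> set t \<Longrightarrow> - int m \<le> i \<and> i < int m"
  shows "map_mat hom (fiedlers n m A t) = fiedlers n m (\<lambda>i. map_mat hom (A i)) t"
  using t
proof (induction t)
  case Nil
  then show ?case by (simp add: fiedlers_def mat_hom_one)
next
  case (Cons i t)
  have c: "fiedler n m A i \<in> carrier_mat (m * n) (m * n)"
    using A Cons.prems by (intro fiedler_carrier) auto
  have cs: "fiedlers n m A t \<in> carrier_mat (m * n) (m * n)"
    using Cons.prems A by (intro fiedlers_carrier; auto)+
  have "\<bar>i\<bar> \<le> int m" using Cons.prems[of i] by auto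
  then show ?case using Cons A
    by (simp add: fiedlers_Cons mat_hom_mult[OF c cs] map_fiedler)
qed

lemma factors_eq_fiedlers:
  assumes "\<And>i. i \<le> m \<Longrightarrow> A i \<in> carrier_mat n n" "set t \<subseteq> {0..m}"
  shows "factors n A m t = fiedlers n (Suc m) A (map int t)"
  using assms(2)
  by (induction t) (use assms(1) in \<open>auto simp: factors_def fiedlers_def factor_eq_fiedler\<close>)

section \<open>Reversal of rows and columns\<close>

text \<open>Reversal of the order of rows and of columns, that is, conjugation by the antidiagonal permutation matrix.\<close>

definition flip :: "'a mat \<Rightarrow> 'a mat" where
  "flip X = mat (dim_row X) (dim_col X) (\<lambda>(i, j). X $$ (dim_row X - 1 - i, dim_col X - 1 - j))"

definition antidiag :: "nat \<Rightarrow> 'a::comm_ring_1 mat" where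
  "antidiag N = mat N N (\<lambda>(i, j). if i = N - 1 - j then 1 else 0)"

lemma index_antidiag: "i < N \<Longrightarrow> j < N \<Longrightarrow> antidiag N $$ (i, j) = (if i = N - 1 - j then 1 else 0)"
  by (simp add: antidiag_def)

lemma antidiag_carrier [simp]: "antidiag N \<in> carrier_mat N N"
  by (simp add: antidiag_def)

lemma flip_carrier [simp]: "X \<in> carrier_mat a b \<Longrightarrow> flip X \<in> carrier_mat a b"
  by (auto simp: flip_def)

lemma flip_dim [simp]: "dim_row (flip X) = dim_row X" "dim_col (flip X) = dim_col X"
  by (auto simp: flip_def)

lemma antidiag_square: "antidiag N * antidiag N = 1\<^sub>m N"
proof (rule eq_matI)
  fix i j assume "i < dim_row (1\<^sub>m N :: 'a mat)" "j < dim_col (1\<^sub>m N :: 'a mat)"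
  then have ij: "i < N" "j < N" by auto
  have "(antidiag N * antidiag N) $$ (i, j) = (\<Sum>k = 0..<N. (if i = N - 1 - k then 1 else 0) * (if k = N - 1 - j then 1 else 0 :: 'a))"
    using ij by (simp add: antidiag_def scalar_prod_def)
  also have "\<dots> = (\<Sum>k = 0..<N. if k = N - 1 - j then (if i = N - 1 - k then 1 else 0) else 0)"
    by (rule sum.cong) auto
  also have "\<dots> = 1\<^sub>m N $$ (i, j)" using ij by (simp add: if_distrib cong: if_cong)
  finally show "(antidiag N * antidiag N) $$ (i, j) = (1\<^sub>m N :: 'a mat) $$ (i, j)" .
qed (auto simp: antidiag_def)

lemma flip_eq_antidiag:
  assumes X: "X \<in> carrier_mat N N"
  shows "flip X = antidiag N * X * antidiag N"
proof (rule eq_matI)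
  fix i j assume "i < dim_row (antidiag N * X * antidiag N)" "j < dim_col (antidiag N * X * antidiag N)"
  then have ij: "i < N" "j < N" using X by (auto simp: antidiag_def)
  have 1: "(antidiag N * X) $$ (i, k) = X $$ (N - 1 - i, k)" if "k < N" for k
  proof -
    have "(antidiag N * X) $$ (i, k) = (\<Sum>l = 0..<N. (if i = N - 1 - l then 1 else 0) * X $$ (l, k))"
      using ij that X by (simp add: antidiag_def scalar_prod_def)
    also have "\<dots> = (\<Sum>l = 0..<N. if l = N - 1 - i then X $$ (l, k) else 0)"
      by (rule sum.cong) (use ij in auto)
    finally show ?thesis using ij by (auto cong: if_cong)
  qed
  have "(antidiag N * X * antidiag N) $$ (i, j) = (\<Sum>l = 0..<N. (antidiag N * X) $$ (i, l) * (antidiag N) $$ (l, j))"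
    using ij X by (simp add: antidiag_def scalar_prod_def)
  also have "\<dots> = (\<Sum>l = 0..<N. if l = N - 1 - j then X $$ (N - 1 - i, l) else 0)"
    using ij 1 by (intro sum.cong) (auto simp: index_antidiag)
  also have "\<dots> = flip X $$ (i, j)" using ij X by (auto simp: flip_def cong: if_cong)
  finally show "flip X $$ (i, j) = (antidiag N * X * antidiag N) $$ (i, j)" ..
qed (use X in \<open>auto simp: antidiag_def\<close>)

lemma flip_mult:
  assumes "X \<in> carrier_mat N N" "Y \<in> carrier_mat N N"
  shows "flip (X * Y) = flip X * flip (Y :: 'a::comm_ring_1 mat)"
proof -
  define K where "K = (antidiag N :: 'a mat)"
  have K: "K \<in> carrier_mat N N" by (simp add: K_def)
  have "flip X * flip Y = K * X * (K * K) * Y * K"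
    unfolding flip_eq_antidiag[OF assms(1)] flip_eq_antidiag[OF assms(2)] K_def[symmetric]
    using assms K by (simp add: assoc_mult_mat[of _ N N _ N _ N])
  also have "\<dots> = K * (X * Y) * K"
    unfolding antidiag_square[of N, where 'a = 'a, folded K_def] using assms K by simp
  finally show ?thesis using assms mult_carrier_mat[OF assms] by (simp add: flip_eq_antidiag[of _ N] K_def)
qed

lemma flip_one [simp]: "flip (1\<^sub>m N) = (1\<^sub>m N :: 'a::comm_ring_1 mat)"
  by (rule eq_matI) (auto simp: flip_def)

lemma flip_zero [simp]: "flip (0\<^sub>m a b) = 0\<^sub>m a b"
  by (rule eq_matI) (auto simp: flip_def)

lemma flip_uminus: "flip (- X) = - flip (X :: 'a::comm_ring_1 mat)"
  by (rule eq_matI) (auto simp: flip_def)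

lemma flip_smult: "flip (c \<cdot>\<^sub>m X) = c \<cdot>\<^sub>m flip X"
  by (rule eq_matI) (auto simp: flip_def)

lemma flip_minus: "X \<in> carrier_mat a b \<Longrightarrow> Y \<in> carrier_mat a b \<Longrightarrow> flip (X - Y) = flip X - flip (Y :: 'a::comm_ring_1 mat)"
  by (rule eq_matI) (auto simp: flip_def)

lemma flip_dsum: "flip (dsum X Y) = dsum (flip Y) (flip X)"
  by (rule eq_matI) (auto simp: flip_def dsum_def intro!: arg_cong2[of _ _ _ _ "\<lambda>i j. _ $$ (i, j)"])

lemma flip_four_block:
  assumes "X \<in> carrier_mat n n" "Y \<in> carrier_mat n n" "Z \<in> carrier_mat n n" "W \<in> carrier_mat n n"
  shows "flip (four_block_mat X Y Z W) = four_block_mat (flip W) (flip Z) (flip Y) (flip X)"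
  using assms by (intro eq_matI) (auto simp: flip_def intro!: arg_cong2[of _ _ _ _ "\<lambda>i j. _ $$ (i, j)"])

text \<open>Reversal turns a block \<open>[0, I; I, A\<^sub>k]\<close> into \<open>[A\<^sub>k, I; I, 0]\<close> (with the entries of \<open>A\<^sub>k\<close> reversed), which is the
  core of a Fiedler matrix of positive index \<open>m - k\<close> with coefficient \<open>-A\<^sub>k\<close>. It also exchanges the extreme indices
  \<open>0\<close> and \<open>-m\<close>.\<close>

lemma flip_fiedler:
  assumes A: "\<And>i. i \<le> m \<Longrightarrow> A i \<in> carrier_mat n n" and i: "- int m \<le> i" "i \<le> 0" "0 < m"
  shows "flip (fiedler n m A i) = fiedler n m (\<lambda>j. - flip (A (m - j))) (if i = 0 then - int m else i + int m)"
proof -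
  consider "i = 0" | "i = - int m" "i \<noteq> 0" | "- int m < i" "i < 0" using i by linarith
  then show ?thesis
  proof cases
    case 1
    then show ?thesis using A i by (simp add: fiedler_def flip_dsum flip_uminus)
  next
    case 2
    then show ?thesis using A i by (simp add: fiedler_def flip_dsum flip_uminus)
  next
    case 3
    define k where "k = nat (- i)"
    have k: "i = - int k" "0 < k" "k < m" "nat (int m - int k) = m - k" using 3 by (auto simp: k_def)
    have Ak: "A k \<in> carrier_mat n n" using A k by simp
    have u: "- (- flip (A k)) = flip (A k)" by (rule eq_matI) auto
    show ?thesis
      using k Ak by (simp add: fiedler_def Let_def flip_dsum flip_four_block[of _ n] u dsum_assoc)
  qed
qed

lemma flip_fiedlers:
  assumes A: "\<And>i. i \<le> m \<Longrightarrow> A i \<in> carrier_mat n n" and t: "\<And>i. i \<in> set t \<Longrightarrow> - int m \<le> i \<and> i < 0"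
  shows "flip (fiedlers n m A t) = fiedlers n m (\<lambda>j. - flip (A (m - j))) (map (\<lambda>i. i + int m) t)"
  using t
proof (induction t)
  case Nil
  then show ?case by (simp add: fiedlers_def)
next
  case (Cons i t)
  have i: "- int m \<le> i" "i < 0" using Cons.prems[of i] by auto
  have c: "fiedler n m A i \<in> carrier_mat (m * n) (m * n)"
    using A i by (intro fiedler_carrier) auto
  have cs: "fiedlers n m A t \<in> carrier_mat (m * n) (m * n)"
    using A Cons.prems by (intro fiedlers_carrier) force+
  show ?case
    using Cons flip_fiedler[of m A n i] A i by (simp add: fiedlers_Cons flip_mult[OF c cs])
qed

section \<open>Admissible tuples\<close>

lemma admissible_tuple_elements:
  assumes "admissible_tuple k p u"
  shows "distinct u" "set u = {0..int k}"
proof -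
  let ?q = "(k - p) div 2"
  let ?I = "\<lambda>j. [int k - 2 * int j - 1 .. int k - 2 * int j]"
  have p: "p \<le> k" "k = p + 2 * ?q" and u: "u = concat (map ?I [0..<?q]) @ [0..int p]"
    using assms by (auto simp: admissible_tuple_def)
  have I: "?I j = [int k - 2 * int j - 1, int k - 2 * int j]" for j
    by (simp add: upto.simps)
  have "distinct (concat (map ?I [0..<i])) \<and> set (concat (map ?I [0..<i])) = {int k - 2 * int i + 1..int k}" for i
  proof (induction i)
    case (Suc i)
    have "set (concat (map ?I [0..<Suc i])) = {int k - 2 * int (Suc i) + 1..int k}"
      using Suc.IH by (auto simp: I)
    moreover have "distinct (concat (map ?I [0..<Suc i]))"
      using Suc.IH by (auto simp: I)
    ultimately show ?case by blast
  qed simp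
  note * = this[of ?q]
  have k: "int k - 2 * int ?q = int p" using p by linarith
  show "distinct u" unfolding u using * unfolding k by auto
  have "set u = {int p + 1..int k} \<union> {0..int p}" unfolding u using * unfolding k by auto
  also have "\<dots> = {0..int k}" using p by auto
  finally show "set u = {0..int k}" .
qed

lemma symmetric_complement_elements:
  assumes "i \<in> set (symmetric_complement k p)" "p \<le> k" "even (k - p)"
  shows "0 \<le> i" "i < int k" "p = 0 \<Longrightarrow> 0 < i"
proof -
  let ?q = "(k - p) div 2"
  have k: "k = p + 2 * ?q" using assms by auto
  from assms(1) consider j where "j < ?q" "i = int k - 1 - 2 * int j" | "p > 0" "0 \<le> i" "i < int p"
    unfolding symmetric_complement_def rev_c_def by fastforce
  then show "0 \<le> i" "i < int k" "p = 0 \<Longrightarrow> 0 < i"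
    using k assms(2) by (cases; linarith)+
qed

text \<open>For even \<open>h\<close> the index is 0, so that the tuple ends in the single entry 0, preceded by \<open>(1, 2)\<close> unless it is
  \<open>(0)\<close>. The factors of this tail are the only ones that move the border blocks.\<close>

lemma simple_even_tuple:
  assumes "simple_admissible_tuple h p w" "even h"
  obtains a where "p = 0" "w = a @ [0]" "distinct a" "set a = {1..int h}"
    "h = 0 \<or> (\<exists>a'. a = a' @ [1, 2] \<and> set a' = {3..int h})"
proof -
  have p: "p = 0" using assms by (auto simp: simple_admissible_tuple_def admissible_tuple_def)
  let ?q = "h div 2"
  let ?I = "\<lambda>j. [int h - 2 * int j - 1 .. int h - 2 * int j]"
  define a where "a = concat (map ?I [0..<?q])"
  have w: "w = a @ [0]"
    using assms p by (simp add: simple_admissible_tuple_def admissible_tuple_def a_def)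
  have "admissible_tuple h 0 w" using assms p by (simp add: simple_admissible_tuple_def)
  note el = admissible_tuple_elements[OF this]
  have a: "distinct a" "set a = {1..int h}"
  proof -
    show "distinct a" using el(1) w by simp
    have "0 \<notin> set a" using el(1) w by simp
    moreover have "insert 0 (set a) = {0..int h}" using el(2) w by simp
    moreover have "{0..int h} - {0} = {1..int h}" by auto
    ultimately show "set a = {1..int h}" by (metis Diff_insert_absorb)
  qed
  have "h = 0 \<or> (\<exists>a'. a = a' @ [1, 2] \<and> set a' = {3..int h})"
  proof (cases "h = 0")
    case False
    then obtain r where r: "?q = Suc r" "h = 2 * Suc r" using assms(2) by (cases ?q) auto
    have "int h - 2 * int r - 1 = 1" "int h - 2 * int r = 2" using r by simp_all
    then have I: "?I r = [1, 2]" by (simp add: upto.simps)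
    define a' where "a' = concat (map ?I [0..<r])"
    have aa: "a = a' @ [1, 2]" unfolding a_def r(1) by (simp add: I a'_def)
    have "set a' \<inter> {1, 2} = {}" using a(1) aa by auto
    moreover have "set a' \<union> {1, 2} = {1..int h}" using a(2) aa by auto
    moreover have "{1..int h} - {1, 2} = {3..int h}" by auto
    ultimately have "set a' = {3..int h}" by blast
    then show ?thesis using aa by blast
  qed simp
  then show ?thesis using that p w a by blast
qed

lemma symmetric_complement_even:
  assumes "even h" "h \<noteq> 0"
  obtains c where "symmetric_complement h 0 = c @ [1]" "set c \<subseteq> {3..<int h}"
proof -
  obtain r where r: "h div 2 = Suc r" "h = 2 * Suc r" using assms by (cases "h div 2") auto
  define c where "c = map (\<lambda>j. int h - 1 - 2 * int j) [0..<r]"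
  have "symmetric_complement h 0 = c @ [1]"
    using r by (simp add: symmetric_complement_def rev_c_def c_def)
  moreover have "set c \<subseteq> {3..<int h}" using r by (auto simp: c_def)
  ultimately show ?thesis by (rule that)
qed

text \<open>The entry 1 occurs only once, and before the entry 2. So \<open>(1, 0)\<close> is a subtuple and \<open>(2, 1, 0)\<close> is not.\<close>

lemma i0_simple_even:
  assumes "a = a' @ [1, 2]" "set a' = {3..int h}" "distinct a"
  shows "i0 (a @ [0]) = 1"
proof -
  have two: "\<not> subseq [2, 1, 0] (a @ [0])"
  proof
    assume s: "subseq [2, 1, 0] (a @ [0])"
    have n: "(2::int) \<notin> set a'" "(1::int) \<notin> set a'" using assms by auto
    have "subseq [2, 1, 0] (u @ [1, 2, 0]) \<Longrightarrow> 2 \<notin> set u \<Longrightarrow> False" for u :: "int list"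
      by (induction u) (auto simp: subseq_Cons2_iff split: if_splits)
    then show False using s n assms(1) by auto
  qed
  have one: "subseq (rev [0..int 1]) (a @ [0])"
  proof -
    have "rev [0..int 1] = [1, 0::int]" by (simp add: upto.simps)
    moreover have "subseq [1, 0] (a' @ [1, 2, 0::int])"
      by (rule subseq_drop_many) simp
    ultimately show ?thesis using assms(1) by simp
  qed
  have "p \<le> 1" if "subseq (rev [0..int p]) (a @ [0])" for p
  proof (rule ccontr)
    assume "\<not> p \<le> 1"
    then have "[0..int p] = [0, 1, 2] @ [3..int p]"
      by (simp add: upto_rec1)
    then have "rev [0..int p] = rev [3..int p] @ [2, 1, 0]" by simp
    then have "subseq [2, 1, 0] (rev [0..int p])" by (simp only: subseq_drop_many subseq_order.order_refl)
    with that two show False using subseq_order.order_trans by blast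
  qed
  then show ?thesis unfolding i0_def using one by (intro Greatest_equality) auto
qed

lemma i0_zero: "i0 [0] = 0"
proof -
  have "p \<le> 0" if "subseq (rev [0..int p]) [0]" for p
    using list_emb_length[OF that] by simp
  moreover have "subseq (rev [0..int 0]) [0]" by simp
  ultimately show ?thesis unfolding i0_def by (intro Greatest_equality) auto
qed

section \<open>Block unit columns\<close>

definition block_col :: "nat \<Rightarrow> nat \<Rightarrow> 'a::comm_ring_1 mat \<Rightarrow> 'a mat" where
  "block_col m j X = kronecker (e_col m j) X"

definition block_row :: "nat \<Rightarrow> nat \<Rightarrow> 'a::comm_ring_1 mat \<Rightarrow> 'a mat" where
  "block_row m j X = kronecker (transpose_mat (e_col m j)) X"

lemma e_col_carrier [simp]: "e_col m j \<in> carrier_mat m 1"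
  using mat_of_cols_carrier(1)[of m "[unit_vec m (j - 1)]"] by (simp add: e_col_def)

lemma e_col_index: "i < m \<Longrightarrow> e_col m j $$ (i, 0) = (if i = j - 1 then 1 else 0)"
  by (simp add: e_col_def mat_of_cols_def unit_vec_def)

lemma block_col_carrier: "X \<in> carrier_mat n r \<Longrightarrow> block_col m j X \<in> carrier_mat (m * n) r"
  by (auto simp: block_col_def kronecker_def e_col_def)

lemma block_row_carrier: "X \<in> carrier_mat r n \<Longrightarrow> block_row m j X \<in> carrier_mat r (m * n)"
  by (auto simp: block_row_def kronecker_def e_col_def)

lemma block_col_index:
  assumes "X \<in> carrier_mat n r" "p < m * n" "c < r"
  shows "block_col m j X $$ (p, c) = (if p div n = j - 1 then X $$ (p mod n, c) else 0)"
proof -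
  have "p div n < m" using assms by (simp add: less_mult_imp_div_less)
  then show ?thesis
    using assms e_col_carrier[of m j, where 'a = 'a] by (auto simp: block_col_def kronecker_def e_col_index)
qed

lemma block_row_transpose:
  assumes "X \<in> carrier_mat r n"
  shows "block_row m j X = transpose_mat (block_col m j (transpose_mat X))"
proof (rule eq_matI)
  fix i p assume "i < dim_row (transpose_mat (block_col m j (transpose_mat X)))"
    "p < dim_col (transpose_mat (block_col m j (transpose_mat X)))"
  then have ip: "i < r" "p < m * n"
    using assms block_col_carrier[of "transpose_mat X" n r m j] by auto
  have d: "p div n < m" "p mod n < n" using ip
    by (auto simp: less_mult_imp_div_less intro!: mod_less_divisor) (cases n; simp)
  show "block_row m j X $$ (i, p) = transpose_mat (block_col m j (transpose_mat X)) $$ (i, p)"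
    using ip d assms e_col_carrier[of m j, where 'a = 'a]
    by (simp add: block_row_def block_col_def kronecker_def)
qed (use assms in \<open>auto simp: block_col_def block_row_def kronecker_def\<close>)

lemma block_col_mult:
  assumes "X \<in> carrier_mat n r" "Y \<in> carrier_mat r q"
  shows "block_col m j X * Y = block_col m j (X * Y)"
proof (rule eq_matI)
  fix p c assume "p < dim_row (block_col m j (X * Y))" "c < dim_col (block_col m j (X * Y))"
  then have pc: "p < m * n" "c < q"
    using assms block_col_carrier[of "X * Y" n q m j] by auto
  have d: "p mod n < n" using pc by (cases n) auto
  have cc: "block_col m j X \<in> carrier_mat (m * n) r" using assms by (simp add: block_col_carrier)
  have "(block_col m j X * Y) $$ (p, c) = (\<Sum>k = 0..<r. block_col m j X $$ (p, k) * Y $$ (k, c))"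
    using pc assms cc by (simp add: scalar_prod_def)
  also have "\<dots> = (\<Sum>k = 0..<r. (if p div n = j - 1 then X $$ (p mod n, k) else 0) * Y $$ (k, c))"
    by (rule sum.cong) (use pc assms in \<open>auto simp: block_col_index\<close>)
  also have "\<dots> = (if p div n = j - 1 then (X * Y) $$ (p mod n, c) else 0)"
    using d pc assms by (simp add: scalar_prod_def)
  also have "\<dots> = block_col m j (X * Y) $$ (p, c)"
    using pc assms by (subst block_col_index[of _ n q]) auto
  finally show "(block_col m j X * Y) $$ (p, c) = block_col m j (X * Y) $$ (p, c)" .
qed (use assms block_col_carrier[of X n r m j] block_col_carrier[of "X * Y" n q m j] in auto)

lemma block_row_mult:
  assumes "X \<in> carrier_mat r n" "Y \<in> carrier_mat q r"
  shows "Y * block_row m j X = block_row m j (Y * X)"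
proof -
  have c: "block_col m j (transpose_mat X) \<in> carrier_mat (m * n) r"
    using assms by (intro block_col_carrier) auto
  have "Y * block_row m j X = transpose_mat (block_col m j (transpose_mat X) * transpose_mat Y)"
    using assms c by (simp add: block_row_transpose[of _ r n] transpose_mult[of _ "m * n" r _ q])
  also have "\<dots> = transpose_mat (block_col m j (transpose_mat (Y * X)))"
    using assms by (simp add: block_col_mult[of _ n r _ q] transpose_mult[of _ q r _ n])
  also have "\<dots> = block_row m j (Y * X)"
    using assms by (subst block_row_transpose[of _ q n]) auto
  finally show ?thesis .
qed

lemma (in comm_ring_hom) map_block_col:
  "X \<in> carrier_mat n r \<Longrightarrow> map_mat hom (block_col m j X) = block_col m j (map_mat hom X)"
proof (rule eq_matI)
  assume X: "X \<in> carrier_mat n r"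
  have c: "block_col m j X \<in> carrier_mat (m * n) r" "block_col m j (map_mat hom X) \<in> carrier_mat (m * n) r"
    using X by (auto intro!: block_col_carrier)
  show "dim_row (map_mat hom (block_col m j X)) = dim_row (block_col m j (map_mat hom X))"
    "dim_col (map_mat hom (block_col m j X)) = dim_col (block_col m j (map_mat hom X))"
    using c by auto
  fix p q assume "p < dim_row (block_col m j (map_mat hom X))" "q < dim_col (block_col m j (map_mat hom X))"
  then have pq: "p < m * n" "q < r" using c by auto
  then have "p mod n < n" by (cases n) auto
  then show "map_mat hom (block_col m j X) $$ (p, q) = block_col m j (map_mat hom X) $$ (p, q)"
    using pq X c by (auto simp: block_col_index[of _ n r])
qed

lemma (in comm_ring_hom) map_block_row:
  assumes "X \<in> carrier_mat r n"
  shows "map_mat hom (block_row m j X) = block_row m j (map_mat hom X)"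
proof -
  have "map_mat hom (block_row m j X) = transpose_mat (map_mat hom (block_col m j (transpose_mat X)))"
    using assms by (simp add: block_row_transpose map_mat_transpose)
  also have "\<dots> = transpose_mat (block_col m j (transpose_mat (map_mat hom X)))"
    using assms by (subst map_block_col[of _ n r]) (auto simp: map_mat_transpose)
  also have "\<dots> = block_row m j (map_mat hom X)"
    using assms by (subst block_row_transpose[of _ r n]) auto
  finally show ?thesis .
qed

lemma last_proj_block_col:
  assumes "X \<in> carrier_mat n r"
  shows "last_proj n m * block_col (Suc m) (Suc m) X = block_col (Suc m) (Suc m) X"
proof (rule eq_matI)
  let ?E = "block_col (Suc m) (Suc m) X"
  have c: "?E \<in> carrier_mat (n + m * n) r" using block_col_carrier[OF assms, of "Suc m" "Suc m"] by simp
  fix p c assume "p < dim_row ?E" "c < dim_col ?E"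
  then have pc: "p < n + m * n" "c < r" using c by auto
  have "(last_proj n m * ?E) $$ (p, c) = (\<Sum>k = 0..<n + m * n. last_proj n m $$ (p, k) * ?E $$ (k, c))"
    using pc c by (simp add: scalar_prod_def carrier_matD[OF last_proj_carrier[of n m]])
  also have "\<dots> = (\<Sum>k = 0..<n + m * n. if k = p then ?E $$ (k, c) else 0)"
  proof (rule sum.cong)
    fix k assume k: "k \<in> {0..<n + m * n}"
    have E: "?E $$ (k, c) = (if k div n = m then X $$ (k mod n, c) else 0)"
      using k pc assms by (subst block_col_index[of _ n r]) auto
    have "?E $$ (k, c) = 0" if "k < m * n"
      using E that less_mult_imp_div_less[of k m n] by auto
    then show "last_proj n m $$ (p, k) * ?E $$ (k, c) = (if k = p then ?E $$ (k, c) else 0)"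
      using k pc by (auto simp: last_proj_def dsum_def)
  qed simp
  finally show "(last_proj n m * ?E) $$ (p, c) = ?E $$ (p, c)" using pc by simp
qed (use block_col_carrier[OF assms, of "Suc m" "Suc m"] in \<open>auto simp: carrier_matD[OF last_proj_carrier[of n m]]\<close>)

lemma dsum_middle_fix:
  assumes D: "D \<in> carrier_mat d d" and Y: "Y \<in> carrier_mat (a + (d + b)) r"
    and z: "\<And>p c. a \<le> p \<Longrightarrow> p < a + d \<Longrightarrow> c < r \<Longrightarrow> Y $$ (p, c) = 0"
  shows "dsum (1\<^sub>m a) (dsum D (1\<^sub>m b)) * Y = (Y :: 'a::comm_ring_1 mat)"
proof (rule eq_matI)
  let ?M = "dsum (1\<^sub>m a) (dsum D (1\<^sub>m b))"
  fix p c assume "p < dim_row Y" "c < dim_col Y"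
  then have pc: "p < a + (d + b)" "c < r" using Y by auto
  have "(?M * Y) $$ (p, c) = (\<Sum>k = 0..<a + (d + b). ?M $$ (p, k) * Y $$ (k, c))"
    using pc Y D by (simp add: scalar_prod_def)
  also have "\<dots> = (\<Sum>k = 0..<a + (d + b). if k = p then Y $$ (k, c) else 0)"
  proof (rule sum.cong)
    fix k assume "k \<in> {0..<a + (d + b)}"
    then show "?M $$ (p, k) * Y $$ (k, c) = (if k = p then Y $$ (k, c) else 0)"
      using pc D Y z[of k c] by (cases "a \<le> k \<and> k < a + d") (auto simp: dsum_def)
  qed simp
  finally show "(?M * Y) $$ (p, c) = Y $$ (p, c)" using pc by simp
qed (use D Y in auto)

text \<open>The matrix \<open>M\<^sub>i\<close> differs from the identity only in the block rows \<open>m - \<bar>i\<bar>\<close> and \<open>m - \<bar>i\<bar> + 1\<close>.\<close>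

lemma fiedler_block_col:
  assumes A: "\<And>i. i \<le> m \<Longrightarrow> A i \<in> carrier_mat n n" and X: "X \<in> carrier_mat n r"
    and i: "i \<noteq> 0" "- int m \<le> i" "i < int m" and j: "1 \<le> j" "j \<le> m"
    and away: "int j \<noteq> int m - \<bar>i\<bar>" "int j \<noteq> int m - \<bar>i\<bar> + 1"
  shows "fiedler n m A i * block_col m j X = block_col m j X"
proof -
  define k where "k = nat \<bar>i\<bar>"
  have k: "0 < k" "k \<le> m" using i by (auto simp: k_def)
  have jk: "j \<noteq> m - k" "j \<noteq> m - k + 1" using away k by (auto simp: k_def)
  have Yc: "block_col m j X \<in> carrier_mat (m * n) r" using X by (rule block_col_carrier)
  have zero: "block_col m j X $$ (p, c) = 0" if "p div n + 1 \<noteq> j" "p < m * n" "c < r" for p c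
    using that X j by (subst block_col_index[of _ n r]) auto
  show ?thesis
  proof (cases "i = - int m")
    case True
    then have F: "fiedler n m A i = dsum (1\<^sub>m 0) (dsum (A m) (1\<^sub>m ((m - 1) * n)))"
      using i by (simp add: fiedler_def)
    have km: "k = m" using True by (simp add: k_def)
    have "m * n = 0 + (n + (m - 1) * n)" using k by (cases m) auto
    then show ?thesis unfolding F using jk km j k
      by (intro dsum_middle_fix[of _ n]) (use A Yc zero in auto)
  next
    case False
    then have km: "k < m" using i by (auto simp: k_def)
    obtain D where D: "D \<in> carrier_mat (n + n) (n + n)"
      and F: "fiedler n m A i = dsum (1\<^sub>m ((m - k - 1) * n)) (dsum D (1\<^sub>m ((k - 1) * n)))"
    proof -
      have "A k \<in> carrier_mat n n" using A k by simp
      then show ?thesis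
        using that[of "if i > 0 then four_block_mat (- A k) (1\<^sub>m n) (1\<^sub>m n) (0\<^sub>m n n)
           else four_block_mat (0\<^sub>m n n) (1\<^sub>m n) (1\<^sub>m n) (A k)"] i(1) False
        unfolding fiedler_def Let_def k_def[symmetric] by auto
    qed
    have m: "m * n = (m - k - 1) * n + ((n + n) + (k - 1) * n)" using block_sizes[OF k(1) km] by simp
    have "block_col m j X $$ (p, c) = 0"
      if p: "(m - k - 1) * n \<le> p" "p < (m - k - 1) * n + (n + n)" and c: "c < r" for p c
    proof (rule zero[OF _ _ c])
      show "p < m * n" using p unfolding m by linarith
      have n: "n > 0" using p by (cases n) auto
      have "m - k - 1 \<le> p div n" using p n by (simp add: less_eq_div_iff_mult_less_eq)
      moreover have "p div n < m - k - 1 + 2"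
        using p by (intro less_mult_imp_div_less) (simp add: algebra_simps)
      ultimately have "p div n = m - k - 1 \<or> p div n = m - k" using km by linarith
      then show "p div n + 1 \<noteq> j" using jk km by auto
    qed
    then show ?thesis
      unfolding F using Yc unfolding m by (intro dsum_middle_fix[OF D]) auto
  qed
qed

text \<open>The last block column of \<open>M\<^sub>1\<close> has a single nonzero block, the identity in block row \<open>m - 1\<close>. This is where the
  position \<open>m - i\<^sub>0(w)\<close> with \<open>i\<^sub>0(w) = 1\<close> comes from.\<close>

lemma fiedler_one_block_col:
  assumes A: "\<And>i. i \<le> m \<Longrightarrow> A i \<in> carrier_mat n n" and X: "X \<in> carrier_mat n r" and m: "2 \<le> m"
  shows "fiedler n m A 1 * block_col m m X = block_col m (m - 1) X"
proof -
  let ?a = "(m - 2) * n"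
  let ?D = "four_block_mat (- A 1) (1\<^sub>m n) (1\<^sub>m n) (0\<^sub>m n n)"
  have F: "fiedler n m A 1 = dsum (1\<^sub>m ?a) ?D"
    using m by (simp add: fiedler_def Let_def numeral_2_eq_2)
  have mn: "m * n = ?a + (n + n)" using m by (metis le_add_diff_inverse2 distrib_right mult_2)
  have A1: "A 1 \<in> carrier_mat n n" using A m by simp
  let ?E = "block_col m m X"
  have c: "?E \<in> carrier_mat (m * n) r" using X by (rule block_col_carrier)
  have Fc: "fiedler n m A 1 \<in> carrier_mat (m * n) (m * n)" unfolding F mn using A1 by auto
  have zero: "?E $$ (k, c) = 0" if "k < ?a + n" "c < r" for k c
  proof -
    have "?a + n = (m - 1) * n" using mn by (simp add: diff_mult_distrib)
    then have "k div n < m - 1" using that by (metis less_mult_imp_div_less)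
    then show ?thesis using that mn X by (subst block_col_index[of _ n r]) auto
  qed
  show ?thesis
  proof (rule eq_matI)
    fix p c assume "p < dim_row (block_col m (m - 1) X)" "c < dim_col (block_col m (m - 1) X)"
    then have pc: "p < m * n" "c < r" using block_col_carrier[OF X, of m "m - 1"] by auto
    then have n: "n > 0" by (cases n) auto
    have "(fiedler n m A 1 * ?E) $$ (p, c) = (\<Sum>k = 0..<m * n. fiedler n m A 1 $$ (p, k) * ?E $$ (k, c))"
      using pc c Fc by (simp add: scalar_prod_def)
    also have "\<dots> = (\<Sum>k = 0..<m * n. if k = p + n then ?E $$ (k, c) else 0)"
    proof (rule sum.cong)
      fix k assume k: "k \<in> {0..<m * n}"
      show "fiedler n m A 1 $$ (p, k) * ?E $$ (k, c) = (if k = p + n then ?E $$ (k, c) else 0)"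
      proof (cases "k < ?a + n")
        case True
        then show ?thesis using zero pc by simp
      next
        case False
        then have "fiedler n m A 1 $$ (p, k) = (if k = p + n then 1 else 0)"
        proof -
          obtain q where q: "k = ?a + n + q" "q < n"
            using False k unfolding mn by (metis add_diff_inverse_nat add.assoc nat_add_left_cancel_less atLeastLessThan_iff)
          show ?thesis
          proof (cases "p < ?a")
            case True
            then show ?thesis using q A1 unfolding F by (auto simp: dsum_def)
          next
            case False
            then obtain p' where p': "p = ?a + p'" by (metis le_iff_add not_le)
            have "p' < n + n" using pc p' unfolding mn by simp
            then show ?thesis using q p' A1 unfolding F by (auto simp: dsum_def)
          qed
        qed
        then show ?thesis by simp
      qed
    qed simp
    also have "\<dots> = (if p + n < m * n then ?E $$ (p + n, c) else 0)" by simp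
    also have "\<dots> = block_col m (m - 1) X $$ (p, c)"
    proof -
      have "p + n < m * n \<or> p div n \<noteq> m - 2"
      proof (cases "p + n < m * n")
        case False
        then have "(m - 1) * n \<le> p" by (simp add: diff_mult_distrib)
        then have "m - 1 \<le> p div n" using n by (simp add: less_eq_div_iff_mult_less_eq)
        then show ?thesis using m by linarith
      qed simp
      moreover have "block_col m (m - 1) X $$ (p, c) = (if p div n = m - 2 then X $$ (p mod n, c) else 0)"
        using pc X m by (subst block_col_index[of _ n r]) (auto simp: numeral_2_eq_2)
      moreover have "?E $$ (p + n, c) = (if p div n = m - 2 then X $$ (p mod n, c) else 0)" if "p + n < m * n"
        using pc X m n that by (subst block_col_index[of _ n r]) auto
      ultimately show ?thesis by auto
    qed
    finally show "(fiedler n m A 1 * ?E) $$ (p, c) = block_col m (m - 1) X $$ (p, c)" .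
  qed (use c Fc block_col_carrier[OF X, of m "m - 1"] in auto)
qed

text \<open>All the indices that occur here are so large that the factors stay above block row \<open>j\<close>.\<close>

lemma fiedlers_block_col:
  assumes A: "\<And>i. i \<le> m \<Longrightarrow> A i \<in> carrier_mat n n" and X: "X \<in> carrier_mat n r"
    and j: "1 \<le> j" "j \<le> m"
    and t: "\<And>i. i \<in> set t \<Longrightarrow> i \<noteq> 0 \<and> - int m \<le> i \<and> i < int m \<and> int m - \<bar>i\<bar> + 1 < int j"
  shows "fiedlers n m A t * block_col m j X = block_col m j X"
  using t
proof (induction t)
  case Nil
  then show ?case using block_col_carrier[OF X, of m j] by (simp add: fiedlers_def)
next
  case (Cons i t)
  have i: "i \<noteq> 0" "- int m \<le> i" "i < int m" "int m - \<bar>i\<bar> + 1 < int j" using Cons.prems[of i] by auto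
  have c: "fiedler n m A i \<in> carrier_mat (m * n) (m * n)"
    using A i by (intro fiedler_carrier) auto
  have cs: "fiedlers n m A t \<in> carrier_mat (m * n) (m * n)"
    using A Cons.prems by (intro fiedlers_carrier) force+
  have "fiedlers n m A (i # t) * block_col m j X = fiedler n m A i * (fiedlers n m A t * block_col m j X)"
    unfolding fiedlers_def using c cs block_col_carrier[OF X, of m j] by (simp add: fiedlers_def)
  also have "\<dots> = fiedler n m A i * block_col m j X" using Cons by simp
  also have "\<dots> = block_col m j X"
    by (rule fiedler_block_col) (use A X i j in auto)
  finally show ?case .
qed

lemma fiedler_transpose:
  assumes A: "\<And>i. i \<le> m \<Longrightarrow> A i \<in> carrier_mat n n" and "\<bar>i\<bar> \<le> int m"
  shows "transpose_mat (fiedler n m A i) = fiedler n m (\<lambda>i. transpose_mat (A i)) i"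
proof -
  define k where "k = nat \<bar>i\<bar>"
  have c: "A k \<in> carrier_mat n n" using assms by (auto simp: k_def)
  have b: "transpose_mat (four_block_mat (- A k) (1\<^sub>m n) (1\<^sub>m n) (0\<^sub>m n n))
      = four_block_mat (- transpose_mat (A k)) (1\<^sub>m n) (1\<^sub>m n) (0\<^sub>m n n)"
    "transpose_mat (four_block_mat (0\<^sub>m n n) (1\<^sub>m n) (1\<^sub>m n) (A k))
      = four_block_mat (0\<^sub>m n n) (1\<^sub>m n) (1\<^sub>m n) (transpose_mat (A k))"
    using c by (subst transpose_four_block_mat[of _ n n _ n _ n]; simp add: transpose_uminus)+
  show ?thesis
    unfolding fiedler_def Let_def k_def[symmetric] by (auto simp: dsum_transpose transpose_uminus b)
qed

lemma fiedlers_transpose: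
  assumes A: "\<And>i. i \<le> m \<Longrightarrow> A i \<in> carrier_mat n n" and t: "\<And>i. i \<in> set t \<Longrightarrow> - int m \<le> i \<and> i < int m"
  shows "transpose_mat (fiedlers n m A t) = fiedlers n m (\<lambda>i. transpose_mat (A i)) (rev t)"
  using t
proof (induction t)
  case Nil
  then show ?case by (simp add: fiedlers_def)
next
  case (Cons i t)
  let ?A = "\<lambda>i. transpose_mat (A i)"
  have A': "?A i \<in> carrier_mat n n" if "i \<le> m" for i using A that by simp
  have i: "- int m \<le> i" "i < int m" using Cons.prems[of i] by auto
  have i': "\<bar>i\<bar> \<le> int m" using i by auto
  have c: "fiedler n m A i \<in> carrier_mat (m * n) (m * n)" "fiedler n m ?A i \<in> carrier_mat (m * n) (m * n)"
    using A i by (intro fiedler_carrier; auto)+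
  have cs: "fiedlers n m A t \<in> carrier_mat (m * n) (m * n)"
    using A Cons.prems by (intro fiedlers_carrier) force+
  have "transpose_mat (fiedlers n m A (i # t)) = fiedlers n m ?A (rev t) * fiedler n m ?A i"
    using Cons fiedler_transpose[of m A n i] A i'
    by (simp add: fiedlers_def transpose_mult[OF c(1) cs[unfolded fiedlers_def]])
  also have "fiedler n m ?A i = fiedlers n m ?A [i]" using c(2) by (simp add: fiedlers_def)
  also have "fiedlers n m ?A (rev t) * fiedlers n m ?A [i] = fiedlers n m ?A (rev t @ [i])"
    by (rule fiedlers_append[symmetric]) (use A' Cons.prems in auto)
  finally show ?case by simp
qed

lemma fiedlers_block_row:
  assumes A: "\<And>i. i \<le> m \<Longrightarrow> A i \<in> carrier_mat n n" and X: "X \<in> carrier_mat r n"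
    and j: "1 \<le> j" "j \<le> m"
    and t: "\<And>i. i \<in> set t \<Longrightarrow> i \<noteq> 0 \<and> - int m \<le> i \<and> i < int m \<and> int m - \<bar>i\<bar> + 1 < int j"
  shows "block_row m j X * fiedlers n m A t = block_row m j X"
proof -
  let ?A = "\<lambda>i. transpose_mat (A i)" and ?E = "block_col m j (transpose_mat X)"
  have c: "?E \<in> carrier_mat (m * n) r" using X by (intro block_col_carrier) auto
  have cs: "fiedlers n m A t \<in> carrier_mat (m * n) (m * n)" "fiedlers n m ?A (rev t) \<in> carrier_mat (m * n) (m * n)"
    using A t by (intro fiedlers_carrier; force)+
  have "fiedlers n m ?A (rev t) * ?E = ?E"
    by (rule fiedlers_block_col) (use A X j t in auto)
  then have "transpose_mat (fiedlers n m ?A (rev t) * ?E) = transpose_mat ?E" by simp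
  moreover have "transpose_mat (fiedlers n m ?A (rev t)) = fiedlers n m A t"
    using fiedlers_transpose[of m A n t] A t by (metis transpose_transpose)
  ultimately show ?thesis
    using X cs c by (simp add: block_row_transpose transpose_mult[OF cs(2) c])
qed

lemma fiedler_one_block_row:
  assumes A: "\<And>i. i \<le> m \<Longrightarrow> A i \<in> carrier_mat n n" and X: "X \<in> carrier_mat r n" and m: "2 \<le> m"
  shows "block_row m m X * fiedler n m A 1 = block_row m (m - 1) X"
proof -
  let ?A = "\<lambda>i. transpose_mat (A i)" and ?E = "block_col m m (transpose_mat X)"
  have c: "?E \<in> carrier_mat (m * n) r" using X by (intro block_col_carrier) auto
  have cf: "fiedler n m ?A 1 \<in> carrier_mat (m * n) (m * n)"
    using A m by (intro fiedler_carrier) auto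
  have "fiedler n m ?A 1 * ?E = block_col m (m - 1) (transpose_mat X)"
    by (rule fiedler_one_block_col) (use A X m in auto)
  then have "transpose_mat (fiedler n m ?A 1 * ?E) = transpose_mat (block_col m (m - 1) (transpose_mat X))" by simp
  moreover have "transpose_mat (fiedler n m ?A 1) = fiedler n m A 1"
    using fiedler_transpose[of m A n 1] A m by (metis abs_1 of_nat_1 of_nat_le_iff one_le_numeral order_trans transpose_transpose)
  ultimately show ?thesis
    using X c cf by (simp add: block_row_transpose transpose_mult[OF cf c])
qed

section \<open>Rational functions near infinity\<close>

interpretation const_hom: inj_comm_ring_hom "\<lambda>c::complex. [:c:]"
  by unfold_locales (auto simp: one_pCons)

interpretation fract_hom: inj_comm_ring_hom "to_fract :: complex poly \<Rightarrow> complex poly fract"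
  by unfold_locales auto

interpretation const_fract_hom: inj_comm_ring_hom "\<lambda>c::complex. to_fract [:c:]"
proof unfold_locales
  fix x y :: complex
  show "to_fract [:x + y:] = to_fract [:x:] + to_fract [:y:]"
    unfolding const_hom.hom_add fract_hom.hom_add ..
  show "to_fract [:x * y:] = to_fract [:x:] * to_fract [:y:]"
    unfolding const_hom.hom_mult fract_hom.hom_mult ..
  show "to_fract [:0 :: complex:] = 0" "to_fract [:1 :: complex:] = 1"
    unfolding const_hom.hom_zero const_hom.hom_one by simp_all
qed auto

lemma smult_smult_mat: "a \<cdot>\<^sub>m (b \<cdot>\<^sub>m M) = (a * b) \<cdot>\<^sub>m (M :: 'a::semigroup_mult mat)"
  by (rule eq_matI) (auto simp: mult.assoc)

lemma smult_one_mat [simp]: "1 \<cdot>\<^sub>m M = (M :: 'a::monoid_mult mat)"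
  by (rule eq_matI) auto

lemma minus_one_poly_const: "[:- 1:] = (- 1 :: complex poly)"
  by (simp only: one_pCons minus_pCons minus_zero)

lemma const_rat_mat_eq: "const_rat_mat M = map_mat (\<lambda>c. to_fract [:c:]) M"
  by (rule eq_matI) (auto simp: rat_mat_def const_mat_def)

lemma eventually_poly_nonzero:
  fixes p :: "complex poly"
  assumes "p \<noteq> 0"
  shows "eventually (\<lambda>x. poly p x \<noteq> 0) at_infinity"
proof -
  have "finite (norm ` {x. poly p x = 0})" using poly_roots_finite[OF assms] by simp
  then obtain b where "\<And>x. poly p x = 0 \<Longrightarrow> norm x \<le> b" using Max_ge by blast
  then have "poly p x \<noteq> 0" if "b + 1 \<le> norm x" for x using that by fastforce
  then show ?thesis unfolding eventually_at_infinity by blast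
qed

text \<open>The reduced fraction and the given one agree outside the finitely many zeros of the two denominators.\<close>

lemma rat_eval_Fract:
  assumes "b \<noteq> 0"
  shows "eventually (\<lambda>x. rat_eval (Fract a b) x = poly a x / poly b x) at_infinity"
proof -
  define p q where "p = fst (quot_of_fract (Fract a b))" and "q = snd (quot_of_fract (Fract a b))"
  have q: "q \<noteq> 0" unfolding q_def by (rule snd_quot_of_fract_nonzero)
  have "Fract p q = Fract a b" unfolding p_def q_def by (rule Fract_quot_of_fract)
  then have "p * b = a * q" using q assms by (simp add: eq_fract)
  then have "poly p x * poly b x = poly a x * poly q x" for x by (metis poly_mult)
  then have "poly q x \<noteq> 0 \<Longrightarrow> poly b x \<noteq> 0 \<Longrightarrow> poly p x / poly q x = poly a x / poly b x" for x
    by (simp add: frac_eq_eq)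
  then show ?thesis
    unfolding rat_eval_def p_def[symmetric] q_def[symmetric]
    using eventually_conj[OF eventually_poly_nonzero[OF q] eventually_poly_nonzero[OF assms]]
    by (auto elim: eventually_mono)
qed

definition value_at_infinity :: "complex poly fract \<Rightarrow> complex \<Rightarrow> bool" where
  "value_at_infinity f c \<longleftrightarrow> (rat_eval f \<longlongrightarrow> c) at_infinity"

definition proper_functions :: "complex poly fract set" where
  "proper_functions = {f. \<exists>c. value_at_infinity f c}"

lemma Fract_exists: obtains a b where "f = Fract a b" "b \<noteq> 0"
  by (cases f) auto

lemma value_at_infinity_unique:
  assumes "value_at_infinity f c" "value_at_infinity f d"
  shows "c = d"
proof -
  have "at_infinity \<noteq> (bot :: complex filter)"
  proof
    assume "at_infinity = (bot :: complex filter)"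
    then have "eventually (\<lambda>x::complex. False) at_infinity" by simp
    then obtain b where "\<And>x::complex. b \<le> norm x \<Longrightarrow> False" unfolding eventually_at_infinity by blast
    from this[of "of_real \<bar>b\<bar>"] show False using abs_ge_self[of b] by simp
  qed
  then show ?thesis using assms tendsto_unique unfolding value_at_infinity_def by blast
qed

lemma value_at_infinity_add:
  assumes "value_at_infinity f c" "value_at_infinity g d"
  shows "value_at_infinity (f + g) (c + d)"
proof -
  obtain p q where f: "f = Fract p q" "q \<noteq> 0" by (rule Fract_exists)
  obtain a b where g: "g = Fract a b" "b \<noteq> 0" by (rule Fract_exists)
  have fg: "f + g = Fract (p * b + a * q) (q * b)" using f g by simp
  have qb: "q * b \<noteq> 0" using f g by simp
  have "eventually (\<lambda>x. rat_eval f x + rat_eval g x = rat_eval (f + g) x) at_infinity"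
    using rat_eval_Fract[OF f(2), of p, folded f(1)] rat_eval_Fract[OF g(2), of a, folded g(1)]
      rat_eval_Fract[OF qb, of "p * b + a * q", folded fg] eventually_poly_nonzero[OF f(2)] eventually_poly_nonzero[OF g(2)]
    by eventually_elim (simp add: add_frac_eq)
  moreover have "((\<lambda>x. rat_eval f x + rat_eval g x) \<longlongrightarrow> c + d) at_infinity"
    using assms unfolding value_at_infinity_def by (rule tendsto_add)
  ultimately show ?thesis unfolding value_at_infinity_def by (blast intro: Lim_transform_eventually)
qed

lemma value_at_infinity_mult:
  assumes "value_at_infinity f c" "value_at_infinity g d"
  shows "value_at_infinity (f * g) (c * d)"
proof -
  obtain p q where f: "f = Fract p q" "q \<noteq> 0" by (rule Fract_exists)
  obtain a b where g: "g = Fract a b" "b \<noteq> 0" by (rule Fract_exists)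
  have fg: "f * g = Fract (p * a) (q * b)" using f g by simp
  have qb: "q * b \<noteq> 0" using f g by simp
  have "eventually (\<lambda>x. rat_eval f x * rat_eval g x = rat_eval (f * g) x) at_infinity"
    using rat_eval_Fract[OF f(2), of p, folded f(1)] rat_eval_Fract[OF g(2), of a, folded g(1)]
      rat_eval_Fract[OF qb, of "p * a", folded fg]
    by eventually_elim simp
  moreover have "((\<lambda>x. rat_eval f x * rat_eval g x) \<longlongrightarrow> c * d) at_infinity"
    using assms unfolding value_at_infinity_def by (rule tendsto_mult)
  ultimately show ?thesis unfolding value_at_infinity_def by (blast intro: Lim_transform_eventually)
qed

lemma to_fract_eq_Fract: "to_fract p = Fract p 1"
  by (simp add: to_fract_def)

lemma value_at_infinity_const: "value_at_infinity (to_fract [:c:]) c"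
proof -
  have "eventually (\<lambda>x. c = rat_eval (to_fract [:c:]) x) at_infinity"
    using rat_eval_Fract[of 1 "[:c:]"] by (simp add: to_fract_eq_Fract eq_commute)
  then show ?thesis unfolding value_at_infinity_def
    by (rule Lim_transform_eventually[OF tendsto_const])
qed

lemma value_at_infinity_0: "value_at_infinity 0 0" and value_at_infinity_1: "value_at_infinity 1 1"
  using value_at_infinity_const[of 0] value_at_infinity_const[of 1] by (simp_all add: one_pCons[symmetric])

lemma value_at_infinity_diff:
  assumes "value_at_infinity f c" "value_at_infinity g d"
  shows "value_at_infinity (f - g) (c - d)"
proof -
  have "to_fract [:- 1:] = (- 1 :: complex poly fract)"
    using fract_hom.hom_uminus[of 1] by (simp add: minus_one_poly_const)
  then have "value_at_infinity (- 1) (- 1)" using value_at_infinity_const[of "- 1"] by simp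
  from value_at_infinity_add[OF assms(1) value_at_infinity_mult[OF this assms(2)]]
  show ?thesis by simp
qed

lemma value_at_infinity_sum:
  "(\<And>i. i \<in> I \<Longrightarrow> value_at_infinity (f i) (c i)) \<Longrightarrow> value_at_infinity (sum f I) (sum c I)"
  by (induction I rule: infinite_finite_induct) (auto intro: value_at_infinity_add value_at_infinity_0)

lemma value_at_infinity_prod:
  "(\<And>i. i \<in> I \<Longrightarrow> value_at_infinity (f i) (c i)) \<Longrightarrow> value_at_infinity (prod f I) (prod c I)"
  by (induction I rule: infinite_finite_induct) (auto intro: value_at_infinity_mult value_at_infinity_1)

lemma value_at_infinity_inverse:
  assumes "value_at_infinity f c" "c \<noteq> 0"
  shows "value_at_infinity (inverse f) (inverse c)"
proof -
  obtain p q where f: "f = Fract p q" "q \<noteq> 0" by (rule Fract_exists)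
  have "p \<noteq> 0"
  proof
    assume "p = 0"
    then have "f = 0" using f by (simp add: fract_collapse)
    then have "value_at_infinity f 0" by (simp add: value_at_infinity_0)
    then show False using assms value_at_infinity_unique by blast
  qed
  have i: "inverse f = Fract q p" using f by simp
  have "eventually (\<lambda>x. inverse (rat_eval f x) = rat_eval (inverse f) x) at_infinity"
    using rat_eval_Fract[OF f(2), of p, folded f(1)] rat_eval_Fract[OF \<open>p \<noteq> 0\<close>, of q, folded i]
    by eventually_elim simp
  moreover have "((\<lambda>x. inverse (rat_eval f x)) \<longlongrightarrow> inverse c) at_infinity"
    using assms unfolding value_at_infinity_def by (intro tendsto_inverse)
  ultimately show ?thesis unfolding value_at_infinity_def by (blast intro: Lim_transform_eventually)
qed

lemma value_at_infinity_inverse_rvar: "value_at_infinity (inverse rvar) 0"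
proof -
  have i: "inverse rvar = Fract 1 [:0, 1:]" by (simp add: to_fract_eq_Fract)
  have "eventually (\<lambda>x. inverse x = rat_eval (inverse rvar) x) at_infinity"
    using rat_eval_Fract[of "[:0, 1:]" 1, folded i]
    by (auto elim!: eventually_mono simp: inverse_eq_divide)
  then show ?thesis unfolding value_at_infinity_def
    by (rule Lim_transform_eventually[OF tendsto_inverse_0])
qed

interpretation proper: scalar_subring proper_functions
proof
  show "1 \<in> proper_functions" using value_at_infinity_1 by (auto simp: proper_functions_def)
  show "x - y \<in> proper_functions" if "x \<in> proper_functions" "y \<in> proper_functions" for x y
    using that value_at_infinity_diff by (fastforce simp: proper_functions_def)
  show "x * y \<in> proper_functions" if "x \<in> proper_functions" "y \<in> proper_functions" for x y
    using that value_at_infinity_mult by (fastforce simp: proper_functions_def)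
qed

interpretation all_scalars: scalar_subring UNIV
  by unfold_locales auto

lemma proper_const [simp]: "to_fract [:c:] \<in> proper_functions"
  using value_at_infinity_const by (auto simp: proper_functions_def)

lemma proper_inverse_rvar [simp]: "inverse rvar \<in> proper_functions"
  using value_at_infinity_inverse_rvar by (auto simp: proper_functions_def)

lemmas proper_inverse_rvar' [simp] = proper_inverse_rvar[unfolded pCons_one]

lemma const_rat_mat_proper: "M \<in> carrier_mat a b \<Longrightarrow> const_rat_mat M \<in> proper.mats a b"
  by (auto simp: const_rat_mat_eq proper.mats_def)

text \<open>Taking limits is multiplicative, so the limits of a matrix and of its inverse are inverse to each other.\<close>

lemma proper_GL_biproper:
  assumes "U \<in> proper.GL k"
  shows "biproper k U"
proof -
  obtain V where U: "U \<in> proper.mats k k" and V: "V \<in> proper.mats k k" and UV: "U * V = 1\<^sub>m k" "V * U = 1\<^sub>m k"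
    using assms by (auto simp: proper.GL_def)
  have lim: "\<exists>M \<in> carrier_mat k k. \<forall>i<k. \<forall>j<k. value_at_infinity (X $$ (i, j)) (M $$ (i, j))"
    if "X \<in> proper.mats k k" for X
  proof -
    have "\<forall>i j. \<exists>c. i < k \<longrightarrow> j < k \<longrightarrow> value_at_infinity (X $$ (i, j)) c"
      using proper.matsD[OF that] by (auto simp: proper_functions_def)
    then obtain c where "\<And>i j. i < k \<Longrightarrow> j < k \<Longrightarrow> value_at_infinity (X $$ (i, j)) (c i j)"
      by metis
    then show ?thesis by (intro bexI[of _ "mat k k (\<lambda>(i, j). c i j)"]) auto
  qed
  obtain M where M: "M \<in> carrier_mat k k" "\<And>i j. i < k \<Longrightarrow> j < k \<Longrightarrow> value_at_infinity (U $$ (i, j)) (M $$ (i, j))"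
    using lim[OF U] by blast
  obtain N where N: "N \<in> carrier_mat k k" "\<And>i j. i < k \<Longrightarrow> j < k \<Longrightarrow> value_at_infinity (V $$ (i, j)) (N $$ (i, j))"
    using lim[OF V] by blast
  have prod: "X' * Y' = 1\<^sub>m k"
    if X: "X \<in> proper.mats k k" and Y: "Y \<in> proper.mats k k" and XY: "X * Y = 1\<^sub>m k"
      and X': "X' \<in> carrier_mat k k" "\<And>i j. i < k \<Longrightarrow> j < k \<Longrightarrow> value_at_infinity (X $$ (i, j)) (X' $$ (i, j))"
      and Y': "Y' \<in> carrier_mat k k" "\<And>i j. i < k \<Longrightarrow> j < k \<Longrightarrow> value_at_infinity (Y $$ (i, j)) (Y' $$ (i, j))"
    for X Y X' Y'
  proof (rule eq_matI)
    fix i j assume "i < dim_row (1\<^sub>m k :: complex mat)" "j < dim_col (1\<^sub>m k :: complex mat)"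
    then have ij: "i < k" "j < k" by auto
    have c: "X \<in> carrier_mat k k" "Y \<in> carrier_mat k k" using X Y by auto
    have "value_at_infinity (\<Sum>l = 0..<k. X $$ (i, l) * Y $$ (l, j)) (\<Sum>l = 0..<k. X' $$ (i, l) * Y' $$ (l, j))"
      using ij X' Y' by (intro value_at_infinity_sum value_at_infinity_mult) auto
    also have "(\<Sum>l = 0..<k. X $$ (i, l) * Y $$ (l, j)) = (X * Y) $$ (i, j)"
      using ij c by (simp add: scalar_prod_def)
    also have "(\<Sum>l = 0..<k. X' $$ (i, l) * Y' $$ (l, j)) = (X' * Y') $$ (i, j)"
      using ij X' Y' by (simp add: scalar_prod_def)
    finally have "value_at_infinity ((1\<^sub>m k :: complex poly fract mat) $$ (i, j)) ((X' * Y') $$ (i, j))" unfolding XY .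
    moreover have "value_at_infinity ((1\<^sub>m k :: complex poly fract mat) $$ (i, j)) ((1\<^sub>m k :: complex mat) $$ (i, j))"
      using ij by (auto simp: value_at_infinity_0 value_at_infinity_1)
    ultimately show "(X' * Y') $$ (i, j) = (1\<^sub>m k :: complex mat) $$ (i, j)"
      by (rule value_at_infinity_unique)
  qed (use X' Y' in auto)
  have "invertible_mat M"
    using prod[OF U V UV(1) M N] prod[OF V U UV(2) N M] M(1) N(1)
    by (auto simp: invertible_mat_def inverts_mat_def intro!: exI[of _ N])
  then show ?thesis
    using U M unfolding biproper_def value_at_infinity_def by blast
qed

lemma proper_det:
  assumes "X \<in> proper.mats k k"
  shows "det X \<in> proper_functions"
proof -
  have s: "signof p \<in> proper_functions" for p
    using proper.one_closed proper.uminus_closed[OF proper.one_closed] by (auto simp: sign_def)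
  have c: "X \<in> carrier_mat k k" using assms by auto
  show ?thesis unfolding det_def'[OF c]
    using assms s
    by (intro proper.sum_closed proper.mult_closed proper.prod_closed)
      (auto simp: proper.mats_def permutes_in_image)
qed

text \<open>Write \<open>\<lambda>I - A = \<lambda> (I - \<lambda>\<inverse> A)\<close>. The second factor tends to the identity at infinity, so its determinant tends
  to 1 and the adjugate formula gives an inverse with proper entries.\<close>

lemma resolvent_exists:
  assumes A: "A \<in> carrier_mat r r"
  obtains R where "R \<in> proper.mats r r"
    "(rvar \<cdot>\<^sub>m 1\<^sub>m r - const_rat_mat A) * R = 1\<^sub>m r" "R * (rvar \<cdot>\<^sub>m 1\<^sub>m r - const_rat_mat A) = 1\<^sub>m r"
    "the (mat_inverse (rvar \<cdot>\<^sub>m const_rat_mat (1\<^sub>m r) - const_rat_mat A)) = R"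
proof -
  let ?A = "const_rat_mat A" and ?mu = "inverse rvar"
  have rv: "rvar \<noteq> 0" by simp
  have cA: "?A \<in> carrier_mat r r" using A by (simp add: const_rat_mat_eq)
  define N where "N = 1\<^sub>m r - ?mu \<cdot>\<^sub>m ?A"
  have cN: "N \<in> carrier_mat r r" using cA by (auto simp: N_def)
  have Nm: "N \<in> proper.mats r r"
    using A cA by (intro proper.matsI) (auto simp: N_def const_rat_mat_eq intro!: proper.diff_closed proper.mult_closed)
  have v: "value_at_infinity (N $$ (i, j)) ((1\<^sub>m r :: complex mat) $$ (i, j))" if "i < r" "j < r" for i j
  proof -
    have "value_at_infinity ((1\<^sub>m r :: complex poly fract mat) $$ (i, j)) ((1\<^sub>m r :: complex mat) $$ (i, j))"
      using that by (auto simp: value_at_infinity_0 value_at_infinity_1)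
    moreover have "value_at_infinity (?mu * to_fract [:A $$ (i, j):]) (0 * A $$ (i, j))"
      by (intro value_at_infinity_mult value_at_infinity_inverse_rvar value_at_infinity_const)
    ultimately have "value_at_infinity ((1\<^sub>m r :: complex poly fract mat) $$ (i, j) - ?mu * to_fract [:A $$ (i, j):])
      ((1\<^sub>m r :: complex mat) $$ (i, j) - 0 * A $$ (i, j))" by (rule value_at_infinity_diff)
    then show ?thesis using that A by (simp add: N_def const_rat_mat_eq)
  qed
  have "value_at_infinity (det N) (det (1\<^sub>m r))"
  proof -
    have s: "value_at_infinity (signof p) (signof p)" for p
      using value_at_infinity_1 value_at_infinity_diff[OF value_at_infinity_0 value_at_infinity_1] by (auto simp: sign_def)
    show ?thesis unfolding det_def'[OF cN] det_def'[OF one_carrier_mat]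
      by (intro value_at_infinity_sum value_at_infinity_mult value_at_infinity_prod s v) (auto simp: permutes_in_image)
  qed
  then have d: "value_at_infinity (det N) 1" by simp
  have dinv: "inverse (det N) \<in> proper_functions"
    using value_at_infinity_inverse[OF d] by (auto simp: proper_functions_def)
  have d0: "det N \<noteq> 0"
  proof
    assume "det N = 0"
    then have "value_at_infinity (det N) 0" by (simp add: value_at_infinity_0)
    then show False using d value_at_infinity_unique zero_neq_one by blast
  qed
  have adj: "adj_mat N \<in> proper.mats r r"
  proof (rule proper.matsI)
    show "adj_mat N \<in> carrier_mat r r" using adj_mat[OF cN] by blast
    fix i j assume ij: "i < r" "j < r"
    have "mat_delete N j i \<in> proper.mats (r - 1) (r - 1)"
      using Nm ij cN by (intro proper.matsI) (auto simp: mat_delete_def intro: proper.matsD)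
    then have "det (mat_delete N j i) \<in> proper_functions" by (rule proper_det)
    moreover have "(- 1) ^ e \<in> proper_functions" for e
      by (induction e) (auto intro: proper.uminus_closed)
    ultimately show "adj_mat N $$ (i, j) \<in> proper_functions"
      using ij cN by (auto simp: adj_mat_def cofactor_def intro: proper.mult_closed)
  qed
  define D where "D = inverse (det N) \<cdot>\<^sub>m adj_mat N"
  have Dm: "D \<in> proper.mats r r" unfolding D_def using adj dinv by (rule proper.mats_smult)
  have cD: "D \<in> carrier_mat r r" using Dm by auto
  have ND: "N * D = 1\<^sub>m r" "D * N = 1\<^sub>m r"
    unfolding D_def using adj_mat[OF cN] d0
    by (simp_all add: mult_smult_distrib[OF cN adj_mat(1)[OF cN]] mult_smult_assoc_mat[OF adj_mat(1)[OF cN] cN] smult_smult_mat)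
  define R where "R = ?mu \<cdot>\<^sub>m D"
  define L where "L = rvar \<cdot>\<^sub>m 1\<^sub>m r - ?A"
  have L: "L = rvar \<cdot>\<^sub>m N"
    unfolding L_def N_def using cA rv by (intro eq_matI) (auto simp: algebra_simps)
  have cL: "L \<in> carrier_mat r r" using cN by (simp add: L)
  have LR: "L * R = 1\<^sub>m r" "R * L = 1\<^sub>m r"
  proof -
    have "L * R = rvar \<cdot>\<^sub>m (?mu \<cdot>\<^sub>m (N * D))"
      unfolding L R_def mult_smult_assoc_mat[OF cN smult_carrier_mat[OF cD]] mult_smult_distrib[OF cN cD] ..
    moreover have "R * L = ?mu \<cdot>\<^sub>m (rvar \<cdot>\<^sub>m (D * N))"
      unfolding L R_def mult_smult_assoc_mat[OF cD smult_carrier_mat[OF cN]] mult_smult_distrib[OF cD cN] ..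
    ultimately show "L * R = 1\<^sub>m r" "R * L = 1\<^sub>m r"
      using rv ND by (simp_all add: smult_smult_mat)
  qed
  have Rm: "R \<in> proper.mats r r" unfolding R_def using Dm by (intro proper.mats_smult) auto
  have cR: "R \<in> carrier_mat r r" using Rm by auto
  have one: "const_rat_mat (1\<^sub>m r) = 1\<^sub>m r" by (simp add: const_rat_mat_eq const_fract_hom.mat_hom_one)
  have "L \<in> Units (ring_mat TYPE(complex poly fract) r ())"
    using cL cR LR by (auto simp: Units_def ring_mat_def)
  then obtain R' where R': "mat_inverse L = Some R'"
    using mat_inverse(1)[OF cL, of "()"] by (cases "mat_inverse L") auto
  then have R'L: "R' * L = 1\<^sub>m r" "R' \<in> carrier_mat r r" using mat_inverse(2)[OF cL] by auto
  have "R' = R' * (L * R)" using LR R'L by simp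
  also have "\<dots> = R' * L * R" by (rule assoc_mult_mat[symmetric]) (use R'L cL cR in auto)
  also have "\<dots> = R" using R'L cR by simp
  finally have "R' = R" .
  then have "the (mat_inverse (rvar \<cdot>\<^sub>m const_rat_mat (1\<^sub>m r) - ?A)) = R"
    unfolding one L_def[symmetric] using R' by (simp only: option.sel)
  then show ?thesis using that Rm LR unfolding L_def by blast
qed

lemma all_GL_unimodular:
  assumes "U \<in> all_scalars.GL k"
  shows "unimodular k U"
proof -
  obtain V where c: "U \<in> carrier_mat k k" "V \<in> carrier_mat k k" and UV: "U * V = 1\<^sub>m k"
    using assms by (auto simp: all_scalars.GL_def all_scalars.mats_def)
  have "det U * det V = 1" using det_mult[OF c] UV by simp
  then have "det U dvd 1" by (metis dvdI)
  then obtain c where "det U = [:c:]" "c \<noteq> 0" by (metis is_unit_polyE dvd_field_iff is_unit_pCons_iff)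
  then show ?thesis using c by (auto simp: unimodular_def)
qed

section \<open>The substitution of the negative variable\<close>

lemma poly_reflect_add: "poly_reflect (p + q) = poly_reflect p + poly_reflect q"
  and poly_reflect_mult: "poly_reflect (p * q) = poly_reflect p * poly_reflect q"
  and poly_reflect_const [simp]: "poly_reflect [:c:] = [:c:]"
  and poly_reflect_0 [simp]: "poly_reflect 0 = 0"
  and poly_reflect_1 [simp]: "poly_reflect 1 = 1"
  by (simp_all add: poly_reflect_def pcompose_add pcompose_mult pcompose_pCons pcompose_1 minus_one_poly_const)

lemma poly_reflect_smult: "poly_reflect ([:c:] * p) = [:c:] * poly_reflect p"
  by (simp add: poly_reflect_mult del: mult_pCons_left)

lemma poly_reflect_smult': "poly_reflect (smult c p) = smult c (poly_reflect p)"
  using poly_reflect_smult[of c p] by simp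

interpretation reflect_hom: comm_ring_hom poly_reflect
  by unfold_locales (auto simp: poly_reflect_add poly_reflect_mult)

text \<open>The substitution is an involution.\<close>

lemma poly_reflect_eq_0: "poly_reflect p = 0 \<longleftrightarrow> p = 0"
proof
  assume "poly_reflect p = 0"
  moreover have "poly_reflect (poly_reflect p) = p"
    by (simp add: poly_reflect_def pcompose_assoc[symmetric] pcompose_pCons pcompose_idR[unfolded pCons_one])
  ultimately show "p = 0" by simp
qed simp

lemma rat_reflect_Fract:
  assumes "b \<noteq> 0"
  shows "rat_reflect (Fract a b) = Fract (poly_reflect a) (poly_reflect b)"
proof -
  define p q where "p = fst (quot_of_fract (Fract a b))" and "q = snd (quot_of_fract (Fract a b))"
  have q: "q \<noteq> 0" unfolding q_def by (rule snd_quot_of_fract_nonzero)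
  have "Fract p q = Fract a b" unfolding p_def q_def by (rule Fract_quot_of_fract)
  then have "p * b = a * q" using q assms by (simp add: eq_fract)
  then have "poly_reflect p * poly_reflect b = poly_reflect a * poly_reflect q"
    by (metis poly_reflect_mult)
  then show ?thesis
    unfolding rat_reflect_def p_def[symmetric] q_def[symmetric]
    using q assms by (simp add: eq_fract poly_reflect_eq_0)
qed

lemma rat_reflect_to_fract: "rat_reflect (to_fract p) = to_fract (poly_reflect p)"
  by (simp add: to_fract_eq_Fract rat_reflect_Fract)

lemma rat_reflect_add: "rat_reflect (f + g) = rat_reflect f + rat_reflect g"
proof -
  obtain p q where f: "f = Fract p q" "q \<noteq> 0" by (rule Fract_exists)
  obtain a b where g: "g = Fract a b" "b \<noteq> 0" by (rule Fract_exists)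
  show ?thesis using f g by (simp add: rat_reflect_Fract poly_reflect_eq_0 poly_reflect_add poly_reflect_mult)
qed

lemma rat_reflect_0 [simp]: "rat_reflect 0 = 0"
  using rat_reflect_to_fract[of 0] by simp

section \<open>Minimality and irreducibility\<close>

text \<open>If no nonzero row vector is annihilated, the Gram matrix \<open>M M\<^sup>*\<close> is nonsingular, because \<open>v M M\<^sup>* = 0\<close> implies
  that \<open>v M\<close> has norm 0. Then \<open>M\<close> is surjective.\<close>

lemma full_row_rank:
  fixes M :: "complex mat"
  assumes M: "M \<in> carrier_mat r c"
    and null: "\<And>v. v \<in> carrier_mat 1 r \<Longrightarrow> v * M = 0\<^sub>m 1 c \<Longrightarrow> v = 0\<^sub>m 1 r"
  shows "vec_space.rank r M = r"
proof -
  interpret vec_space "TYPE(complex)" r .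
  define H where "H = mat c r (\<lambda>(i, j). cnj (M $$ (j, i)))"
  have H: "H \<in> carrier_mat c r" by (simp add: H_def)
  have MH: "M * H \<in> carrier_mat r r" using M H by simp
  have "det (M * H) \<noteq> 0"
  proof
    assume "det (M * H) = 0"
    then have "det (transpose_mat (M * H)) = 0" using det_transpose[OF MH] by simp
    then obtain v where v: "v \<in> carrier_vec r" "v \<noteq> 0\<^sub>v r" "transpose_mat (M * H) *\<^sub>v v = 0\<^sub>v r"
      using det_0_iff_vec_prod_zero[of "transpose_mat (M * H)" r] MH by auto
    define V where "V = mat 1 r (\<lambda>(i, j). v $ j)"
    have V: "V \<in> carrier_mat 1 r" by (simp add: V_def)
    have VM: "V * M \<in> carrier_mat 1 c" using V M by simp
    define P where "P = M * H"
    have P: "P \<in> carrier_mat r r" "transpose_mat P *\<^sub>v v = 0\<^sub>v r" using MH v(3) by (simp_all add: P_def)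
    have sum0: "(\<Sum>k = 0..<r. v $ k * P $$ (k, i)) = 0" if "i < r" for i
    proof -
      have "(transpose_mat P *\<^sub>v v) $ i = (\<Sum>k = 0..<r. P $$ (k, i) * v $ k)"
        using that v(1) P(1) by (simp add: scalar_prod_def)
      then show ?thesis unfolding P(2) using that by (simp add: mult.commute)
    qed
    have "V * (M * H) = 0\<^sub>m 1 r"
      unfolding P_def[symmetric] using V P(1) by (intro eq_matI) (auto simp: V_def sum0 scalar_prod_def)
    then have VMH: "(V * M) * H = 0\<^sub>m 1 r" using V M H by simp
    define u where "u = (\<lambda>i. (V * M) $$ (0, i))"
    have uH: "(\<Sum>i = 0..<c. u i * cnj (M $$ (k, i))) = 0" if "k < r" for k
    proof -
      have "(Z * H) $$ (0, k) = (\<Sum>i = 0..<c. Z $$ (0, i) * H $$ (i, k))" if "Z \<in> carrier_mat 1 c" for Z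
        using that \<open>k < r\<close> H by (simp add: scalar_prod_def)
      from this[OF VM] have "((V * M) * H) $$ (0, k) = (\<Sum>i = 0..<c. u i * H $$ (i, k))"
        unfolding u_def .
      then show ?thesis unfolding VMH using that by (simp add: H_def)
    qed
    have u: "u i = (\<Sum>k = 0..<r. v $ k * M $$ (k, i))" if "i < c" for i
      using that V M by (simp add: u_def V_def scalar_prod_def)
    have "(\<Sum>i = 0..<c. u i * cnj (u i)) = (\<Sum>i = 0..<c. \<Sum>k = 0..<r. cnj (v $ k) * (u i * cnj (M $$ (k, i))))"
      by (rule sum.cong) (auto simp: u sum_distrib_left mult_ac intro!: arg_cong2[of _ _ _ _ "(*)"])
    also have "\<dots> = (\<Sum>k = 0..<r. cnj (v $ k) * (\<Sum>i = 0..<c. u i * cnj (M $$ (k, i))))"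
      by (subst sum.swap) (simp add: sum_distrib_left)
    also have "\<dots> = 0" using uH by simp
    finally have s0: "(\<Sum>i = 0..<c. u i * cnj (u i)) = 0" .
    have "(\<Sum>i = 0..<c. (cmod (u i))\<^sup>2) = 0"
    proof -
      have "complex_of_real (\<Sum>i = 0..<c. (cmod (u i))\<^sup>2) = (\<Sum>i = 0..<c. u i * cnj (u i))"
        by (simp only: of_real_sum complex_norm_square)
      then show ?thesis using s0 by (metis of_real_eq_0_iff)
    qed
    then have "u i = 0" if "i < c" for i
      using that by (subst (asm) sum_nonneg_eq_0_iff) auto
    then have "V * M = 0\<^sub>m 1 c" using VM by (intro eq_matI) (auto simp: u_def)
    then have "V = 0\<^sub>m 1 r" by (rule null[OF V])
    then have "v $ k = 0" if "k < r" for k using that by (auto simp: V_def mat_eq_iff)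
    then have "v = 0\<^sub>v r" using v(1) by (intro eq_vecI) auto
    then show False using v by simp
  qed
  then obtain N where N: "N \<in> carrier_mat r r" "(M * H) * N = 1\<^sub>m r"
    using det_non_zero_imp_unit[OF MH, of "()"] by (auto simp: Units_def ring_mat_def)
  have "col_space M = carrier_vec r"
  proof
    show "col_space M \<subseteq> carrier_vec r" unfolding col_space_eq[OF M] using M by auto
    show "carrier_vec r \<subseteq> col_space M"
    proof
      fix y :: "complex vec" assume y: "y \<in> carrier_vec r"
      have Ny: "N *\<^sub>v y \<in> carrier_vec r" using N y by simp
      have "M *\<^sub>v (H *\<^sub>v (N *\<^sub>v y)) = (M * H) *\<^sub>v (N *\<^sub>v y)"
        by (rule assoc_mult_mat_vec[symmetric, OF M H Ny])
      also have "\<dots> = ((M * H) * N) *\<^sub>v y" by (rule assoc_mult_mat_vec[symmetric, OF MH N(1) y])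
      also have "\<dots> = y" unfolding N(2) using y by simp
      finally show "y \<in> col_space M" unfolding col_space_eq[OF M] using M H N y
        by (auto intro!: bexI[of _ "H *\<^sub>v (N *\<^sub>v y)"])
    qed
  qed
  then have "rank M = vectorspace.dim class_ring (vs (carrier_vec r))"
    unfolding rank_def col_space_def by simp
  also have "vs (carrier_vec r) = V" by simp
  finally show ?thesis using dim_is_n by simp
qed

lemma full_col_rank:
  fixes M :: "complex mat"
  assumes M: "M \<in> carrier_mat N r"
    and null: "\<And>v. v \<in> carrier_mat r 1 \<Longrightarrow> M * v = 0\<^sub>m N 1 \<Longrightarrow> v = 0\<^sub>m r 1"
  shows "vec_space.rank N M = r"
proof -
  interpret vec_space "TYPE(complex)" N .
  have null': "v = 0\<^sub>v r" if v: "v \<in> carrier_vec r" "M *\<^sub>v v = 0\<^sub>v N" for v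
  proof -
    define V where "V = mat r 1 (\<lambda>(i, j). v $ i)"
    have V: "V \<in> carrier_mat r 1" by (simp add: V_def)
    have cV: "col V 0 = v" using v by (intro eq_vecI) (auto simp: V_def)
    then have "M * V = 0\<^sub>m N 1" using v M V by (intro eq_matI) (auto simp: vec_eq_iff cV)
    then have "V = 0\<^sub>m r 1" by (rule null[OF V])
    then have "v $ k = 0" if "k < r" for k using that by (auto simp: V_def mat_eq_iff)
    then show ?thesis using v by (intro eq_vecI) auto
  qed
  have d: "distinct (cols M)"
    unfolding distinct_conv_nth
  proof (intro allI impI)
    fix i j assume "i < length (cols M)" "j < length (cols M)" "i \<noteq> j"
    then have ij: "i < r" "j < r" "i \<noteq> j" using M by auto
    show "cols M ! i \<noteq> cols M ! j"
    proof
      assume "cols M ! i = cols M ! j"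
      then have "col M i = col M j" using ij M by simp
      moreover have "M *\<^sub>v (unit_vec r i - unit_vec r j) = col M i - col M j"
      proof -
        have "M *\<^sub>v unit_vec r k = col M k" if "k < r" for k
          using M that by (intro eq_vecI) auto
        then show ?thesis
          using M ij by (subst mult_minus_distrib_mat_vec[of _ N r]) auto
      qed
      ultimately have "M *\<^sub>v (unit_vec r i - unit_vec r j) = 0\<^sub>v N" using M ij by auto
      then have "unit_vec r i - unit_vec r j = (0\<^sub>v r :: complex vec)" by (intro null') auto
      then have "(unit_vec r i - unit_vec r j) $ i = (0\<^sub>v r :: complex vec) $ i" by simp
      then show False using ij by simp
    qed
  qed
  have "lin_indpt (set (cols M))"
    using lin_depE[OF M _ d] null' by metis
  then show ?thesis by (rule lin_indpt_full_rank[OF M d])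
qed

text \<open>The columns of \<open>W\<close> form a basis of the kernel of \<open>v\<close>, and \<open>Y\<close> returns the coordinates of a kernel vector. Such a
  vector is determined by its entries outside a position \<open>q\<close> with \<open>v\<^sub>q \<noteq> 0\<close>.\<close>

lemma left_annihilator_basis:
  fixes v :: "'a::field mat"
  assumes v: "v \<in> carrier_mat 1 r" "v \<noteq> 0\<^sub>m 1 r"
  obtains W Y where "W \<in> carrier_mat r (r - 1)" "Y \<in> carrier_mat (r - 1) r" "v * W = 0\<^sub>m 1 (r - 1)"
    "\<And>M c. M \<in> carrier_mat r c \<Longrightarrow> v * M = 0\<^sub>m 1 c \<Longrightarrow> W * (Y * M) = M"
proof -
  obtain q where q: "q < r" "v $$ (0, q) \<noteq> 0"
    using v by (auto simp: mat_eq_iff)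
  define s where "s = r - 1"
  have r: "r = Suc s" using q by (simp add: s_def)
  let ?f = "insert_index q"
  let ?v = "\<lambda>k. v $$ (0, k)"
  have f: "?f k < r" "?f k \<noteq> q" if "k < s" for k using that r by (auto simp: insert_index_def)
  have img: "?f ` {0..<s} = {0..<r} - {q}" using insert_index_image[of q s] q r by simp
  have inj: "inj_on ?f {0..<s}" by (auto simp: inj_on_def insert_index_def split: if_splits)
  have sum_f: "(\<Sum>k = 0..<s. g (?f k)) = (\<Sum>i \<in> {0..<r} - {q}. g i)" for g :: "nat \<Rightarrow> 'a"
    using sum.reindex[OF inj, of g] by (simp add: img)
  define Y where "Y = mat s r (\<lambda>(i, j). if j = ?f i then 1 else 0 :: 'a)"
  define W where "W = mat r s (\<lambda>(i, j). if i = ?f j then 1 else if i = q then - ?v (?f j) / ?v q else 0 :: 'a)"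
  have c: "W \<in> carrier_mat r s" "Y \<in> carrier_mat s r" by (auto simp: W_def Y_def)
  have "v * W = 0\<^sub>m 1 s"
  proof (rule eq_matI)
    fix i j assume "i < dim_row (0\<^sub>m 1 s :: 'a mat)" "j < dim_col (0\<^sub>m 1 s :: 'a mat)"
    then have ij: "i = 0" "j < s" by auto
    have "(v * W) $$ (i, j) = (\<Sum>k = 0..<r. ?v k * W $$ (k, j))"
      using ij v c by (simp add: scalar_prod_def)
    also have "\<dots> = (\<Sum>k = 0..<r. (if k = ?f j then ?v k else 0) + (if k = q then - ?v (?f j) else 0))"
      by (rule sum.cong) (use ij q f in \<open>auto simp: W_def\<close>)
    also have "\<dots> = 0" using ij q f by (simp add: sum.distrib)
    finally show "(v * W) $$ (i, j) = 0\<^sub>m 1 s $$ (i, j)" using ij by simp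
  qed (use v c in auto)
  moreover have "W * (Y * M) = M" if M: "M \<in> carrier_mat r c" "v * M = 0\<^sub>m 1 c" for M c
  proof (rule eq_matI)
    fix i j assume "i < dim_row M" "j < dim_col M"
    then have ij: "i < r" "j < c" using M by auto
    have YM: "(Y * M) $$ (k, j) = M $$ (?f k, j)" if "k < s" for k
    proof -
      have "(Y * M) $$ (k, j) = (\<Sum>l = 0..<r. Y $$ (k, l) * M $$ (l, j))"
        using that ij M c by (simp add: scalar_prod_def)
      also have "\<dots> = (\<Sum>l = 0..<r. if l = ?f k then M $$ (l, j) else 0)"
        by (rule sum.cong) (use that in \<open>auto simp: Y_def\<close>)
      finally show ?thesis using f[OF that] by simp
    qed
    have vM: "(\<Sum>k = 0..<r. ?v k * M $$ (k, j)) = 0"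
    proof -
      have "(v * M) $$ (0, j) = (\<Sum>k = 0..<r. ?v k * M $$ (k, j))" using ij M(1) v(1) by (simp add: scalar_prod_def)
      then show ?thesis unfolding M(2) using ij by simp
    qed
    have "(W * (Y * M)) $$ (i, j) = (\<Sum>k = 0..<s. W $$ (i, k) * M $$ (?f k, j))"
      using ij M c YM by (simp add: scalar_prod_def)
    also have "\<dots> = M $$ (i, j)"
    proof (cases "i = q")
      case False
      have "(\<Sum>k = 0..<s. W $$ (i, k) * M $$ (?f k, j)) = (\<Sum>k = 0..<s. if ?f k = i then M $$ (?f k, j) else 0)"
        by (rule sum.cong) (use False ij in \<open>auto simp: W_def\<close>)
      also have "\<dots> = (\<Sum>k \<in> {0..<r} - {q}. if k = i then M $$ (k, j) else 0)" by (rule sum_f)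
      finally show ?thesis using False ij by simp
    next
      case True
      have "(\<Sum>k = 0..<s. W $$ (i, k) * M $$ (?f k, j)) = (\<Sum>k = 0..<s. - (?v (?f k) * M $$ (?f k, j)) / ?v q)"
        by (rule sum.cong) (use True ij f f(2)[symmetric] in \<open>auto simp: W_def\<close>)
      also have "\<dots> = (\<Sum>k \<in> {0..<r} - {q}. - (?v k * M $$ (k, j)) / ?v q)" by (rule sum_f)
      also have "\<dots> = - (\<Sum>k \<in> {0..<r} - {q}. ?v k * M $$ (k, j)) / ?v q"
        by (simp add: sum_negf sum_divide_distrib[symmetric])
      also have "(\<Sum>k \<in> {0..<r} - {q}. ?v k * M $$ (k, j)) = - (?v q * M $$ (q, j))"
        using vM q sum.remove[of "{0..<r}" q "\<lambda>k. ?v k * M $$ (k, j)"] by (simp add: eq_neg_iff_add_eq_0 add.commute)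
      finally show ?thesis using True q by simp
    qed
    finally show "(W * (Y * M)) $$ (i, j) = M $$ (i, j)" .
  qed (use M c in auto)
  ultimately show ?thesis using that[of W Y] c unfolding s_def by blast
qed

lemma transfer_function_eq:
  assumes A: "A \<in> carrier_mat r r"
    and R: "(rvar \<cdot>\<^sub>m 1\<^sub>m r - const_rat_mat A) * R = 1\<^sub>m r" "R \<in> carrier_mat r r"
  shows "transfer_function P C (1\<^sub>m r) A B = rat_mat P + const_rat_mat C * R * const_rat_mat B"
proof -
  define L where "L = rvar \<cdot>\<^sub>m 1\<^sub>m r - const_rat_mat A"
  have cA: "const_rat_mat A \<in> carrier_mat r r" using A by (simp add: const_rat_mat_eq)
  have cL: "L \<in> carrier_mat r r" unfolding L_def by (rule minus_carrier_mat[OF cA])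
  obtain R' where R': "R' \<in> proper.mats r r" "L * R' = 1\<^sub>m r" "R' * L = 1\<^sub>m r"
    "the (mat_inverse (rvar \<cdot>\<^sub>m const_rat_mat (1\<^sub>m r) - const_rat_mat A)) = R'"
    using resolvent_exists[OF A] unfolding L_def by metis
  have cR': "R' \<in> carrier_mat r r" using R' by auto
  have "R' = R' * (L * R)" using R cR' unfolding L_def by simp
  also have "\<dots> = R' * L * R" by (rule assoc_mult_mat[symmetric]) (use R(2) cL cR' in auto)
  also have "\<dots> = R" using R'(3) R(2) by simp
  finally show ?thesis unfolding transfer_function_def R'(4) by simp
qed

text \<open>The kernel of \<open>v\<close> is invariant under \<open>A\<close> and contains the columns of \<open>B\<close>. Restricting the state space to it does
  not change the transfer function.\<close>

lemma uncontrollable_reduction: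
  assumes real: "realization n r G P A B C"
    and v: "v \<in> carrier_mat 1 r" "v \<noteq> 0\<^sub>m 1 r"
    and vA: "v * A = x \<cdot>\<^sub>m v" and vB: "v * B = 0\<^sub>m 1 n"
  obtains A' B' C' where "realization n (r - 1) G P A' B' C'"
proof -
  have c: "P \<in> carrier_mat n n" "A \<in> carrier_mat r r" "B \<in> carrier_mat r n" "C \<in> carrier_mat n r"
    and G: "G = transfer_function P C (1\<^sub>m r) A B"
    using real by (auto simp: realization_def)
  let ?s = "r - 1"
  obtain W Y where W: "W \<in> carrier_mat r ?s" "v * W = 0\<^sub>m 1 ?s" and Y: "Y \<in> carrier_mat ?s r"
    and WY: "\<And>M c. M \<in> carrier_mat r c \<Longrightarrow> v * M = 0\<^sub>m 1 c \<Longrightarrow> W * (Y * M) = M"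
    using left_annihilator_basis[OF v] by metis
  define A' B' C' where defs: "A' = Y * (A * W)" "B' = Y * B" "C' = C * W"
  have c': "A' \<in> carrier_mat ?s ?s" "B' \<in> carrier_mat ?s n" "C' \<in> carrier_mat n ?s"
    using c W Y by (auto simp: defs)
  have WB: "W * B' = B" unfolding defs using WY[OF c(3) vB] .
  have "v * (A * W) = v * A * W" using c v W by simp
  also have "\<dots> = x \<cdot>\<^sub>m (v * W)" unfolding vA using v W by (intro mult_smult_assoc_mat)
  also have "\<dots> = 0\<^sub>m 1 ?s" using W by simp
  finally have WA: "W * A' = A * W" unfolding defs using c W by (intro WY) auto
  let ?c = "const_rat_mat"
  have cm: "?c (M * N) = ?c M * ?c N" if "M \<in> carrier_mat a b" "N \<in> carrier_mat b d" for M N a b d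
    unfolding const_rat_mat_eq by (rule const_fract_hom.mat_hom_mult[OF that])
  have cc: "?c M \<in> carrier_mat a b" if "M \<in> carrier_mat a b" for M a b using that by (simp add: const_rat_mat_eq)
  define L where "L = rvar \<cdot>\<^sub>m 1\<^sub>m r - ?c A"
  define L' where "L' = rvar \<cdot>\<^sub>m 1\<^sub>m ?s - ?c A'"
  have cL: "L \<in> carrier_mat r r" "L' \<in> carrier_mat ?s ?s"
    unfolding L_def L'_def by (rule minus_carrier_mat[OF cc]; use c c' in auto)+
  obtain R where R: "R \<in> proper.mats r r" "L * R = 1\<^sub>m r" "R * L = 1\<^sub>m r"
    using resolvent_exists[OF c(2)] unfolding L_def by metis
  obtain R' where R': "R' \<in> proper.mats ?s ?s" "L' * R' = 1\<^sub>m ?s" "R' * L' = 1\<^sub>m ?s"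
    using resolvent_exists[OF c'(1)] unfolding L'_def by metis
  have cR: "R \<in> carrier_mat r r" "R' \<in> carrier_mat ?s ?s" using R R' by auto
  define w where "w = ?c W"
  have cw: "w \<in> carrier_mat r ?s" unfolding w_def using cc W by blast
  have LW: "L * w = w * L'"
  proof -
    have "L * w = rvar \<cdot>\<^sub>m 1\<^sub>m r * w - ?c A * w"
      unfolding L_def by (rule minus_mult_distrib_mat) (use cw cc c in auto)
    also have "rvar \<cdot>\<^sub>m 1\<^sub>m r * w = rvar \<cdot>\<^sub>m (1\<^sub>m r * w)" by (rule mult_smult_assoc_mat[OF one_carrier_mat cw])
    also have "1\<^sub>m r * w = w" using cw by simp
    also have "?c A * w = ?c (A * W)" unfolding w_def using cm[OF c(2) W(1)] by simp
    also have "\<dots> = w * ?c A'" unfolding WA[symmetric] w_def using cm[OF W(1) c'(1)] by simp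
    also have "rvar \<cdot>\<^sub>m w = w * (rvar \<cdot>\<^sub>m 1\<^sub>m ?s)" using mult_smult_distrib[OF cw one_carrier_mat, of rvar] cw by simp
    also have "w * (rvar \<cdot>\<^sub>m 1\<^sub>m ?s) - w * ?c A' = w * L'"
      unfolding L'_def by (rule mult_minus_distrib_mat[symmetric, OF cw]) (use cc c' in auto)
    finally show ?thesis .
  qed
  \<comment> \<open>The inclusion of the kernel intertwines \<open>A'\<close> with \<open>A\<close>, hence also the resolvents.\<close>
  have "w * R' = R * L * (w * R')" using R cw cR by simp
  also have "\<dots> = R * (L * w) * R'" using cR cL cw by (simp add: assoc_mult_mat[of _ r r _ ?s _ ?s] assoc_mult_mat[of _ r r _ r _ ?s])
  also have "\<dots> = R * w * (L' * R')" unfolding LW using cR cL cw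
    by (simp add: assoc_mult_mat[of _ r ?s _ ?s _ ?s] assoc_mult_mat[of _ r r _ ?s _ ?s])
  also have "\<dots> = R * w" using R' cR cw by simp
  finally have wR: "w * R' = R * w" .
  have "?c C * R * ?c B = ?c C * R * (w * ?c B')"
    unfolding w_def using cm[OF W(1) c'(2)] WB by simp
  also have "\<dots> = ?c C * (R * w) * ?c B'"
    using cc[OF c(4)] cR cw cc[OF c'(2)]
    by (simp add: assoc_mult_mat[of _ n r _ r _ n] assoc_mult_mat[of _ n r _ ?s _ n] assoc_mult_mat[of _ r r _ ?s _ n])
  also have "\<dots> = ?c C * w * R' * ?c B'"
    unfolding wR[symmetric] using cc[OF c(4)] cR cw cc[OF c'(2)]
    by (simp add: assoc_mult_mat[of _ n r _ ?s _ ?s] assoc_mult_mat[of _ n ?s _ ?s _ n] assoc_mult_mat[of _ r ?s _ ?s _ n] assoc_mult_mat[of _ n r _ ?s _ n])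
  also have "?c C * w = ?c C'" unfolding w_def defs using cm[OF c(4) W(1)] by simp
  finally have eq: "?c C * R * ?c B = ?c C' * R' * ?c B'" .
  have "G = transfer_function P C' (1\<^sub>m ?s) A' B'"
    unfolding G transfer_function_eq[OF c(2) R(2)[unfolded L_def] cR(1)]
      transfer_function_eq[OF c'(1) R'(2)[unfolded L'_def] cR(2)] eq ..
  then have "realization n ?s G P A' B' C'" using c c' by (simp add: realization_def)
  then show ?thesis by (rule that)
qed

lemma minimal_controllable:
  assumes min: "minimal_realization n r G P A B C"
    and v: "v \<in> carrier_mat 1 r" and vA: "v * A = x \<cdot>\<^sub>m v" and vB: "v * B = 0\<^sub>m 1 n"
  shows "v = 0\<^sub>m 1 r"
proof (rule ccontr)
  assume v0: "v \<noteq> 0\<^sub>m 1 r"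
  have real: "realization n r G P A B C" using min by (simp add: minimal_realization_def)
  obtain A' B' C' where "realization n (r - 1) G P A' B' C'"
    using uncontrollable_reduction[OF real v v0 vA vB] .
  then have "r \<le> r - 1" using min unfolding minimal_realization_def by blast
  then have "r = 0" by simp
  then have "v = 0\<^sub>m 1 r" using v by (intro eq_matI) auto
  then show False using v0 by simp
qed

lemma J_mat_carrier [simp]: "J_mat l \<in> carrier_mat (2 * l) (2 * l)"
  using four_block_carrier_mat[of "0\<^sub>m l l" l l "0\<^sub>m l l" l l "1\<^sub>m l" "- 1\<^sub>m l"] by (simp add: J_mat_def mult_2)

lemma J_mat_transpose: "transpose_mat (J_mat l) = - (J_mat l :: 'a::ring_1 mat)"
  unfolding J_mat_def by (rule eq_matI) auto

lemma J_mat_square: "J_mat l * J_mat l = - (1\<^sub>m (2 * l) :: 'a::comm_ring_1 mat)"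
proof -
  have "J_mat l * J_mat l = four_block_mat (- 1\<^sub>m l) (0\<^sub>m l l) (0\<^sub>m l l) (- 1\<^sub>m l :: 'a mat)"
    unfolding J_mat_def by (subst mult_four_block_mat[of _ l l _ l _ l _ _ l _ l]) auto
  also have "\<dots> = - 1\<^sub>m (2 * l)" by (rule eq_matI) auto
  finally show ?thesis .
qed

text \<open>If \<open>v\<close> is a right eigenvector for \<open>x\<close>, then \<open>v\<^sup>T J\<close> is a left eigenvector for \<open>-x\<close>, since \<open>J A\<close> is symmetric and \<open>J\<close>
  is skew-symmetric; and \<open>v\<^sup>T J B = (C v)\<^sup>T\<close>. So controllability excludes \<open>C v = 0\<close>.\<close>

lemma hamiltonian_minimal_observable:
  assumes min: "minimal_realization n (2 * l) G P A B C"
    and ham: "hamiltonian_realization n l G P A B C"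
    and v: "v \<in> carrier_mat (2 * l) 1" and Av: "A * v = x \<cdot>\<^sub>m v" and Cv: "C * v = 0\<^sub>m n 1"
  shows "v = 0\<^sub>m (2 * l) 1"
proof -
  let ?r = "2 * l"
  let ?t = "transpose_mat :: complex mat \<Rightarrow> complex mat"
  define J where "J = (J_mat l :: complex mat)"
  have c: "A \<in> carrier_mat ?r ?r" "B \<in> carrier_mat ?r n" "C \<in> carrier_mat n ?r"
    and JA: "?t (J * A) = J * A" and JB: "J * B = ?t C"
    using ham by (auto simp: hamiltonian_realization_def realization_def hamiltonian_mat_def J_def)
  have J: "J \<in> carrier_mat ?r ?r" "?t J = - J" "J * J = - 1\<^sub>m ?r"
    by (simp_all add: J_def J_mat_transpose J_mat_square)
  have tv: "?t v \<in> carrier_mat 1 ?r" using v by simp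
  define u where "u = ?t v * J"
  have u: "u \<in> carrier_mat 1 ?r" using tv J by (simp add: u_def)
  have "u * A = ?t v * (J * A)" unfolding u_def using tv J c by simp
  also have "\<dots> = ?t v * (?t A * ?t J)" using JA transpose_mult[OF J(1) c(1)] by simp
  also have "\<dots> = (?t v * ?t A) * ?t J" using tv J c by simp
  also have "?t v * ?t A = ?t (A * v)" using transpose_mult[OF c(1) v] by simp
  also have "\<dots> = x \<cdot>\<^sub>m ?t v" unfolding Av by (rule eq_matI) auto
  also have "(x \<cdot>\<^sub>m ?t v) * ?t J = (- x) \<cdot>\<^sub>m u"
    unfolding u_def J(2) mult_smult_assoc_mat[OF tv uminus_carrier_mat[OF J(1)]]
    using tv J by (intro eq_matI) auto
  finally have uA: "u * A = (- x) \<cdot>\<^sub>m u" .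
  have "u * B = ?t v * (J * B)" unfolding u_def using tv J c by simp
  also have "\<dots> = ?t (C * v)" unfolding JB using transpose_mult[OF c(3) v] by simp
  also have "\<dots> = 0\<^sub>m 1 n" unfolding Cv by simp
  finally have uB: "u * B = 0\<^sub>m 1 n" .
  have "u = 0\<^sub>m 1 ?r" by (rule minimal_controllable[OF min u uA uB])
  then have "?t v * (J * J) = 0\<^sub>m 1 ?r" using tv J unfolding u_def by (metis assoc_mult_mat left_mult_zero_mat)
  then have "- ?t v = 0\<^sub>m 1 ?r" unfolding J(3) using tv by simp
  then have "?t v = 0\<^sub>m 1 ?r" by (metis uminus_uminus_mat uminus_zero_mat)
  then show ?thesis by (metis transpose_transpose zero_transpose_mat)
qed

section \<open>The system matrix and its transfer function\<close>

lemma block_col_entry: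
  assumes "X \<in> carrier_mat n r" "1 \<le> j" "j \<le> m" "q < n" "c < r"
  shows "block_col m j X $$ ((j - 1) * n + q, c) = X $$ (q, c)"
proof -
  have "(j - 1) * n + q < (j - 1) * n + n" using assms by simp
  also have "\<dots> = j * n" using assms by (cases j) auto
  also have "\<dots> \<le> m * n" using assms by simp
  finally show ?thesis using assms by (subst block_col_index[of _ n r]) auto
qed

lemma block_col_eq_zero:
  assumes "X \<in> carrier_mat n r" "1 \<le> j" "j \<le> m" "block_col m j X = 0\<^sub>m (m * n) r"
  shows "X = 0\<^sub>m n r"
proof (rule eq_matI)
  fix q c assume "q < dim_row (0\<^sub>m n r :: 'a mat)" "c < dim_col (0\<^sub>m n r :: 'a mat)"
  then have qc: "q < n" "c < r" by auto
  have "(j - 1) * n + q < (j - 1) * n + n" using qc by simp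
  also have "\<dots> = j * n" using assms by (cases j) auto
  also have "\<dots> \<le> m * n" using assms by simp
  finally have "block_col m j X $$ ((j - 1) * n + q, c) = 0" using assms(4) qc by simp
  then show "X $$ (q, c) = 0\<^sub>m n r $$ (q, c)" using block_col_entry[OF assms(1-3) qc] qc by simp
qed (use assms in auto)

lemma block_row_eq_zero:
  assumes "X \<in> carrier_mat r n" "1 \<le> j" "j \<le> m" "block_row m j X = 0\<^sub>m r (m * n)"
  shows "X = 0\<^sub>m r n"
proof -
  have "transpose_mat (block_row m j X) = block_col m j (transpose_mat X)"
    using assms(1) by (simp add: block_row_transpose)
  then have "block_col m j (transpose_mat X) = 0\<^sub>m (m * n) r" using assms(4) by simp
  then have "transpose_mat X = 0\<^sub>m n r" using assms by (intro block_col_eq_zero[of _ n r j m]) auto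
  then show ?thesis by (metis transpose_transpose zero_transpose_mat)
qed

lemma left_null_of_block_row:
  fixes v :: "'a::comm_ring_1 mat"
  assumes v: "v \<in> carrier_mat 1 r" and B: "B \<in> carrier_mat r c" and D: "D \<in> carrier_mat r d"
    and null: "v * four_block_mat B D (0\<^sub>m 0 c) (0\<^sub>m 0 d) = 0\<^sub>m 1 (c + d)"
  shows "v * B = 0\<^sub>m 1 c" "v * D = 0\<^sub>m 1 d"
proof -
  have vB: "v * B \<in> carrier_mat 1 c" "v * D \<in> carrier_mat 1 d" using v B D by auto
  have "v = four_block_mat v (0\<^sub>m 1 0) (0\<^sub>m 0 r) (0\<^sub>m 0 0)" using v by (intro eq_matI) auto
  then have "v * four_block_mat B D (0\<^sub>m 0 c) (0\<^sub>m 0 d)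
      = four_block_mat v (0\<^sub>m 1 0) (0\<^sub>m 0 r) (0\<^sub>m 0 0) * four_block_mat B D (0\<^sub>m 0 c) (0\<^sub>m 0 d)"
    by simp
  also have "\<dots> = four_block_mat (v * B + 0\<^sub>m 1 0 * 0\<^sub>m 0 c) (v * D + 0\<^sub>m 1 0 * 0\<^sub>m 0 d)
      (0\<^sub>m 0 r * B + 0\<^sub>m 0 0 * 0\<^sub>m 0 c) (0\<^sub>m 0 r * D + 0\<^sub>m 0 0 * 0\<^sub>m 0 d)"
    by (rule mult_four_block_mat) (use v B D in auto)
  finally have e: "four_block_mat (v * B + 0\<^sub>m 1 0 * 0\<^sub>m 0 c) (v * D + 0\<^sub>m 1 0 * 0\<^sub>m 0 d)
      (0\<^sub>m 0 r * B + 0\<^sub>m 0 0 * 0\<^sub>m 0 c) (0\<^sub>m 0 r * D + 0\<^sub>m 0 0 * 0\<^sub>m 0 d) = 0\<^sub>m 1 (c + d)" (is "?M = _")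
    unfolding null by simp
  show "v * B = 0\<^sub>m 1 c"
  proof (rule eq_matI)
    fix i j assume "i < dim_row (0\<^sub>m 1 c :: 'a mat)" "j < dim_col (0\<^sub>m 1 c :: 'a mat)"
    then show "(v * B) $$ (i, j) = 0\<^sub>m 1 c $$ (i, j)"
      using arg_cong[OF e, of "\<lambda>M. M $$ (i, j)"] vB v B D by (simp del: index_mult_mat(1))
  qed (use vB in auto)
  show "v * D = 0\<^sub>m 1 d"
  proof (rule eq_matI)
    fix i j assume "i < dim_row (0\<^sub>m 1 d :: 'a mat)" "j < dim_col (0\<^sub>m 1 d :: 'a mat)"
    then show "(v * D) $$ (i, j) = 0\<^sub>m 1 d $$ (i, j)"
      using arg_cong[OF e, of "\<lambda>M. M $$ (i, c + j)"] vB v B D by (simp del: index_mult_mat(1))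
  qed (use vB in auto)
qed

lemma right_null_of_block_col:
  fixes v :: "'a::comm_ring_1 mat"
  assumes v: "v \<in> carrier_mat r 1" and C: "C \<in> carrier_mat c r" and D: "D \<in> carrier_mat d r"
    and null: "(C @\<^sub>r D) * v = 0\<^sub>m (c + d) 1"
  shows "C * v = 0\<^sub>m c 1" "D * v = 0\<^sub>m d 1"
proof -
  let ?t = "transpose_mat :: 'a mat \<Rightarrow> 'a mat"
  have CD: "C @\<^sub>r D \<in> carrier_mat (c + d) r" using C D by auto
  have "?t (C @\<^sub>r D) = four_block_mat (?t C) (?t D) (0\<^sub>m 0 c) (0\<^sub>m 0 d)"
    using C D by (intro eq_matI) (auto simp: append_rows_def)
  then have "?t v * four_block_mat (?t C) (?t D) (0\<^sub>m 0 c) (0\<^sub>m 0 d) = 0\<^sub>m 1 (c + d)"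
    using transpose_mult[OF CD v] null by simp
  note * = left_null_of_block_row[OF _ _ _ this, of r]
  have "?t (C * v) = 0\<^sub>m 1 c" "?t (D * v) = 0\<^sub>m 1 d"
    using * v C D transpose_mult[OF C v] transpose_mult[OF D v] by auto
  then show "C * v = 0\<^sub>m c 1" "D * v = 0\<^sub>m d 1" by (metis transpose_transpose zero_transpose_mat)+
qed

text \<open>A rank defect at \<open>x\<close> yields a left or right eigenvector of \<open>A\<close> for \<open>x\<close> that annihilates the border block, hence
  \<open>B\<close> or \<open>C\<close>.\<close>

lemma irreducible_block_system:
  assumes min: "minimal_realization n (2 * l) G P A B C"
    and ham: "hamiltonian_realization n l G P A B C"
    and j: "1 \<le> j" "j \<le> m"
  shows "irreducible_system (m * n) (2 * l) (block_col m j C) (block_row m j B) A (1\<^sub>m (2 * l))"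
  unfolding irreducible_system_def
proof (intro allI conjI)
  fix x :: complex
  let ?r = "2 * l"
  define D where "D = A - x \<cdot>\<^sub>m 1\<^sub>m ?r"
  define CC BB where "CC = block_col m j C" and "BB = block_row m j B"
  have c: "A \<in> carrier_mat ?r ?r" "B \<in> carrier_mat ?r n" "C \<in> carrier_mat n ?r"
    using ham by (auto simp: hamiltonian_realization_def realization_def)
  have D: "D \<in> carrier_mat ?r ?r" unfolding D_def by (rule minus_carrier_mat) simp
  have cc: "CC \<in> carrier_mat (m * n) ?r" "BB \<in> carrier_mat ?r (m * n)"
    unfolding CC_def BB_def using c by (auto intro: block_col_carrier block_row_carrier)
  have AD: "A = D + x \<cdot>\<^sub>m 1\<^sub>m ?r" unfolding D_def using c by (intro eq_matI) auto
  have M: "four_block_mat BB D (0\<^sub>m 0 (m * n)) (0\<^sub>m 0 ?r) \<in> carrier_mat ?r (m * n + ?r)" (is "?M \<in> _")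
    using cc by auto
  have "vec_space.rank ?r ?M = ?r"
  proof (rule full_row_rank[OF M])
    fix v assume v: "v \<in> carrier_mat 1 ?r" and vM: "v * ?M = 0\<^sub>m 1 (m * n + ?r)"
    note null = left_null_of_block_row[OF v cc(2) D vM]
    have "block_row m j (v * B) = 0\<^sub>m 1 (m * n)"
      using null(1) unfolding BB_def block_row_mult[OF c(2) v] .
    then have vB: "v * B = 0\<^sub>m 1 n" using v c j by (intro block_row_eq_zero[of _ 1 n j m]) auto
    have "v * A = v * D + v * (x \<cdot>\<^sub>m 1\<^sub>m ?r)"
      unfolding AD by (rule mult_add_distrib_mat[OF v D]) simp
    also have "\<dots> = x \<cdot>\<^sub>m v"
      unfolding null(2) using v mult_smult_distrib[OF v one_carrier_mat, of x] by simp
    finally show "v = 0\<^sub>m 1 ?r" using minimal_controllable[OF min v _ vB] by blast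
  qed
  then show "vec_space.rank (2 * l)
      (four_block_mat (block_row m j B) (A - x \<cdot>\<^sub>m 1\<^sub>m (2 * l)) (0\<^sub>m 0 (dim_col (block_row m j B))) (0\<^sub>m 0 (dim_col A))) = 2 * l"
    unfolding D_def BB_def using cc c unfolding BB_def by simp
  have K: "CC @\<^sub>r D \<in> carrier_mat (m * n + ?r) ?r" (is "?K \<in> _") using cc D by auto
  have "vec_space.rank (m * n + ?r) ?K = ?r"
  proof (rule full_col_rank[OF K])
    fix v assume v: "v \<in> carrier_mat ?r 1" and Kv: "?K * v = 0\<^sub>m (m * n + ?r) 1"
    note null = right_null_of_block_col[OF v cc(1) D Kv]
    have "block_col m j (C * v) = 0\<^sub>m (m * n) 1"
      using null(1) unfolding CC_def block_col_mult[OF c(3) v] .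
    then have Cv: "C * v = 0\<^sub>m n 1" using v c j by (intro block_col_eq_zero[of _ n 1 j m]) auto
    have "A * v = D * v + (x \<cdot>\<^sub>m 1\<^sub>m ?r) * v"
      unfolding AD by (rule add_mult_distrib_mat[OF D _ v]) simp
    also have "\<dots> = x \<cdot>\<^sub>m v"
      unfolding null(2) using v mult_smult_assoc_mat[OF one_carrier_mat v, of x] by simp
    finally show "v = 0\<^sub>m ?r 1" using hamiltonian_minimal_observable[OF min ham v _ Cv] by blast
  qed
  then show "vec_space.rank (m * n + 2 * l) (block_col m j C @\<^sub>r (A - x \<cdot>\<^sub>m 1\<^sub>m (2 * l))) = 2 * l"
    unfolding D_def CC_def .
qed

lemma const_mat_carrier: "M \<in> carrier_mat a b \<Longrightarrow> const_mat M \<in> carrier_mat a b"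
  by (simp add: const_mat_def)

lemma const_mat_mult:
  "M \<in> carrier_mat a b \<Longrightarrow> N \<in> carrier_mat b c \<Longrightarrow> const_mat (M * N) = const_mat M * const_mat N"
  unfolding const_mat_def by (rule const_hom.mat_hom_mult)

lemma const_mat_one: "const_mat (1\<^sub>m k) = 1\<^sub>m k"
  unfolding const_mat_def by (rule const_hom.mat_hom_one)

lemma const_mat_transpose: "transpose_mat (const_mat M) = const_mat (transpose_mat M)"
  by (simp add: const_mat_def map_mat_transpose)

lemma const_mat_J: "const_mat (J_mat l) = J_mat l"
  unfolding const_mat_def J_mat_def
  by (rule eq_matI) (auto simp: minus_one_poly_const)

lemma pencil_one: "pencil A (1\<^sub>m r) = const_mat A - pvar \<cdot>\<^sub>m 1\<^sub>m r"
  by (simp add: pencil_def const_mat_one)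

lemma poly_reflect_linear: "poly_reflect (pCons a (- 1)) = pCons a 1"
  by (simp add: poly_reflect_def pcompose_pCons pcompose_uminus pcompose_1)

text \<open>In the lower right block \<open>J A\<close> is symmetric, while the transpose of \<open>\<lambda>J\<close> is \<open>-\<lambda>J\<close>; the latter sign is
  compensated by the substitution of \<open>-\<lambda>\<close>.\<close>

lemma hamiltonian_system_matrixI:
  assumes X: "X \<in> carrier_mat N N" "even_poly_mat X"
    and A: "hamiltonian_mat l A"
    and c: "CC \<in> carrier_mat N (2 * l)" "BB \<in> carrier_mat (2 * l) N"
    and JB: "J_mat l * BB = transpose_mat CC"
  shows "hamiltonian_system_matrix N l (system_matrix X CC BB A (1\<^sub>m (2 * l)))"
proof -
  let ?r = "2 * l"
  define J where "J = (J_mat l :: complex mat)"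
  have Jc: "J \<in> carrier_mat ?r ?r" by (simp add: J_def)
  have Ac: "A \<in> carrier_mat ?r ?r" and JA: "transpose_mat (J * A) = J * A"
    using A by (auto simp: hamiltonian_mat_def J_def)
  define cJ cA cC cB where defs: "cJ = const_mat J" "cA = const_mat A" "cC = const_mat CC" "cB = const_mat BB"
  have cc: "cJ \<in> carrier_mat ?r ?r" "cA \<in> carrier_mat ?r ?r" "cC \<in> carrier_mat N ?r" "cB \<in> carrier_mat ?r N"
    unfolding defs using Jc Ac c by (auto intro: const_mat_carrier)
  define xI where "xI = pvar \<cdot>\<^sub>m (1\<^sub>m ?r)"
  have xI: "xI \<in> carrier_mat ?r ?r" by (simp add: xI_def)
  have T: "system_matrix X CC BB A (1\<^sub>m ?r) = four_block_mat X cC cB (cA - xI)"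
    by (simp add: system_matrix_def pencil_one defs xI_def)
  have Tc: "system_matrix X CC BB A (1\<^sub>m ?r) \<in> carrier_mat (N + ?r) (N + ?r)"
    unfolding T by (rule four_block_carrier_mat[OF X(1)]) (rule minus_carrier_mat[OF xI])
  define X' where "X' = map_mat poly_reflect X"
  have X': "X' \<in> carrier_mat N N" "transpose_mat X' = X"
    using X by (auto simp: X'_def even_poly_mat_def)
  have refl_const: "map_mat poly_reflect (const_mat M) = const_mat M" for M
    by (rule eq_matI) (auto simp: const_mat_def)
  have refl_pen: "map_mat poly_reflect (cA - xI) = cA + xI"
  proof (rule eq_matI)
    fix i j assume "i < dim_row (cA + xI)" "j < dim_col (cA + xI)"
    then have ij: "i < ?r" "j < ?r" using xI by auto
    then show "map_mat poly_reflect (cA - xI) $$ (i, j) = (cA + xI) $$ (i, j)"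
      using cc Ac xI by (auto simp: defs const_mat_def xI_def poly_reflect_linear)
  qed (use cc xI in auto)
  have TR: "map_mat poly_reflect (four_block_mat X cC cB (cA - xI)) = four_block_mat X' cC cB (cA + xI)"
  proof -
    have "map_mat poly_reflect cC = cC" "map_mat poly_reflect cB = cB" by (simp_all only: defs refl_const)
    then show ?thesis
      using map_four_block_mat[OF X(1) cc(3) cc(4) minus_carrier_mat[OF xI], of poly_reflect cA]
      by (simp only: refl_pen X'_def)
  qed
  have dia: "diag_block_mat [1\<^sub>m N, J_mat l] = four_block_mat (1\<^sub>m N) (0\<^sub>m N ?r) (0\<^sub>m ?r N) cJ"
    unfolding dsum_diag_block using Jc by (simp add: dsum_def defs J_def const_mat_J carrier_matD[OF J_mat_carrier])
  have mul: "four_block_mat (1\<^sub>m N) (0\<^sub>m N ?r) (0\<^sub>m ?r N) cJ * four_block_mat Y cC cB D = four_block_mat Y cC (cJ * cB) (cJ * D)"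
    if "Y \<in> carrier_mat N N" "D \<in> carrier_mat ?r ?r" for Y D
    using that cc by (subst mult_four_block_mat[of _ N N _ ?r _ ?r _ _ N _ ?r]) auto
  have JBc: "cJ * cB = transpose_mat cC"
    unfolding defs const_mat_transpose using const_mat_mult[OF Jc c(2)] JB by (simp add: J_def)
  have JAc: "transpose_mat (cJ * cA) = cJ * cA"
    unfolding defs const_mat_mult[OF Jc Ac, symmetric] const_mat_transpose JA ..
  have Jt: "transpose_mat cJ = - cJ"
    unfolding defs const_mat_transpose J_def J_mat_transpose
    by (rule eq_matI) (auto simp: const_mat_def)
  have "transpose_mat (cJ * (cA + xI)) = cJ * (cA - xI)"
  proof -
    have Jx: "cJ * xI = pvar \<cdot>\<^sub>m cJ"
      unfolding xI_def using mult_smult_distrib[OF cc(1) one_carrier_mat] cc by simp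
    have "cJ * (cA + xI) = cJ * cA + pvar \<cdot>\<^sub>m cJ"
      using mult_add_distrib_mat[OF cc(1,2) xI] by (simp add: Jx)
    then have "transpose_mat (cJ * (cA + xI)) = transpose_mat (cJ * cA) + transpose_mat (pvar \<cdot>\<^sub>m cJ)"
      using cc by (simp add: transpose_add[of _ ?r ?r])
    also have "\<dots> = cJ * cA + pvar \<cdot>\<^sub>m transpose_mat cJ"
      unfolding JAc by (intro arg_cong2[of _ _ _ _ "(+)"] eq_matI) auto
    also have "\<dots> = cJ * cA - pvar \<cdot>\<^sub>m cJ"
      unfolding Jt using mult_carrier_mat[OF cc(1,2)] cc by (intro eq_matI) auto
    also have "\<dots> = cJ * (cA - xI)"
      using mult_minus_distrib_mat[OF cc(1,2) xI] by (simp add: Jx)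
    finally show ?thesis .
  qed
  then have "transpose_mat (four_block_mat X' cC (cJ * cB) (cJ * (cA + xI))) = four_block_mat X cC (cJ * cB) (cJ * (cA - xI))"
    using transpose_four_block_mat[OF X'(1) cc(3) mult_carrier_mat[OF cc(1,4)] mult_carrier_mat[OF cc(1) add_carrier_mat[OF xI]], of cA]
      X' JBc by simp
  then show ?thesis
    unfolding hamiltonian_system_matrix_def using Tc
    unfolding T TR dia mul[OF X(1) minus_carrier_mat[OF xI]] mul[OF X'(1) add_carrier_mat[OF xI]] by simp
qed

text \<open>The matrix \<open>e\<^sub>j e\<^sub>j\<^sup>T \<otimes> X\<close>.\<close>

definition block_both :: "nat \<Rightarrow> nat \<Rightarrow> 'a::comm_ring_1 mat \<Rightarrow> 'a mat" where
  "block_both m j X = mat (m * dim_row X) (m * dim_row X) (\<lambda>(p, q).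
     if p div dim_row X = j - 1 \<and> q div dim_row X = j - 1 then X $$ (p mod dim_row X, q mod dim_row X) else 0)"

lemma block_col_row_mult:
  assumes "X \<in> carrier_mat n r" "Y \<in> carrier_mat r n"
  shows "block_col m j X * block_row m j Y = block_both m j (X * Y)"
proof (rule eq_matI)
  have c: "block_col m j X \<in> carrier_mat (m * n) r" "block_row m j Y \<in> carrier_mat r (m * n)"
    using assms by (auto intro: block_col_carrier block_row_carrier)
  have d: "dim_row (X * Y) = n" using assms by simp
  show "dim_row (block_col m j X * block_row m j Y) = dim_row (block_both m j (X * Y))"
    "dim_col (block_col m j X * block_row m j Y) = dim_col (block_both m j (X * Y))"
    using c d by (auto simp: block_both_def)
  fix p q assume "p < dim_row (block_both m j (X * Y))" "q < dim_col (block_both m j (X * Y))"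
  then have pq: "p < m * n" "q < m * n" using d by (auto simp: block_both_def)
  then have mods: "p mod n < n" "q mod n < n" by (cases n; simp)+
  have ct: "block_col m j (transpose_mat Y) \<in> carrier_mat (m * n) r"
    using assms by (intro block_col_carrier) auto
  have row: "block_row m j Y $$ (k, q) = (if q div n = j - 1 then Y $$ (k, q mod n) else 0)" if "k < r" for k
    using that pq assms ct mods by (simp add: block_row_transpose[of _ r n] block_col_index[of _ n r])
  have "(block_col m j X * block_row m j Y) $$ (p, q) = (\<Sum>k = 0..<r. block_col m j X $$ (p, k) * block_row m j Y $$ (k, q))"
    using pq c by (simp add: scalar_prod_def)
  also have "\<dots> = (\<Sum>k = 0..<r. if p div n = j - 1 \<and> q div n = j - 1 then X $$ (p mod n, k) * Y $$ (k, q mod n) else 0)"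
    by (rule sum.cong) (use pq assms in \<open>auto simp: row block_col_index[of _ n r]\<close>)
  also have "\<dots> = block_both m j (X * Y) $$ (p, q)"
    using pq mods assms
    by (auto simp: block_both_def scalar_prod_def intro!: sum.neutral)
  finally show "(block_col m j X * block_row m j Y) $$ (p, q) = block_both m j (X * Y) $$ (p, q)" .
qed

lemma block_both_last:
  assumes "X \<in> carrier_mat n n"
  shows "block_both (Suc m) (Suc m) X = dsum (0\<^sub>m (m * n) (m * n)) X"
proof (rule eq_matI)
  fix p q assume "p < dim_row (dsum (0\<^sub>m (m * n) (m * n)) X)" "q < dim_col (dsum (0\<^sub>m (m * n) (m * n)) X)"
  then have pq: "p < m * n + n" "q < m * n + n" using assms by auto
  have lt: "k div n = m \<longleftrightarrow> m * n \<le> k" "m * n \<le> k \<Longrightarrow> k mod n = k - m * n" if "k < m * n + n" for k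
  proof -
    have n: "n > 0" using that by (cases n) auto
    show "k div n = m \<longleftrightarrow> m * n \<le> k"
    proof
      assume "m * n \<le> k"
      then have "m \<le> k div n" using n by (simp add: less_eq_div_iff_mult_less_eq)
      moreover have "k div n < Suc m" using that by (intro less_mult_imp_div_less) simp
      ultimately show "k div n = m" by simp
    qed (metis div_times_less_eq_dividend)
    assume "m * n \<le> k"
    then obtain t where t: "k = m * n + t" by (metis le_iff_add)
    then have "t < n" using that by simp
    then show "k mod n = k - m * n" using t by simp
  qed
  show "block_both (Suc m) (Suc m) X $$ (p, q) = dsum (0\<^sub>m (m * n) (m * n)) X $$ (p, q)"
    using pq lt[OF pq(1)] lt[OF pq(2)] assms by (auto simp: block_both_def dsum_def)
qed (use assms in \<open>auto simp: block_both_def\<close>)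

lemma const_rat_mat_block_col: "X \<in> carrier_mat n r \<Longrightarrow> const_rat_mat (block_col m j X) = block_col m j (const_rat_mat X)"
  unfolding const_rat_mat_eq by (rule comm_ring_hom.map_block_col[OF const_fract_hom.comm_ring_hom_axioms])

lemma const_rat_mat_block_row: "X \<in> carrier_mat r n \<Longrightarrow> const_rat_mat (block_row m j X) = block_row m j (const_rat_mat X)"
  unfolding const_rat_mat_eq by (rule comm_ring_hom.map_block_row[OF const_fract_hom.comm_ring_hom_axioms])

lemma block_transfer:
  assumes c: "C \<in> carrier_mat n r" "B \<in> carrier_mat r n" and R: "R \<in> carrier_mat r r"
  shows "const_rat_mat (block_col m j C) * R * const_rat_mat (block_row m j B)
    = block_both m j (const_rat_mat C * R * const_rat_mat B)"
proof -
  have cc: "const_rat_mat C \<in> carrier_mat n r" "const_rat_mat B \<in> carrier_mat r n"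
    using c by (auto simp: const_rat_mat_eq)
  show ?thesis
    unfolding const_rat_mat_block_col[OF c(1)] const_rat_mat_block_row[OF c(2)] block_col_mult[OF cc(1) R]
    by (rule block_col_row_mult[OF mult_carrier_mat[OF cc(1) R] cc(2)])
qed

text \<open>Here \<open>\<Phi> = C (\<lambda>I - A)\<inverse> B\<close>. Moving \<open>B\<close> and \<open>C\<close> to the \<open>j\<close>-th block moves \<open>\<Phi>\<close> to the \<open>j\<close>-th diagonal
  block.\<close>

lemma transfer_function_split:
  assumes real: "realization n r G P A B C"
  obtains Phi where "Phi \<in> proper.mats n n" "G = rat_mat P + Phi"
    "\<And>X m j. transfer_function X (block_col m j C) (1\<^sub>m r) A (block_row m j B) = rat_mat X + block_both m j Phi"
proof -
  have c: "A \<in> carrier_mat r r" "B \<in> carrier_mat r n" "C \<in> carrier_mat n r"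
    and G: "G = transfer_function P C (1\<^sub>m r) A B"
    using real by (auto simp: realization_def)
  obtain R where R: "R \<in> proper.mats r r" "(rvar \<cdot>\<^sub>m 1\<^sub>m r - const_rat_mat A) * R = 1\<^sub>m r"
    using resolvent_exists[OF c(1)] by metis
  have cR: "R \<in> carrier_mat r r" using R by auto
  note tf = transfer_function_eq[OF c(1) R(2) cR]
  show ?thesis
  proof (rule that[of "const_rat_mat C * R * const_rat_mat B"])
    show "const_rat_mat C * R * const_rat_mat B \<in> proper.mats n n"
      using R const_rat_mat_proper[OF c(2)] const_rat_mat_proper[OF c(3)] by (blast intro: proper.mats_mult)
    show "G = rat_mat P + const_rat_mat C * R * const_rat_mat B" unfolding G by (rule tf)
    show "transfer_function X (block_col m j C) (1\<^sub>m r) A (block_row m j B)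
        = rat_mat X + block_both m j (const_rat_mat C * R * const_rat_mat B)" for X m j
      unfolding block_transfer[OF c(3,2) cR, symmetric] by (rule tf)
  qed
qed

lemma even_rat_mat_add_block:
  assumes X: "X \<in> carrier_mat (m * n) (m * n)" "even_poly_mat X"
    and P: "P \<in> carrier_mat n n" "even_poly_mat P"
    and F: "F \<in> carrier_mat n n" and G: "even_rat_mat (rat_mat P + F)"
  shows "even_rat_mat (rat_mat X + block_both m j F)"
proof -
  have ev: "poly_reflect (Y $$ (q, p)) = Y $$ (p, q)" if "Y \<in> carrier_mat k k" "even_poly_mat Y" "p < k" "q < k" for Y k p q
  proof -
    have "transpose_mat (map_mat poly_reflect Y) $$ (p, q) = Y $$ (p, q)" using that by (simp add: even_poly_mat_def)
    then show ?thesis using that by simp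
  qed
  have Fe: "rat_reflect (F $$ (q, p)) = F $$ (p, q)" if "p < n" "q < n" for p q
  proof -
    have "transpose_mat (map_mat rat_reflect (rat_mat P + F)) $$ (p, q) = (rat_mat P + F) $$ (p, q)"
      using G by (simp add: even_rat_mat_def)
    then have "rat_reflect (to_fract (P $$ (q, p)) + F $$ (q, p)) = to_fract (P $$ (p, q)) + F $$ (p, q)"
      using that P F by (simp add: rat_mat_def)
    then show ?thesis using ev[OF P that] by (simp add: rat_reflect_add rat_reflect_to_fract)
  qed
  have Fd: "dim_row F = n" using F by simp
  show ?thesis
    unfolding even_rat_mat_def
  proof (rule eq_matI)
    fix p q assume "p < dim_row (rat_mat X + block_both m j F)" "q < dim_col (rat_mat X + block_both m j F)"
    then have pq: "p < m * n" "q < m * n" by (auto simp: block_both_def Fd)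
    then have "p mod n < n" "q mod n < n" by (cases n; simp)+
    then show "transpose_mat (map_mat rat_reflect (rat_mat X + block_both m j F)) $$ (p, q) = (rat_mat X + block_both m j F) $$ (p, q)"
      using pq X ev[OF X pq] by (auto simp: block_both_def Fd rat_mat_def rat_reflect_add rat_reflect_to_fract Fe)
  qed (use X in \<open>auto simp: block_both_def rat_mat_def Fd\<close>)
qed

section \<open>Reduction to a Fiedler pencil\<close>

lemma matrix_polynomial_mpoly_at:
  assumes "\<And>i. i \<le> m \<Longrightarrow> As i \<in> carrier_mat n n"
  shows "matrix_polynomial n m As = mpoly_at n m (\<lambda>i. const_mat (As i)) pvar"
proof (rule eq_matI)
  fix i j assume "i < dim_row (mpoly_at n m (\<lambda>i. const_mat (As i)) pvar)" "j < dim_col (mpoly_at n m (\<lambda>i. const_mat (As i)) pvar)"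
  then have ij: "i < n" "j < n" by (auto simp: mpoly_at_def)
  have "monom (As k $$ (i, j)) k = pvar ^ k * const_mat (As k) $$ (i, j)" if "k \<le> m" for k
    using ij assms[OF that] by (simp add: const_mat_def monom_altdef)
  then show "matrix_polynomial n m As $$ (i, j) = mpoly_at n m (\<lambda>i. const_mat (As i)) pvar $$ (i, j)"
    using ij by (simp add: matrix_polynomial_def mpoly_at_def)
qed (auto simp: matrix_polynomial_def mpoly_at_def)

lemma rat_mat_mpoly_at:
  assumes "\<And>i. i \<le> m \<Longrightarrow> A i \<in> carrier_mat n n"
  shows "rat_mat (mpoly_at n m A x) = mpoly_at n m (\<lambda>i. rat_mat (A i)) (to_fract x)"
proof (rule eq_matI)
  fix i j assume "i < dim_row (mpoly_at n m (\<lambda>i. rat_mat (A i)) (to_fract x))" "j < dim_col (mpoly_at n m (\<lambda>i. rat_mat (A i)) (to_fract x))"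
  then have ij: "i < n" "j < n" by (auto simp: mpoly_at_def)
  have "to_fract (x ^ k * A k $$ (i, j)) = to_fract x ^ k * rat_mat (A k) $$ (i, j)" if "k \<le> m" for k
    using ij assms[OF that] by (simp add: rat_mat_def fract_hom.hom_mult fract_hom.hom_power)
  then show "rat_mat (mpoly_at n m A x) $$ (i, j) = mpoly_at n m (\<lambda>i. rat_mat (A i)) (to_fract x) $$ (i, j)"
    using ij by (simp add: mpoly_at_def rat_mat_def fract_hom.hom_sum)
qed (auto simp: mpoly_at_def rat_mat_def)

text \<open>The sign and the reversal of entries in the new coefficients are those of \<open>flip_fiedler\<close>.\<close>

lemma mpoly_at_reversal:
  fixes x :: "'a::field"
  assumes A: "\<And>i. i \<le> m \<Longrightarrow> A i \<in> carrier_mat n n" and x: "x \<noteq> 0"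
  shows "mpoly_at n m (\<lambda>j. - flip (A (m - j))) (inverse x) = - flip (inverse x ^ m \<cdot>\<^sub>m mpoly_at n m A x)"
proof (rule eq_matI)
  fix i j assume "i < dim_row (- flip (inverse x ^ m \<cdot>\<^sub>m mpoly_at n m A x))"
    "j < dim_col (- flip (inverse x ^ m \<cdot>\<^sub>m mpoly_at n m A x))"
  then have ij: "i < n" "j < n" by (auto simp: mpoly_at_def)
  let ?i = "n - 1 - i" and ?j = "n - 1 - j"
  have "(\<Sum>k\<le>m. inverse x ^ k * (- flip (A (m - k))) $$ (i, j)) = (\<Sum>k\<le>m. inverse x ^ k * - A (m - k) $$ (?i, ?j))"
  proof (rule sum.cong)
    fix k assume "k \<in> {..m}"
    then have "A (m - k) \<in> carrier_mat n n" using A by simp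
    then show "inverse x ^ k * (- flip (A (m - k))) $$ (i, j) = inverse x ^ k * - A (m - k) $$ (?i, ?j)"
      using ij by (simp add: flip_def)
  qed simp
  also have "\<dots> = (\<Sum>k\<le>m. inverse x ^ (m - k) * - A k $$ (?i, ?j))"
    by (rule sum.reindex_bij_witness[of _ "\<lambda>k. m - k" "\<lambda>k. m - k"]) auto
  also have "\<dots> = (\<Sum>k\<le>m. - (inverse x ^ m * (x ^ k * A k $$ (?i, ?j))))"
  proof (rule sum.cong)
    fix k assume "k \<in> {..m}"
    then have "inverse x ^ m = inverse x ^ (m - k) * inverse x ^ k" by (simp add: power_add[symmetric])
    then have "inverse x ^ m * x ^ k = inverse x ^ (m - k)"
      using x by (simp add: power_mult_distrib[symmetric])
    then show "inverse x ^ (m - k) * - A k $$ (?i, ?j) = - (inverse x ^ m * (x ^ k * A k $$ (?i, ?j)))"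
      by (metis mult.assoc mult_minus_right)
  qed simp
  also have "\<dots> = - (inverse x ^ m * (\<Sum>k\<le>m. x ^ k * A k $$ (?i, ?j)))"
    by (simp add: sum_negf sum_distrib_left)
  finally show "mpoly_at n m (\<lambda>j. - flip (A (m - j))) (inverse x) $$ (i, j) = (- flip (inverse x ^ m \<cdot>\<^sub>m mpoly_at n m A x)) $$ (i, j)"
    using ij by (simp add: mpoly_at_def flip_def)
qed (auto simp: mpoly_at_def)

lemma rat_mat_smult: "rat_mat (p \<cdot>\<^sub>m M) = to_fract p \<cdot>\<^sub>m rat_mat M"
  by (rule eq_matI) (auto simp: rat_mat_def fract_hom.hom_mult)

lemma rat_mat_minus:
  "M \<in> carrier_mat k l \<Longrightarrow> M' \<in> carrier_mat k l \<Longrightarrow> rat_mat (M - M') = rat_mat M - rat_mat M'"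
  by (rule eq_matI) (auto simp: rat_mat_def fract_hom.hom_minus)

lemma smult_pull_out:
  fixes x :: "'a::field"
  assumes "x \<noteq> 0" "A \<in> carrier_mat k l" "B \<in> carrier_mat k l" "C \<in> carrier_mat k l"
  shows "x \<cdot>\<^sub>m A - B + C = x \<cdot>\<^sub>m (A - inverse x \<cdot>\<^sub>m (B - C))"
  using assms by (intro eq_matI) (auto simp: field_simps)

lemma fiedlers_cong_0:
  assumes "\<And>i. i \<noteq> 0 \<Longrightarrow> A i = B i" "0 < m" "0 \<notin> set t"
  shows "fiedlers n m A t = fiedlers n m B t"
  using assms(3)
proof (induction t)
  case (Cons i t)
  have "fiedler n m A i = fiedler n m B i"
    using Cons.prems assms(1)[of m] assms(1)[of "nat \<bar>i\<bar>"] assms(2) by (auto simp: fiedler_def Let_def)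
  then show ?case using Cons by (simp add: fiedlers_def)
qed (simp add: fiedlers_def)

text \<open>The dual of a Fiedler pencil: the negative indices form the product and \<open>M\<^sub>0\<close> stands alone. Reversing the
  order of rows and columns exchanges the roles of \<open>M\<^sub>0\<close> and \<open>M\<^sub>-\<^sub>m\<close>, so that the result is a Fiedler pencil in
  \<open>1/\<lambda>\<close> for the reversed coefficients.\<close>

lemma reversed_pencil_linearizes:
  assumes Am: "\<And>i. i \<le> m \<Longrightarrow> A i \<in> proper.mats n n" and mk: "m = Suc k"
    and s: "distinct s" "set s = {- int m .. - 1}"
  obtains U V where "U \<in> proper.GL (m * n)" "V \<in> proper.GL (m * n)"
    "U * (fiedlers n m A s - inverse rvar \<cdot>\<^sub>m fiedler n m A 0) * V
      = dsum (1\<^sub>m (k * n)) (inverse rvar ^ m \<cdot>\<^sub>m mpoly_at n m A rvar)"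
proof -
  define N where "N = m * n"
  have Nk: "n + k * n = N" "k * n + n = N" by (simp_all add: N_def mk)
  have m: "0 < m" by (simp add: mk)
  note as = assoc_mult_mat[of _ N N _ N _ N] mult_carrier_mat[of _ N N _ N]
  let ?mu = "inverse rvar"
  have rv: "rvar \<noteq> 0" by simp
  have Ac: "A i \<in> carrier_mat n n" if "i \<le> m" for i using Am[OF that] by auto
  have rs: "- int m \<le> i \<and> i < 0" if "i \<in> set s" for i using that unfolding s(2) by auto
  define rho mh where "rho = fiedlers n m A s" and "mh = fiedler n m A 0"
  have crho: "rho \<in> carrier_mat N N" unfolding rho_def N_def using Ac rs m by (intro fiedlers_carrier) force+
  have cmh: "mh \<in> carrier_mat N N" unfolding mh_def N_def using Ac m by (intro fiedler_carrier) auto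
  define Y where "Y = rho - ?mu \<cdot>\<^sub>m mh"
  have cY: "Y \<in> carrier_mat N N" unfolding Y_def by (rule minus_carrier_mat) (use cmh in simp)
  define A' where "A' = (\<lambda>i. - flip (A (m - i)))"
  have flip_mats: "flip M \<in> proper.mats n n" if "M \<in> proper.mats n n" for M
    using that by (auto simp: proper.mats_def flip_def)
  have A'm: "A' i \<in> proper.mats n n" for i
    using Am[of "m - i"] by (auto simp: A'_def intro!: proper.mats_uminus flip_mats)
  have A'c: "A' i \<in> carrier_mat n n" for i using A'm[of i] by auto
  define t where "t = map (\<lambda>i. i + int m) s"
  have tset: "set t = {0..int k}" "distinct t"
  proof -
    have "set t = (\<lambda>i. i + int m) ` {- int m..- 1}" unfolding t_def s(2)[symmetric] by simp
    also have "\<dots> = {0..int k}" unfolding mk by (auto simp: image_iff intro!: bexI[of _ "_ - int (Suc k)"])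
    finally show "set t = {0..int k}" .
    show "distinct t" unfolding t_def distinct_map using s(1) by (simp add: inj_on_def)
  qed
  define tn where "tn = map nat t"
  have tn: "map int tn = t" unfolding tn_def map_map using tset by (intro map_idI) auto
  have tnset: "set tn = {0..k}"
  proof -
    have "int ` set tn = int ` {0..k}" using tn tset by (metis image_int_atLeastAtMost of_nat_0 set_map)
    then show ?thesis by (simp add: inj_image_eq_iff)
  qed
  have tnd: "distinct tn" using tset(2) unfolding tn[symmetric] distinct_map by blast
  have "0 \<in> set tn" unfolding tnset by simp
  then obtain r1 r2 where r12: "tn = r1 @ 0 # r2" by (meson split_list)
  have frho: "flip rho = factors n A' k tn"
  proof -
    have "flip rho = fiedlers n m A' t"
      unfolding rho_def t_def A'_def by (rule flip_fiedlers) (use Ac rs in force)+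
    also have "\<dots> = factors n A' k tn"
      unfolding tn[symmetric] mk by (rule factors_eq_fiedlers[symmetric]) (use A'c tnset in auto)
    finally show ?thesis .
  qed
  have fmh: "flip mh = lead n k (A' (Suc k))"
    using flip_fiedler[of m A n 0] Ac m fiedler_lead[of n k A'] unfolding mh_def A'_def mk by simp
  have "proper.linearizes n k A' ?mu (factors n A' k tn) (factors n A' k r1) (factors n A' k r2)"
    unfolding r12
    by (rule proper.fiedler_pencil_linearizes) (use A'm tnd tnset r12 proper_inverse_rvar in auto)
  then obtain U V where UV: "U \<in> proper.GL N" "V \<in> proper.GL N"
    and e1: "U * (?mu \<cdot>\<^sub>m lead n k (A' (Suc k)) - factors n A' k tn) * V = dsum (1\<^sub>m (k * n)) (mpoly_at n (Suc k) A' ?mu)"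
    unfolding proper.linearizes_def Nk by blast
  have cUV: "U \<in> carrier_mat N N" "V \<in> carrier_mat N N" using UV by auto
  define K where "K = (antidiag N :: complex poly fract mat)"
  have K: "K \<in> carrier_mat N N" "K * K = 1\<^sub>m N" by (simp_all add: K_def antidiag_square)
  have Km: "antidiag i \<in> proper.mats i i" for i by (auto simp: proper.mats_def antidiag_def)
  have KG: "antidiag i \<in> proper.GL i" for i by (rule proper.GL_I[OF Km Km antidiag_square antidiag_square])
  have flY: "?mu \<cdot>\<^sub>m lead n k (A' (Suc k)) - factors n A' k tn = - (K * Y * K)"
  proof -
    have "K * Y * K = flip Y" unfolding K_def by (rule flip_eq_antidiag[OF cY, symmetric])
    also have "\<dots> = flip rho - ?mu \<cdot>\<^sub>m flip mh"
      unfolding Y_def using flip_minus[OF crho smult_carrier_mat[OF cmh]] by (simp add: flip_smult)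
    finally show ?thesis unfolding frho[symmetric] fmh[symmetric] using crho cmh
      by (intro eq_matI) auto
  qed
  define Gm where "Gm = ?mu ^ m \<cdot>\<^sub>m mpoly_at n m A rvar"
  have Gm: "Gm \<in> carrier_mat n n" by (simp add: Gm_def)
  have mp: "mpoly_at n (Suc k) A' ?mu = - flip Gm"
    unfolding Gm_def A'_def mk[symmetric] by (rule mpoly_at_reversal[OF Ac rv])
  define k0 where "k0 = (antidiag n :: complex poly fract mat)"
  have k0: "k0 \<in> carrier_mat n n" "k0 * k0 = 1\<^sub>m n" by (simp_all add: k0_def antidiag_square)
  \<comment> \<open>The reversed pencil has the value \<open>-flip (\<mu>\<^sup>m P(\<lambda>))\<close> and enters with the opposite sign. The factor \<open>d1\<close> undoes
    the sign on the identity blocks, both factors undo the reversal in the last block.\<close>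
  define d1 d2 where "d1 = dsum (- 1\<^sub>m (k * n)) k0" and "d2 = dsum (1\<^sub>m (k * n)) k0"
  have d: "d1 \<in> carrier_mat N N" "d2 \<in> carrier_mat N N"
    unfolding d1_def d2_def using k0 dsum_carrier[of _ "k * n" "k * n" k0 n n] by (auto simp: Nk)
  have dG: "d1 \<in> proper.GL N" "d2 \<in> proper.GL N"
  proof -
    have "- 1\<^sub>m (k * n) \<in> proper.GL (k * n)"
      by (rule proper.GL_I[of _ _ "- 1\<^sub>m (k * n)"]) (auto intro: proper.mats_uminus)
    then show "d1 \<in> proper.GL N" "d2 \<in> proper.GL N"
      unfolding d1_def d2_def k0_def using proper.GL_dsum[OF _ KG[of n], of _ "k * n"] by (auto simp: Nk)
  qed
  define W where "W = U * (- (K * Y * K)) * V"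
  have We: "W = dsum (1\<^sub>m (k * n)) (- (k0 * Gm * k0))"
    unfolding W_def flY[symmetric] e1 mp k0_def flip_eq_antidiag[OF Gm] ..
  have dWd: "d1 * (- W) * d2 = dsum (1\<^sub>m (k * n)) Gm"
  proof -
    have kgk: "k0 * Gm * k0 \<in> carrier_mat n n" using k0 Gm by simp
    have "- W = dsum (- 1\<^sub>m (k * n)) (k0 * Gm * k0)"
      unfolding We using kgk by (intro eq_matI) (auto simp: dsum_def)
    moreover have "d1 * dsum (- 1\<^sub>m (k * n)) (k0 * Gm * k0) = dsum (- 1\<^sub>m (k * n) * - 1\<^sub>m (k * n)) (k0 * (k0 * Gm * k0))"
      unfolding d1_def by (rule dsum_mult) (use k0 Gm in auto)
    moreover have "dsum (- 1\<^sub>m (k * n) * - 1\<^sub>m (k * n)) (k0 * (k0 * Gm * k0)) * d2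
        = dsum ((- 1\<^sub>m (k * n) * - 1\<^sub>m (k * n)) * 1\<^sub>m (k * n)) ((k0 * (k0 * Gm * k0)) * k0)"
      unfolding d2_def by (rule dsum_mult) (use k0 Gm in auto)
    moreover have "(k0 * (k0 * Gm * k0)) * k0 = (k0 * k0) * Gm * (k0 * k0)" using k0(1) Gm
      by (simp add: assoc_mult_mat[of _ n n _ n _ n] mult_carrier_mat[of _ n n _ n])
    ultimately show ?thesis using k0 Gm by simp
  qed
  have mW: "- W = U * (K * Y * K) * V"
  proof -
    have KYK: "K * Y * K \<in> carrier_mat N N" using K cY by simp
    have "U * (- Z) * V = - (U * Z * V)" if "Z \<in> carrier_mat N N" for Z
      using cUV that mult_carrier_mat[OF cUV(1) that] by (simp del: assoc_mult_mat)
    from this[OF KYK] show ?thesis unfolding W_def by simp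
  qed
  have "(d1 * U * K) * Y * (K * V * d2) = d1 * (U * (K * Y * K) * V) * d2"
    using d K(1) cUV cY by (simp add: as)
  also have "\<dots> = dsum (1\<^sub>m (k * n)) Gm" unfolding mW[symmetric] by (rule dWd)
  finally have "(d1 * U * K) * Y * (K * V * d2) = dsum (1\<^sub>m (k * n)) Gm" .
  moreover have "d1 * U * K \<in> proper.GL N" "K * V * d2 \<in> proper.GL N"
    unfolding K_def using dG UV KG[of N] by (auto intro!: proper.GL_mult)
  ultimately show ?thesis
    using that unfolding Y_def Gm_def rho_def mh_def N_def by blast
qed

text \<open>The data of the theorem in the form needed for the equivalences: \<open>a\<close> is \<open>w\<close> without its last entry 0, \<open>z\<close> is split
  at the entry \<open>-m\<close>, \<open>E\<close> is the product of the two complements and \<open>Qs\<close> is \<open>s Q\<close>. The last three assumptions state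
  how the constant factors act on the border blocks in the positions \<open>m\<close> and \<open>j\<close>.\<close>

locale structured_pencil =
  fixes n m h j :: nat and As :: "nat \<Rightarrow> complex mat" and a z1 z2 :: "int list" and E Qs :: "complex mat"
  assumes m: "0 < m" and h: "h < m"
    and As: "\<And>i. i \<le> m \<Longrightarrow> As i \<in> carrier_mat n n"
    and a: "distinct a" "set a = {1..int h}"
    and z: "distinct (z1 @ - int m # z2)" "set (z1 @ - int m # z2) = {- int m .. - int h - 1}"
    and E: "E \<in> all_scalars.GL (m * n)" and Qs: "Qs \<in> carrier_mat (m * n) (m * n)" "Qs * Qs = 1\<^sub>m (m * n)"
    and Qs_col: "\<And>C r. C \<in> carrier_mat n r \<Longrightarrow> Qs * block_col m j C = block_col m j C"
    and a_col: "\<And>C r. C \<in> carrier_mat n r \<Longrightarrow> fiedlers n m As a * block_col m m C = block_col m j C"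
    and E_row: "\<And>B r. B \<in> carrier_mat r n \<Longrightarrow> block_row m m B * E = block_row m j B"
begin

definition "pen = const_mat Qs * ((pvar \<cdot>\<^sub>m const_mat (fiedlers n m As (z1 @ - int m # z2)) - const_mat (fiedlers n m As (a @ [0]))) * const_mat E)"

lemma z1_range: "i \<in> set z1 \<Longrightarrow> - int m < i \<and> i < - int h"
  and z2_range: "i \<in> set z2 \<Longrightarrow> - int m < i \<and> i < - int h"
proof -
  have "i \<in> {- int m .. - int h - 1}" "i \<noteq> - int m" if "i \<in> set z1 \<union> set z2" for i
    using that z by (auto simp: set_eq_iff)
  then show "i \<in> set z1 \<Longrightarrow> - int m < i \<and> i < - int h" "i \<in> set z2 \<Longrightarrow> - int m < i \<and> i < - int h"
    by force+
qed

lemma z12_set: "set z1 \<union> set z2 = {- int m + 1 .. - int h - 1}"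
proof -
  have "insert (- int m) (set z1 \<union> set z2) = {- int m .. - int h - 1}" using z(2) by auto
  moreover have "- int m \<notin> set z1 \<union> set z2" using z(1) by auto
  moreover have "{- int m .. - int h - 1} - {- int m} = {- int m + 1 .. - int h - 1}" by auto
  ultimately show ?thesis by (metis Diff_insert_absorb)
qed

text \<open>The inverse of \<open>M\<^sub>z\<^sub>1\<close> is the product over the reversed and negated tuple. Negation sends \<open>-m + 1, \<dots>, -h - 1\<close> to
  \<open>h + 1, \<dots>, m - 1\<close>, which complements \<open>0, \<dots>, h\<close>.\<close>

lemma index_permutation:
  defines "a' \<equiv> map nat (map uminus (rev z1) @ a)" and "b' \<equiv> map nat (map uminus (rev z2))"
  shows "distinct (a' @ 0 # b')" "set (a' @ 0 # b') = {0..m - 1}"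
    "map int a' = map uminus (rev z1) @ a" "map int b' = map uminus (rev z2)"
proof -
  let ?l = "(map uminus (rev z1) @ a) @ 0 # map uminus (rev z2)"
  have nonneg: "0 \<le> i" if "i \<in> set ?l" for i
    using that z1_range z2_range a by force
  have eq: "a' @ 0 # b' = map nat ?l" by (simp add: a'_def b'_def)
  have inj: "inj_on nat (set ?l)" using nonneg by (intro inj_onI) (metis nat_0_le)
  have d: "distinct ?l"
    using z(1) a z1_range z2_range by (auto simp: distinct_map) force+
  show "distinct (a' @ 0 # b')" unfolding eq distinct_map using d inj by blast
  have "set ?l = uminus ` (set z1 \<union> set z2) \<union> {1..int h} \<union> {0}" using a by auto
  also have "\<dots> = {int h + 1..int m - 1} \<union> {1..int h} \<union> {0}"
    unfolding z12_set by (auto simp: image_iff)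
  also have "\<dots> = {0..int m - 1}" using h by auto
  finally have "set ?l = {0..int m - 1}" .
  moreover have "nat ` {0..int m - 1} = {0..m - 1}"
  proof -
    have "i \<in> nat ` {0..int m - 1}" if "i \<le> m - 1" for i
      using that m by (intro image_eqI[of _ _ "int i"]) auto
    then show ?thesis by auto
  qed
  ultimately show "set (a' @ 0 # b') = {0..m - 1}" unfolding eq set_map by simp
  have "map int a' = map (int \<circ> nat) (map uminus (rev z1) @ a)" by (simp add: a'_def)
  also have "\<dots> = map id (map uminus (rev z1) @ a)" by (rule map_cong) (use nonneg in auto)
  finally show "map int a' = map uminus (rev z1) @ a" by simp
  have "map int b' = map (int \<circ> nat) (map uminus (rev z2))" by (simp add: b'_def)
  also have "\<dots> = map id (map uminus (rev z2))" by (rule map_cong) (use nonneg in auto)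
  finally show "map int b' = map uminus (rev z2)" by simp
qed

lemma map_const_fiedlers:
  "(\<And>i. i \<in> set t \<Longrightarrow> - int m \<le> i \<and> i < int m) \<Longrightarrow>
    const_mat (fiedlers n m As t) = fiedlers n m (\<lambda>i. const_mat (As i)) t"
  unfolding const_mat_def by (rule comm_ring_hom.map_fiedlers[OF const_hom.comm_ring_hom_axioms]) (use As in auto)

text \<open>Multiplying by the inverses of the constant factors reduces the pencil to a Fiedler pencil, so that the
  linearizing \<open>U\<close> and \<open>V\<close> are available. The border conditions then act on \<open>e\<^sub>j \<otimes> C = M\<^sub>a (e\<^sub>m \<otimes> C)\<close> and on
  \<open>e\<^sub>j\<^sup>T \<otimes> B = (e\<^sub>m\<^sup>T \<otimes> B) E\<close>, because the last block column and row are fixed by the projection to the last block.\<close>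

theorem unimodular_equivalence:
  assumes C: "C \<in> carrier_mat n r" and B: "B \<in> carrier_mat r n"
  obtains U V where "U \<in> all_scalars.GL (m * n)" "V \<in> all_scalars.GL (m * n)"
    "U * pen * V = dsum (1\<^sub>m ((m - 1) * n)) (matrix_polynomial n m As)"
    "U * const_mat (block_col m j C) = const_mat (block_col m m C)"
    "const_mat (block_row m j B) * V = const_mat (block_row m m B)"
proof -
  obtain k where mk: "m = Suc k" using m by (cases m) auto
  define N where "N = m * n"
  have Nk: "n + k * n = N" by (simp add: N_def mk)
  note as = assoc_mult_mat[of _ N N _ N _ N] mult_carrier_mat[of _ N N _ N]
    assoc_mult_mat[of _ N N _ N _ r] mult_carrier_mat[of _ N N _ r]
    assoc_mult_mat[of _ r N _ N _ N] mult_carrier_mat[of _ r N _ N]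
  define A where "A = (\<lambda>i. const_mat (As i))"
  have A: "A i \<in> carrier_mat n n" if "i \<le> m" for i using As that by (simp add: A_def const_mat_carrier)
  define F where "F = fiedlers n m A"
  have Fc: "F t \<in> carrier_mat N N" if "\<And>i. i \<in> set t \<Longrightarrow> - int m \<le> i \<and> i < int m" for t
    unfolding F_def N_def using A that by (intro fiedlers_carrier) auto
  have Fapp: "F (s @ t) = F s * F t" if "\<And>i. i \<in> set (s @ t) \<Longrightarrow> - int m \<le> i \<and> i < int m" for s t
    unfolding F_def using A that by (intro fiedlers_append) auto
  define Z1 Z2 Z1' Z2' Ma D M0 where defs: "Z1 = F z1" "Z2 = F z2" "Z1' = F (map uminus (rev z1))"
    "Z2' = F (map uminus (rev z2))" "Ma = F a" "D = F [- int m]" "M0 = F [0]"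
  have r1: "- int m \<le> i \<and> i < int m" if "i \<in> set z1" for i using z1_range[OF that] by auto
  have r2: "- int m \<le> i \<and> i < int m" if "i \<in> set z2" for i using z2_range[OF that] by auto
  have r1': "- int m \<le> i \<and> i < int m" if "i \<in> set (map uminus (rev z1))" for i using that z1_range by force
  have r2': "- int m \<le> i \<and> i < int m" if "i \<in> set (map uminus (rev z2))" for i using that z2_range by force
  have ra: "- int m \<le> i \<and> i < int m" if "i \<in> set a" for i using that a h by auto
  have c: "Z1 \<in> carrier_mat N N" "Z2 \<in> carrier_mat N N" "Z1' \<in> carrier_mat N N" "Z2' \<in> carrier_mat N N"
    "Ma \<in> carrier_mat N N" "D \<in> carrier_mat N N" "M0 \<in> carrier_mat N N"
    unfolding defs using r1 r2 r1' r2' ra m by (intro Fc; force)+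
  have inv: "Z1 * Z1' = 1\<^sub>m N" "Z1' * Z1 = 1\<^sub>m N" "Z2 * Z2' = 1\<^sub>m N" "Z2' * Z2 = 1\<^sub>m N"
    unfolding defs F_def N_def using A z1_range z2_range
    by (intro fiedlers_inverse; force)+
  have Mz: "F (z1 @ - int m # z2) = Z1 * (D * Z2)"
  proof -
    have "F (z1 @ ([- int m] @ z2)) = F z1 * F ([- int m] @ z2)" by (rule Fapp) (use r1 r2 m in auto)
    also have "F ([- int m] @ z2) = F [- int m] * F z2" by (rule Fapp) (use r2 m in auto)
    finally show ?thesis by (simp add: defs)
  qed
  have Mw: "F (a @ [0]) = Ma * M0"
    unfolding defs by (rule Fapp) (use ra m in auto)
  obtain Ei where Ei: "E \<in> carrier_mat N N" "Ei \<in> carrier_mat N N" "E * Ei = 1\<^sub>m N" "Ei * E = 1\<^sub>m N"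
    using E by (auto simp: all_scalars.GL_def all_scalars.mats_def N_def)
  define e ei q where ee: "e = const_mat E" "ei = const_mat Ei" "q = const_mat Qs"
  have ce: "e \<in> carrier_mat N N" "ei \<in> carrier_mat N N" "q \<in> carrier_mat N N"
    unfolding ee using Ei Qs by (auto intro: const_mat_carrier simp: N_def)
  have ie: "e * ei = 1\<^sub>m N" "ei * e = 1\<^sub>m N" "q * q = 1\<^sub>m N"
    unfolding ee using Ei Qs by (auto simp: const_mat_mult[symmetric] const_mat_one N_def)
  have pen: "pen = q * ((pvar \<cdot>\<^sub>m (Z1 * (D * Z2)) - Ma * M0) * e)"
  proof -
    have "const_mat (fiedlers n m As (z1 @ - int m # z2)) = F (z1 @ - int m # z2)"
      unfolding F_def A_def by (rule map_const_fiedlers) (use r1 r2 m in auto)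
    moreover have "const_mat (fiedlers n m As (a @ [0])) = F (a @ [0])"
      unfolding F_def A_def by (rule map_const_fiedlers) (use ra m in auto)
    ultimately show ?thesis unfolding pen_def ee Mz Mw by simp
  qed
  define a' b' where ab: "a' = map nat (map uminus (rev z1) @ a)" "b' = map nat (map uminus (rev z2))"
  note perm = index_permutation[folded ab]
  have fac: "factors n A k t = F (map int t)" if "set t \<subseteq> {0..k}" for t
    unfolding F_def mk by (rule factors_eq_fiedlers) (use A that in \<open>auto simp: mk\<close>)
  have sub: "set (a' @ 0 # b') = {0..k}" using perm(2) by (simp add: mk)
  then have subs: "set a' \<subseteq> {0..k}" "set b' \<subseteq> {0..k}" by auto
  have Fa: "factors n A k a' = Z1' * Ma"
    unfolding fac[OF subs(1)] perm(3) defs by (rule Fapp) (use r1' ra in auto)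
  have Fb: "factors n A k b' = Z2'"
    unfolding fac[OF subs(2)] perm(4) defs ..
  have Fs: "factors n A k (a' @ 0 # b') = Z1' * Ma * (M0 * Z2')"
  proof -
    have "factors n A k (a' @ 0 # b') = F (map int a' @ 0 # map int b')"
      using fac[OF equalityD1[OF sub]] by simp
    also have "\<dots> = F ((map uminus (rev z1) @ a) @ ([0] @ map uminus (rev z2)))" unfolding perm by simp
    also have "\<dots> = F (map uminus (rev z1) @ a) * F ([0] @ map uminus (rev z2))"
      by (rule Fapp) (use r1' r2' ra m in auto)
    also have "F (map uminus (rev z1) @ a) = Z1' * Ma" unfolding defs by (rule Fapp) (use r1' ra in auto)
    also have "F ([0] @ map uminus (rev z2)) = M0 * Z2'" unfolding defs by (rule Fapp) (use r2' m in auto)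
    finally show ?thesis .
  qed
  have lead: "lead n k (A (Suc k)) = D"
  proof -
    have "D = fiedler n m A (- int m) * 1\<^sub>m N" by (simp add: defs F_def fiedlers_def N_def)
    also have "\<dots> = fiedler n m A (- int m)"
      using fiedler_carrier[of m A n "- int m"] A m by (simp add: N_def)
    finally show ?thesis using fiedler_lead[of n k A] by (simp add: mk)
  qed
  have "all_scalars.linearizes n k A pvar (factors n A k (a' @ 0 # b')) (factors n A k a') (factors n A k b')"
    by (rule all_scalars.fiedler_pencil_linearizes)
      (use A perm(1) sub in \<open>auto simp: all_scalars.mats_def mk\<close>)
  then obtain U V where UV: "U \<in> all_scalars.GL N" "V \<in> all_scalars.GL N"
    and e1: "U * (pvar \<cdot>\<^sub>m D - Z1' * Ma * (M0 * Z2')) * V = dsum (1\<^sub>m (k * n)) (mpoly_at n (Suc k) A pvar)"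
    and e2: "U * (Z1' * Ma) * last_proj n k = last_proj n k"
    and e3: "last_proj n k * Z2' * V = last_proj n k"
    unfolding all_scalars.linearizes_def Fs Fa Fb lead Nk by blast
  have cUV: "U \<in> carrier_mat N N" "V \<in> carrier_mat N N" using UV by auto
  define L where "L = (last_proj n k :: complex poly mat)"
  have cL: "L \<in> carrier_mat N N" unfolding L_def using last_proj_carrier[of n k] by (simp add: Nk)
  define U' V' where UV': "U' = U * Z1' * q" "V' = ei * Z2' * V"
  have G: "Z1' \<in> all_scalars.GL N" "Z2' \<in> all_scalars.GL N" "q \<in> all_scalars.GL N" "ei \<in> all_scalars.GL N"
    using c ce inv ie by (auto simp: all_scalars.GL_def all_scalars.mats_def)
  have GL: "U' \<in> all_scalars.GL N" "V' \<in> all_scalars.GL N"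
    unfolding UV' using UV G by (auto intro!: all_scalars.GL_mult)
  define W where "W = pvar \<cdot>\<^sub>m (Z1 * (D * Z2)) - Ma * M0"
  have cW: "W \<in> carrier_mat N N" unfolding W_def using c by (intro minus_carrier_mat) auto
  \<comment> \<open>Stripping \<open>M\<^sub>z\<^sub>1\<close> and \<open>M\<^sub>z\<^sub>2\<close> leaves a Fiedler pencil.\<close>
  have ZW: "Z1' * W * Z2' = pvar \<cdot>\<^sub>m D - Z1' * Ma * (M0 * Z2')"
  proof -
    have zdz: "Z1 * (D * Z2) \<in> carrier_mat N N" "Ma * M0 \<in> carrier_mat N N" using c by auto
    have 1: "Z1' * (Z1 * (D * Z2)) * Z2' = D"
    proof -
      have "Z1' * (Z1 * (D * Z2)) * Z2' = (Z1' * Z1) * D * (Z2 * Z2')" using c by (simp add: as)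
      then show ?thesis using c inv by simp
    qed
    have "Z1' * W = pvar \<cdot>\<^sub>m (Z1' * (Z1 * (D * Z2))) - Z1' * (Ma * M0)"
      unfolding W_def using mult_minus_distrib_mat[OF c(3) smult_carrier_mat[OF zdz(1)] zdz(2)]
        mult_smult_distrib[OF c(3) zdz(1)] by simp
    then have "Z1' * W * Z2' = (pvar \<cdot>\<^sub>m (Z1' * (Z1 * (D * Z2)))) * Z2' - Z1' * (Ma * M0) * Z2'"
      using minus_mult_distrib_mat[of "pvar \<cdot>\<^sub>m (Z1' * (Z1 * (D * Z2)))" N N "Z1' * (Ma * M0)" Z2' N] c zdz
      by (simp del: assoc_mult_mat)
    also have "(pvar \<cdot>\<^sub>m (Z1' * (Z1 * (D * Z2)))) * Z2' = pvar \<cdot>\<^sub>m (Z1' * (Z1 * (D * Z2)) * Z2')"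
      by (rule mult_smult_assoc_mat) (use c zdz in auto)
    also have "Z1' * (Ma * M0) * Z2' = Z1' * Ma * (M0 * Z2')" using c by (simp add: as)
    finally show ?thesis unfolding 1 .
  qed
  have "U' * pen * V' = U * Z1' * (q * q) * W * (e * ei) * Z2' * V"
    unfolding UV' pen W_def[symmetric] using cUV c ce cW by (simp add: as)
  also have "\<dots> = U * (Z1' * W * Z2') * V"
    unfolding ie using cUV c cW by (simp add: as)
  also have "\<dots> = dsum (1\<^sub>m ((m - 1) * n)) (matrix_polynomial n m As)"
    unfolding ZW e1 A_def using As by (simp add: matrix_polynomial_mpoly_at mk)
  finally have r1: "U' * pen * V' = \<dots>" .
  define cm cj rm rj where cr: "cm = const_mat (block_col m m C)" "cj = const_mat (block_col m j C)"
    "rm = const_mat (block_row m m B)" "rj = const_mat (block_row m j B)"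
  have bc: "block_col m m C \<in> carrier_mat N r" "block_col m j C \<in> carrier_mat N r"
    "block_row m m B \<in> carrier_mat r N" "block_row m j B \<in> carrier_mat r N"
    unfolding N_def using C B by (auto intro: block_col_carrier block_row_carrier)
  have ccr: "cm \<in> carrier_mat N r" "cj \<in> carrier_mat N r" "rm \<in> carrier_mat r N" "rj \<in> carrier_mat r N"
    unfolding cr using bc by (auto intro: const_mat_carrier)
  have fa: "fiedlers n m As a \<in> carrier_mat N N" unfolding N_def using As ra by (intro fiedlers_carrier) auto
  have k1: "Ma * cm = cj"
  proof -
    have "Ma = const_mat (fiedlers n m As a)"
      unfolding defs F_def A_def by (rule map_const_fiedlers[symmetric]) (use ra in auto)
    then show ?thesis unfolding cr using const_mat_mult[OF fa bc(1)] a_col[OF C] by simp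
  qed
  have k2: "q * cj = cj" unfolding cr ee using const_mat_mult[OF Qs(1)[folded N_def] bc(2)] Qs_col[OF C] by simp
  have k3: "rm * e = rj" unfolding cr ee using const_mat_mult[OF bc(3) Ei(1)] E_row[OF B] by simp
  have cmb: "cm = block_col (Suc k) (Suc k) (const_mat C)" "rm = block_row (Suc k) (Suc k) (const_mat B)"
    unfolding cr const_mat_def mk
    using comm_ring_hom.map_block_col[OF const_hom.comm_ring_hom_axioms C] comm_ring_hom.map_block_row[OF const_hom.comm_ring_hom_axioms B] by auto
  \<comment> \<open>The borders in position \<open>m\<close> are fixed by the projection to the last block.\<close>
  have k4: "L * cm = cm" unfolding L_def cmb by (rule last_proj_block_col[OF const_mat_carrier[OF C]])
  have k5: "rm * L = rm"
  proof -
    have cB: "transpose_mat (const_mat B) \<in> carrier_mat n r" using const_mat_carrier[OF B] by simp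
    have rmt: "transpose_mat rm = block_col (Suc k) (Suc k) (transpose_mat (const_mat B))"
      unfolding cmb(2) block_row_transpose[OF const_mat_carrier[OF B]] by simp
    have "transpose_mat (rm * L) = L * transpose_mat rm"
      using transpose_mult[OF ccr(3) cL] by (simp add: L_def last_proj_transpose)
    also have "\<dots> = transpose_mat rm" unfolding rmt L_def by (rule last_proj_block_col[OF cB])
    finally show ?thesis by (metis transpose_transpose)
  qed
  have "U' * cj = U * (Z1' * (Ma * cm))"
    unfolding UV' k1 using cUV c ce ccr k2 by (simp add: as)
  also have "\<dots> = (U * (Z1' * Ma) * L) * cm"
    using cUV c cL ccr k4 by (simp add: as)
  also have "\<dots> = cm" unfolding e2[folded L_def] by (rule k4)
  finally have r2: "U' * cj = cm" .
  have "rj * V' = rm * (e * ei) * Z2' * V"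
    unfolding UV' k3[symmetric] using cUV c ce ccr by (simp add: as)
  also have "\<dots> = rm * L * Z2' * V" unfolding ie k5 using ccr by (simp add: as)
  also have "\<dots> = rm * (L * Z2' * V)" using cUV c cL ccr by (simp add: as)
  also have "\<dots> = rm" unfolding e3[folded L_def] by (rule k5)
  finally have r3: "rj * V' = rm" .
  show ?thesis
    using that[of U' V'] GL r1 r2 r3 unfolding N_def cr by blast
qed

lemma map_const_rat_fiedlers:
  "(\<And>i. i \<in> set t \<Longrightarrow> - int m \<le> i \<and> i < int m) \<Longrightarrow>
    const_rat_mat (fiedlers n m As t) = fiedlers n m (\<lambda>i. const_rat_mat (As i)) t"
  unfolding const_rat_mat_eq by (rule comm_ring_hom.map_fiedlers[OF const_fract_hom.comm_ring_hom_axioms]) (use As in auto)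

text \<open>After division by \<open>\<lambda>\<close> the pencil is \<open>M\<^sub>z - \<mu> M\<^sub>a M\<^sub>0\<close> with \<open>\<mu> = 1/\<lambda>\<close>, up to constant factors. Cancelling \<open>M\<^sub>a\<close>
  leaves \<open>M\<^sub>0\<close> alone next to \<open>\<mu>\<close>, and the remaining product has all the indices \<open>-m, \<dots>, -1\<close>, so that
  \<open>reversed_pencil_linearizes\<close> applies. The block \<open>\<Phi>\<close> moves from position \<open>j\<close> to position \<open>m\<close> like the borders
  and is absorbed into \<open>A\<^sub>0\<close>.\<close>

theorem equivalence_at_infinity:
  assumes Phi: "Phi \<in> proper.mats n n"
  obtains Ol Or where "Ol \<in> proper.GL (m * n)" "Or \<in> proper.GL (m * n)"
    "Ol * (inverse rvar \<cdot>\<^sub>m (rat_mat pen + block_both m j Phi)) * Or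
      = dsum (1\<^sub>m ((m - 1) * n)) (inverse rvar ^ m \<cdot>\<^sub>m (rat_mat (matrix_polynomial n m As) + Phi))"
proof -
  obtain k where mk: "m = Suc k" using m by (cases m) auto
  define N where "N = m * n"
  have Nk: "n + k * n = N" "k * n + n = N" by (simp_all add: N_def mk)
  note as = assoc_mult_mat[of _ N N _ N _ N] mult_carrier_mat[of _ N N _ N]
  let ?mu = "inverse rvar" and ?c = const_rat_mat
  have rv: "rvar \<noteq> 0" by simp
  have PhiC: "Phi \<in> carrier_mat n n" using Phi by auto
  have cmul: "?c (M * M') = ?c M * ?c M'" if "M \<in> carrier_mat x y" "M' \<in> carrier_mat y w" for M M' x y w
    unfolding const_rat_mat_eq by (rule const_fract_hom.mat_hom_mult[OF that])
  have ccar: "?c M \<in> carrier_mat x y" if "M \<in> carrier_mat x y" for M x y using that by (simp add: const_rat_mat_eq)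
  have cone: "?c (1\<^sub>m x) = 1\<^sub>m x" for x by (simp add: const_rat_mat_eq const_fract_hom.mat_hom_one)
  \<comment> \<open>The rational function is absorbed into the constant coefficient.\<close>
  define A0 A where "A0 = (\<lambda>i. ?c (As i))" and "A = (\<lambda>i. if i = 0 then ?c (As 0) + Phi else ?c (As i))"
  have A0c: "A0 i \<in> carrier_mat n n" if "i \<le> m" for i using As[OF that] by (simp add: A0_def ccar)
  have Am: "A i \<in> proper.mats n n" if "i \<le> m" for i
    using As[OF that] Phi by (auto simp: A_def intro: proper.mats_add const_rat_mat_proper)
  have Ac: "A i \<in> carrier_mat n n" if "i \<le> m" for i using Am[OF that] by auto
  define F where "F = fiedlers n m A"
  have F0: "F t = ?c (fiedlers n m As t)" if "\<And>i. i \<in> set t \<Longrightarrow> - int m \<le> i \<and> i < int m" "0 \<notin> set t" for t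
  proof -
    have "F t = fiedlers n m A0 t"
      unfolding F_def by (rule fiedlers_cong_0) (use m that in \<open>auto simp: A_def A0_def\<close>)
    then show ?thesis using map_const_rat_fiedlers[OF that(1)] by (simp add: A0_def)
  qed
  define zz where "zz = z1 @ - int m # z2"
  define na where "na = map uminus (rev a)"
  have rz: "- int m \<le> i \<and> i < 0" if "i \<in> set zz" for i
  proof -
    have "i \<in> {- int m .. - int h - 1}" using that unfolding zz_def z(2) .
    then show ?thesis using m by auto
  qed
  have ra: "0 < i \<and> i < int m" if "i \<in> set a" for i using that a h by auto
  have rna: "- int m < i \<and> i < 0" if "i \<in> set na" for i using that ra unfolding na_def by force
  define fa fna fz fw where "fa = fiedlers n m As a" and "fna = fiedlers n m As na"
    and "fz = fiedlers n m As zz" and "fw = fiedlers n m As (a @ [0])"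
  have fc: "fa \<in> carrier_mat N N" "fna \<in> carrier_mat N N" "fz \<in> carrier_mat N N" "fw \<in> carrier_mat N N"
    unfolding fa_def fna_def fz_def fw_def N_def using As ra rna rz m
    by (intro fiedlers_carrier; force)+
  have finv: "fa * fna = 1\<^sub>m N" "fna * fa = 1\<^sub>m N"
    unfolding fa_def fna_def na_def N_def using As ra by (intro fiedlers_inverse; force)+
  define f0 where "f0 = fiedler n m As 0"
  have f0: "f0 \<in> carrier_mat N N" unfolding f0_def N_def using As m by (intro fiedler_carrier) auto
  have fwe: "fw = fa * f0"
  proof -
    have "fw = fa * fiedlers n m As [0]"
      unfolding fw_def fa_def by (rule fiedlers_append) (use As ra m in force)+
    then show ?thesis using f0 by (simp add: fiedlers_def f0_def N_def)
  qed
  obtain Ei where Ei: "E \<in> carrier_mat N N" "Ei \<in> carrier_mat N N" "E * Ei = 1\<^sub>m N" "Ei * E = 1\<^sub>m N"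
    using E by (auto simp: all_scalars.GL_def all_scalars.mats_def N_def)
  have QsN: "Qs \<in> carrier_mat N N" "Qs * Qs = 1\<^sub>m N" using Qs by (simp_all add: N_def)
  define q e ei ma mai mz m0 where defs: "q = ?c Qs" "e = ?c E" "ei = ?c Ei" "ma = ?c fa" "mai = ?c fna" "mz = ?c fz" "m0 = ?c f0"
  have c: "q \<in> carrier_mat N N" "e \<in> carrier_mat N N" "ei \<in> carrier_mat N N" "ma \<in> carrier_mat N N"
    "mai \<in> carrier_mat N N" "mz \<in> carrier_mat N N" "m0 \<in> carrier_mat N N"
    unfolding defs using QsN Ei fc f0 by (auto intro: ccar)
  have inv: "q * q = 1\<^sub>m N" "e * ei = 1\<^sub>m N" "ei * e = 1\<^sub>m N" "ma * mai = 1\<^sub>m N" "mai * ma = 1\<^sub>m N"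
    unfolding defs using cmul[OF QsN(1) QsN(1)] cmul[OF Ei(1,2)] cmul[OF Ei(2,1)] cmul[OF fc(1,2)] cmul[OF fc(2,1)]
      QsN Ei finv by (simp_all add: cone)
  have GLs: "q \<in> proper.GL N" "ei \<in> proper.GL N" "mai \<in> proper.GL N"
    using inv const_rat_mat_proper[OF QsN(1)] const_rat_mat_proper[OF Ei(1)] const_rat_mat_proper[OF Ei(2)]
      const_rat_mat_proper[OF fc(1)] const_rat_mat_proper[OF fc(2)]
    unfolding proper.GL_def defs by blast+
  have rpen: "rat_mat pen = q * ((rvar \<cdot>\<^sub>m mz - ma * m0) * e)"
  proof -
    have cm: "const_mat Qs \<in> carrier_mat N N" "const_mat fz \<in> carrier_mat N N" "const_mat fw \<in> carrier_mat N N" "const_mat E \<in> carrier_mat N N"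
      using QsN fc Ei by (auto intro: const_mat_carrier)
    have d: "pvar \<cdot>\<^sub>m const_mat fz - const_mat fw \<in> carrier_mat N N" by (rule minus_carrier_mat[OF cm(3)])
    have "rat_mat pen = rat_mat (const_mat Qs) * (rat_mat (pvar \<cdot>\<^sub>m const_mat fz - const_mat fw) * rat_mat (const_mat E))"
      unfolding pen_def zz_def[symmetric] fz_def[symmetric] fw_def[symmetric] rat_mat_def
      using fract_hom.mat_hom_mult[OF cm(1) mult_carrier_mat[OF d cm(4)]] fract_hom.mat_hom_mult[OF d cm(4)] by simp
    moreover have "rat_mat (pvar \<cdot>\<^sub>m const_mat fz - const_mat fw) = rvar \<cdot>\<^sub>m mz - ?c fw"
      unfolding rat_mat_minus[OF smult_carrier_mat[OF cm(2)] cm(3)] rat_mat_smult defs ..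
    moreover have "?c fw = ma * m0" unfolding fwe defs by (rule cmul[OF fc(1) f0])
    ultimately show ?thesis by (simp add: defs)
  qed
  define D where "D = block_both m m Phi"
  have D: "D = dsum (0\<^sub>m (k * n) (k * n)) Phi" unfolding D_def mk by (rule block_both_last[OF PhiC])
  have cD: "D \<in> carrier_mat N N" unfolding D using dsum_carrier[OF zero_carrier_mat PhiC, of "k * n" "k * n"] by (simp add: Nk)
  \<comment> \<open>Written as \<open>(e\<^sub>j \<otimes> I) \<Phi> (e\<^sub>j\<^sup>T \<otimes> I)\<close>, the block moves from position \<open>j\<close> to position \<open>m\<close> like the borders.\<close>
  have bj: "block_both m j Phi = q * (ma * D * e)"
  proof -
    define u v ut vt where uv: "u = ?c (block_col m m (1\<^sub>m n))" "v = ?c (block_row m m (1\<^sub>m n))"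
      "ut = ?c (block_col m j (1\<^sub>m n))" "vt = ?c (block_row m j (1\<^sub>m n))"
    have bcar: "block_col m i (1\<^sub>m n) \<in> carrier_mat N n" "block_row m i (1\<^sub>m n) \<in> carrier_mat n N" for i
      unfolding N_def by (auto intro: block_col_carrier block_row_carrier)
    have uvc: "u \<in> carrier_mat N n" "v \<in> carrier_mat n N" "ut \<in> carrier_mat N n" "vt \<in> carrier_mat n N"
      unfolding uv by (rule ccar[OF bcar(1)] ccar[OF bcar(2)])+
    have both: "block_both m i Phi = ?c (block_col m i (1\<^sub>m n)) * Phi * ?c (block_row m i (1\<^sub>m n))" for i
      using block_transfer[of "1\<^sub>m n" n n "1\<^sub>m n" Phi m i] PhiC by (simp add: cone)
    have q: "q * ut = ut" unfolding uv defs cmul[OF QsN(1) bcar(1), symmetric] Qs_col[OF one_carrier_mat] ..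
    have ma: "ma * u = ut" unfolding uv defs cmul[OF fc(1) bcar(1), symmetric] a_col[OF one_carrier_mat, folded fa_def] ..
    have ev: "v * e = vt" unfolding uv defs cmul[OF bcar(2) Ei(1), symmetric] E_row[OF one_carrier_mat] ..
    have "block_both m j Phi = (q * (ma * u)) * Phi * (v * e)"
      unfolding both ev uv(3,4)[symmetric] ma q ..
    also have "\<dots> = q * (ma * (u * Phi * v) * e)"
      using c uvc PhiC
      by (simp add: as assoc_mult_mat[of _ N N _ n _ n] assoc_mult_mat[of _ N N _ n _ N] assoc_mult_mat[of _ N n _ n _ N] assoc_mult_mat[of _ N n _ N _ N] assoc_mult_mat[of _ n n _ n _ N] assoc_mult_mat[of _ n n _ N _ N] assoc_mult_mat[of _ n N _ N _ N] mult_carrier_mat[of _ N n _ n] mult_carrier_mat[of _ N n _ N] mult_carrier_mat[of _ n n _ N] mult_carrier_mat[of _ n N _ N] mult_carrier_mat[of _ N N _ n])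
    also have "u * Phi * v = D" unfolding D_def both uv ..
    finally show ?thesis .
  qed
  define mh where "mh = fiedler n m A 0"
  have mh: "m0 - D = mh"
  proof -
    have "m0 = fiedler n m A0 0"
      unfolding defs f0_def const_rat_mat_eq A0_def
      by (rule comm_ring_hom.map_fiedler[OF const_fract_hom.comm_ring_hom_axioms]) (use As in auto)
    then have "m0 = dsum (1\<^sub>m (k * n)) (- A0 0)" by (simp add: fiedler_def mk)
    moreover have "mh = dsum (1\<^sub>m (k * n)) (- (A0 0 + Phi))" by (simp add: mh_def fiedler_def mk A_def A0_def)
    ultimately show ?thesis
      unfolding D using A0c[of 0] PhiC by (intro eq_matI) (auto simp: dsum_def)
  qed
  have cmh: "mh \<in> carrier_mat N N" unfolding mh[symmetric] by (rule minus_carrier_mat[OF cD])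
  define rho where "rho = F (na @ zz)"
  have rho: "rho = mai * mz"
  proof -
    have "rho = ?c (fiedlers n m As (na @ zz))" unfolding rho_def by (rule F0) (use rna rz m in force)+
    also have "fiedlers n m As (na @ zz) = fna * fz"
      unfolding fna_def fz_def by (rule fiedlers_append) (use As rna rz m in force)+
    finally show ?thesis using cmul[OF fc(2,3)] by (simp add: defs)
  qed
  have crho: "rho \<in> carrier_mat N N" unfolding rho using c by (simp add: as)
  define Y where "Y = rho - ?mu \<cdot>\<^sub>m mh"
  have cY: "Y \<in> carrier_mat N N" unfolding Y_def by (rule minus_carrier_mat) (use cmh in simp)
  have total: "?mu \<cdot>\<^sub>m (rat_mat pen + block_both m j Phi) = q * (ma * Y * e)"
  proof -
    define S where "S = rvar \<cdot>\<^sub>m mz - ma * m0"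
    have cS: "S \<in> carrier_mat N N" unfolding S_def by (rule minus_carrier_mat) (use c in auto)
    have cmD: "ma * D \<in> carrier_mat N N" using c cD by simp
    have "rat_mat pen + block_both m j Phi = q * (S * e) + q * (ma * D * e)"
      unfolding rpen bj S_def ..
    also have "\<dots> = q * ((S + ma * D) * e)"
      using mult_add_distrib_mat[OF c(1) mult_carrier_mat[OF cS c(2)] mult_carrier_mat[OF cmD c(2)]]
        add_mult_distrib_mat[OF cS cmD c(2)] by simp
    also have "S + ma * D = rvar \<cdot>\<^sub>m (ma * Y)"
    proof -
      have "ma * Y = ma * rho - ?mu \<cdot>\<^sub>m (ma * mh)"
        unfolding Y_def using mult_minus_distrib_mat[OF c(4) crho smult_carrier_mat[OF cmh]] mult_smult_distrib[OF c(4) cmh] by simp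
      also have "ma * rho = mz" unfolding rho using c inv as(1)[of ma mai mz] by simp
      also have "ma * mh = ma * m0 - ma * D" unfolding mh[symmetric] by (rule mult_minus_distrib_mat[OF c(4,7) cD])
      finally have "ma * Y = mz - ?mu \<cdot>\<^sub>m (ma * m0 - ma * D)" .
      then show ?thesis
        unfolding S_def using smult_pull_out[OF rv c(6) mult_carrier_mat[OF c(4,7)] cmD] by (simp only:)
    qed
    finally have "rat_mat pen + block_both m j Phi = q * ((rvar \<cdot>\<^sub>m (ma * Y)) * e)" .
    also have "\<dots> = rvar \<cdot>\<^sub>m (q * (ma * Y * e))"
      using mult_smult_assoc_mat[OF mult_carrier_mat[OF c(4) cY] c(2)]
        mult_smult_distrib[OF c(1) mult_carrier_mat[OF mult_carrier_mat[OF c(4) cY] c(2)]] by simp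
    finally show ?thesis using rv by (simp add: smult_smult_mat)
  qed
  have s: "distinct (na @ zz)" "set (na @ zz) = {- int m..- 1}"
  proof -
    have "set na = uminus ` {1..int h}" unfolding na_def using a by auto
    also have "\<dots> = {- int h..- 1}" by (auto simp: image_iff)
    finally have sna: "set na = {- int h..- 1}" .
    have szz: "set zz = {- int m..- int h - 1}" using z by (simp add: zz_def)
    show "set (na @ zz) = {- int m..- 1}" using sna szz h by auto
    have "distinct na" unfolding na_def using a by (simp add: distinct_map)
    then show "distinct (na @ zz)" using z(1) sna szz unfolding zz_def[symmetric] by auto
  qed
  have Yf: "Y = fiedlers n m A (na @ zz) - ?mu \<cdot>\<^sub>m fiedler n m A 0"
    by (simp only: Y_def rho_def mh_def F_def)
  obtain U V where UV: "U \<in> proper.GL N" "V \<in> proper.GL N"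
    and UYV: "U * Y * V = dsum (1\<^sub>m (k * n)) (?mu ^ m \<cdot>\<^sub>m mpoly_at n m A rvar)"
    unfolding Yf N_def by (rule reversed_pencil_linearizes[OF Am mk s])
  have cUV: "U \<in> carrier_mat N N" "V \<in> carrier_mat N N" using UV by auto
  have Gval: "mpoly_at n m A rvar = rat_mat (matrix_polynomial n m As) + Phi"
  proof -
    have ca: "const_mat (As i) \<in> carrier_mat n n" if "i \<le> m" for i using As[OF that] by (rule const_mat_carrier)
    have "rat_mat (matrix_polynomial n m As) = mpoly_at n m A0 rvar"
    proof -
      have "matrix_polynomial n m As = mpoly_at n m (\<lambda>i. const_mat (As i)) pvar"
        by (rule matrix_polynomial_mpoly_at) (rule As)
      moreover have "rat_mat (mpoly_at n m (\<lambda>i. const_mat (As i)) pvar) = mpoly_at n m (\<lambda>i. const_rat_mat (As i)) rvar"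
        by (rule rat_mat_mpoly_at) (rule ca)
      ultimately show ?thesis by (simp only: A0_def)
    qed
    moreover have "mpoly_at n m A rvar = mpoly_at n m A0 rvar + Phi"
    proof (rule eq_matI)
      fix i l assume "i < dim_row (mpoly_at n m A0 rvar + Phi)" "l < dim_col (mpoly_at n m A0 rvar + Phi)"
      then have il: "i < n" "l < n" using PhiC by auto
      have "(\<Sum>p\<le>m. rvar ^ p * A p $$ (i, l)) = (\<Sum>p\<le>m. rvar ^ p * A0 p $$ (i, l) + (if p = 0 then Phi $$ (i, l) else 0))"
      proof (rule sum.cong)
        fix p assume "p \<in> {..m}"
        then show "rvar ^ p * A p $$ (i, l) = rvar ^ p * A0 p $$ (i, l) + (if p = 0 then Phi $$ (i, l) else 0)"
          using il A0c[of 0] PhiC by (auto simp: A_def A0_def)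
      qed simp
      also have "\<dots> = (\<Sum>p\<le>m. rvar ^ p * A0 p $$ (i, l)) + Phi $$ (i, l)" by (simp add: sum.distrib)
      finally show "mpoly_at n m A rvar $$ (i, l) = (mpoly_at n m A0 rvar + Phi) $$ (i, l)"
        using il PhiC by (simp add: mpoly_at_def)
    qed (use PhiC in \<open>auto simp: mpoly_at_def\<close>)
    ultimately show ?thesis by simp
  qed
  define Ol Or where "Ol = U * mai * q" and "Or = ei * V"
  have OG: "Ol \<in> proper.GL N" "Or \<in> proper.GL N"
    unfolding Ol_def Or_def using UV GLs by (auto intro!: proper.GL_mult)
  have "Ol * (q * (ma * Y * e)) * Or = U * mai * (q * q) * ma * Y * (e * ei) * V"
    unfolding Ol_def Or_def using c cUV cY by (simp add: as)
  also have "\<dots> = U * (mai * ma) * Y * V"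
    unfolding inv(1,2) using c cUV cY by (simp add: as)
  also have "\<dots> = U * Y * V"
    unfolding inv(5) using cUV cY by (simp add: as)
  finally have "Ol * (?mu \<cdot>\<^sub>m (rat_mat pen + block_both m j Phi)) * Or
      = dsum (1\<^sub>m (k * n)) (?mu ^ m \<cdot>\<^sub>m mpoly_at n m A rvar)"
    unfolding total UYV .
  then show ?thesis
    using that[of Ol Or] OG unfolding Gval N_def by (simp add: mk)
qed

end

section \<open>Assembling the strong linearization\<close>

lemma diagonal_mult_index:
  fixes D :: "'a::semiring_1 mat"
  assumes D: "D \<in> carrier_mat N N" "\<And>p q. p < N \<Longrightarrow> q < N \<Longrightarrow> D $$ (p, q) = (if p = q then d p else 0)"
    and Y: "Y \<in> carrier_mat N r" and pc: "p < N" "c < r"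
  shows "(D * Y) $$ (p, c) = d p * Y $$ (p, c)"
proof -
  have "(D * Y) $$ (p, c) = (\<Sum>k = 0..<N. D $$ (p, k) * Y $$ (k, c))"
    using pc D(1) Y by (simp add: scalar_prod_def)
  also have "\<dots> = (\<Sum>k = 0..<N. if k = p then d p * Y $$ (p, c) else 0)"
    by (rule sum.cong) (use D(2) pc in auto)
  finally show ?thesis using pc by simp
qed

lemma quasi_identity_index:
  assumes "quasi_identity n m eps Q"
  shows "Q \<in> carrier_mat (m * n) (m * n)"
    "\<And>p q. p < m * n \<Longrightarrow> q < m * n \<Longrightarrow> Q $$ (p, q) = (if p = q then eps (p div n + 1) else 0)"
proof -
  let ?D = "\<lambda>m. diag_block_mat (map (\<lambda>i. eps i \<cdot>\<^sub>m 1\<^sub>m n) [1..<m + 1])"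
  have "?D m \<in> carrier_mat (m * n) (m * n) \<and>
      (\<forall>p q. p < m * n \<longrightarrow> q < m * n \<longrightarrow> ?D m $$ (p, q) = (if p = q then eps (p div n + 1) else 0))" for m
  proof (induction m)
    case 0
    then show ?case by simp
  next
    case (Suc m)
    have e: "?D (Suc m) = dsum (?D m) (eps (Suc m) \<cdot>\<^sub>m 1\<^sub>m n)"
    proof -
      have "[1..<Suc m + 1] = [1..<m + 1] @ [Suc m]" by simp
      then have "?D (Suc m) = diag_block_mat (map (\<lambda>i. eps i \<cdot>\<^sub>m 1\<^sub>m n) [1..<m + 1] @ [eps (Suc m) \<cdot>\<^sub>m 1\<^sub>m n])"
        by (simp only: map_append list.map)
      then show ?thesis unfolding diag_block_mat_last Let_def dsum_def .
    qed
    have c: "?D m \<in> carrier_mat (m * n) (m * n)" using Suc by blast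
    have "?D (Suc m) \<in> carrier_mat (m * n + n) (m * n + n)" unfolding e by (rule dsum_carrier[OF c]) simp
    then have 1: "?D (Suc m) \<in> carrier_mat (Suc m * n) (Suc m * n)" by (simp add: add.commute)
    have "?D (Suc m) $$ (p, q) = (if p = q then eps (p div n + 1) else 0)" if pq: "p < Suc m * n" "q < Suc m * n" for p q
    proof -
      have last: "k div n = m" if "m * n \<le> k" "k < Suc m * n" for k
      proof -
        have n: "n > 0" using that by (cases n) auto
        have "m \<le> k div n" using that n by (simp add: less_eq_div_iff_mult_less_eq)
        moreover have "k div n < Suc m" using that by (intro less_mult_imp_div_less)
        ultimately show ?thesis by simp
      qed
      have d: "dim_row (?D m) = m * n" "dim_col (?D m) = m * n" using c by auto
      show ?thesis unfolding e dsum_def using pq d Suc last[of p]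
        by (subst index_mat_four_block) (auto simp: d simp del: upt_Suc)
    qed
    with 1 show ?case by blast
  qed
  then show "Q \<in> carrier_mat (m * n) (m * n)"
    "\<And>p q. p < m * n \<Longrightarrow> q < m * n \<Longrightarrow> Q $$ (p, q) = (if p = q then eps (p div n + 1) else 0)"
    using assms by (simp_all only: quasi_identity_def)
qed

text \<open>Scaling by its own parameter makes the \<open>j\<close>-th diagonal block of \<open>Q\<close> the identity.\<close>

lemma quasi_identity_scaled:
  assumes Q: "quasi_identity n m eps Q" and j: "1 \<le> j" "j \<le> m"
  shows "eps j \<cdot>\<^sub>m Q \<in> carrier_mat (m * n) (m * n)"
    "(eps j \<cdot>\<^sub>m Q) * (eps j \<cdot>\<^sub>m Q) = 1\<^sub>m (m * n)"
    "\<And>C r. C \<in> carrier_mat n r \<Longrightarrow> (eps j \<cdot>\<^sub>m Q) * block_col m j C = block_col m j C"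
proof -
  let ?D = "eps j \<cdot>\<^sub>m Q" and ?N = "m * n"
  note Qi = quasi_identity_index[OF Q]
  have sq: "eps i * eps i = 1" if "1 \<le> i" "i \<le> m" for i
  proof -
    have "eps i \<in> {1, -1}" using Q that unfolding quasi_identity_def by simp
    then show ?thesis by auto
  qed
  have bl: "1 \<le> p div n + 1 \<and> p div n + 1 \<le> m" if "p < ?N" for p
    using less_mult_imp_div_less[of p m n] that by simp
  show c: "?D \<in> carrier_mat ?N ?N" using Qi(1) by simp
  have D: "?D $$ (p, q) = (if p = q then eps j * eps (p div n + 1) else 0)" if "p < ?N" "q < ?N" for p q
    using that Qi by simp
  show "?D * ?D = 1\<^sub>m ?N"
  proof (rule eq_matI)
    fix p q assume "p < dim_row (1\<^sub>m ?N :: complex mat)" "q < dim_col (1\<^sub>m ?N :: complex mat)"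
    then have pq: "p < ?N" "q < ?N" by auto
    have "(?D * ?D) $$ (p, q) = eps j * eps (p div n + 1) * ?D $$ (p, q)"
      by (rule diagonal_mult_index[OF c D c pq])
    also have "\<dots> = (if p = q then (eps j * eps j) * (eps (p div n + 1) * eps (p div n + 1)) else 0)"
      unfolding D[OF pq] by (simp only: mult_ac) simp
    also have "\<dots> = 1\<^sub>m ?N $$ (p, q)"
      unfolding sq[OF j] using sq[OF conjunct1 conjunct2, OF bl bl, OF pq(1) pq(1)] pq by auto
    finally show "(?D * ?D) $$ (p, q) = 1\<^sub>m ?N $$ (p, q)" .
  qed (use c in auto)
  show "?D * block_col m j C = block_col m j C" if C: "C \<in> carrier_mat n r" for C r
  proof (rule eq_matI)
    have cb: "block_col m j C \<in> carrier_mat ?N r" using C by (rule block_col_carrier)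
    fix p c' assume "p < dim_row (block_col m j C)" "c' < dim_col (block_col m j C)"
    then have pc: "p < ?N" "c' < r" using cb by auto
    have "(?D * block_col m j C) $$ (p, c') = eps j * eps (p div n + 1) * block_col m j C $$ (p, c')"
      by (rule diagonal_mult_index[OF c D cb pc])
    also have "\<dots> = block_col m j C $$ (p, c')"
    proof (cases "p div n = j - 1")
      case True
      then have "p div n + 1 = j" using j by simp
      then show ?thesis using sq[OF j] by simp
    next
      case False
      then show ?thesis using block_col_index[OF C pc, of j] by simp
    qed
    finally show "(?D * block_col m j C) $$ (p, c') = block_col m j C $$ (p, c')" .
  qed (use c C block_col_carrier[OF C, of m j] in auto)
qed

text \<open>All factors are invertible except those of index \<open>0\<close> and \<open>-m\<close>; the latter is as soon as \<open>A\<^sub>m\<close> is.\<close>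

lemma fiedlers_GL:
  fixes A :: "nat \<Rightarrow> complex mat"
  assumes A: "\<And>i. i \<le> m \<Longrightarrow> A i \<in> carrier_mat n n" and m: "0 < m"
    and t: "\<And>i. i \<in> set t \<Longrightarrow> (i \<noteq> 0 \<and> \<bar>i\<bar> < int m) \<or> (i = - int m \<and> invertible_mat (A m))"
  shows "fiedlers n m A t \<in> all_scalars.GL (m * n)"
  using t
proof (induction t)
  case Nil
  then show ?case by (simp add: fiedlers_def)
next
  case (Cons i t)
  have "fiedler n m A i \<in> all_scalars.GL (m * n)"
  proof (cases "i = - int m")
    case False
    then have i: "i \<noteq> 0" "\<bar>i\<bar> < int m" using Cons.prems[of i] by auto
    have c: "fiedler n m A i \<in> carrier_mat (m * n) (m * n)" "fiedler n m A (- i) \<in> carrier_mat (m * n) (m * n)"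
      using A i by (intro fiedler_carrier; auto)+
    have "fiedler n m A i * fiedler n m A (- i) = 1\<^sub>m (m * n)"
      by (rule fiedler_inverse) (use A i in auto)
    moreover have "fiedler n m A (- i) * fiedler n m A i = 1\<^sub>m (m * n)"
      using fiedler_inverse[of m A n "- i"] A i by simp
    ultimately show ?thesis
      using c by (intro all_scalars.GL_I[of _ _ "fiedler n m A (- i)"]) (auto simp: all_scalars.mats_def)
  next
    case True
    then have inv: "invertible_mat (A m)" using Cons.prems[of i] by auto
    have Am: "A m \<in> carrier_mat n n" using A by simp
    obtain B where B: "A m * B = 1\<^sub>m n" "B * A m = 1\<^sub>m (dim_row B)"
      using inv Am by (auto simp: invertible_mat_def inverts_mat_def)
    have "dim_col (A m * B) = n" "dim_col (B * A m) = dim_row B" using B by simp_all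
    then have Bc: "B \<in> carrier_mat n n" using Am by (intro carrier_matI) auto
    have "A m \<in> all_scalars.GL n"
      using Am Bc B by (intro all_scalars.GL_I[of _ _ B]) (auto simp: all_scalars.mats_def)
    then have "dsum (A m) (1\<^sub>m ((m - 1) * n)) \<in> all_scalars.GL (n + (m - 1) * n)"
      by (rule all_scalars.GL_dsum) simp
    moreover have "n + (m - 1) * n = m * n" using m by (cases m) auto
    ultimately show ?thesis using True m by (simp add: fiedler_def)
  qed
  then show ?case using Cons by (auto simp: fiedlers_def intro: all_scalars.GL_mult)
qed

lemma block_col_last_index:
  assumes "X \<in> carrier_mat n r" "p < k * n + n" "c < r"
  shows "block_col (Suc k) (Suc k) X $$ (p, c) = (if p < k * n then 0 else X $$ (p - k * n, c))"
proof (cases "p < k * n")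
  case True
  then have "p div n < k" by (rule less_mult_imp_div_less)
  then show ?thesis using True assms by (subst block_col_index[of _ n r]) auto
next
  case False
  then obtain q where q: "p = (Suc k - 1) * n + q" by (metis diff_Suc_1 le_iff_add not_le)
  then have "q < n" using assms by simp
  then show ?thesis using False block_col_entry[OF assms(1), of "Suc k" "Suc k" q c] assms q by simp
qed

lemma block_row_last_index:
  assumes "X \<in> carrier_mat r n" "p < k * n + n" "c < r"
  shows "block_row (Suc k) (Suc k) X $$ (c, p) = (if p < k * n then 0 else X $$ (c, p - k * n))"
proof -
  have t: "transpose_mat X \<in> carrier_mat n r" using assms by simp
  have "block_col (Suc k) (Suc k) (transpose_mat X) \<in> carrier_mat (Suc k * n) r" using t by (rule block_col_carrier)
  then have "block_row (Suc k) (Suc k) X $$ (c, p) = block_col (Suc k) (Suc k) (transpose_mat X) $$ (p, c)"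
    using assms by (simp add: block_row_transpose)
  then show ?thesis using block_col_last_index[OF t assms(2,3)] assms by auto
qed

text \<open>Borders in the last position only meet the last diagonal block.\<close>

lemma four_block_dsum_one:
  assumes "P \<in> carrier_mat n n" "C \<in> carrier_mat n r" "B \<in> carrier_mat r n" "D \<in> carrier_mat r r"
  shows "four_block_mat (dsum (1\<^sub>m (k * n)) P) (block_col (Suc k) (Suc k) C) (block_row (Suc k) (Suc k) B) D
    = dsum (1\<^sub>m (k * n)) (four_block_mat P C B D)"
proof (rule eq_matI)
  fix p q assume "p < dim_row (dsum (1\<^sub>m (k * n)) (four_block_mat P C B D))"
    "q < dim_col (dsum (1\<^sub>m (k * n)) (four_block_mat P C B D))"
  then have pq: "p < k * n + (n + r)" "q < k * n + (n + r)" using assms by auto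
  show "four_block_mat (dsum (1\<^sub>m (k * n)) P) (block_col (Suc k) (Suc k) C) (block_row (Suc k) (Suc k) B) D $$ (p, q)
    = dsum (1\<^sub>m (k * n)) (four_block_mat P C B D) $$ (p, q)"
    using pq assms block_col_last_index[OF assms(2), of p k "q - (k * n + n)"]
      block_row_last_index[OF assms(3), of q k "p - (k * n + n)"]
    by (auto simp: dsum_def)
qed (use assms in auto)

context structured_pencil
begin

lemma pen_is_pencil:
  obtains X Y where "X \<in> carrier_mat (m * n) (m * n)" "Y \<in> carrier_mat (m * n) (m * n)" "pen = pencil X Y"
proof -
  define N where "N = m * n"
  define fz fw where "fz = fiedlers n m As (z1 @ - int m # z2)" and "fw = fiedlers n m As (a @ [0])"
  have f: "fz \<in> carrier_mat N N" "fw \<in> carrier_mat N N"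
  proof -
    have "- int m \<le> i \<and> i < int m" if "i \<in> set (z1 @ - int m # z2)" for i
      using that m unfolding z(2) by auto
    then show "fz \<in> carrier_mat N N" unfolding fz_def N_def using As by (intro fiedlers_carrier) auto
    have "- int m \<le> i \<and> i < int m" if "i \<in> set (a @ [0])" for i using that a h by auto
    then show "fw \<in> carrier_mat N N" unfolding fw_def N_def using As by (intro fiedlers_carrier) auto
  qed
  have c: "Qs \<in> carrier_mat N N" "E \<in> carrier_mat N N" using Qs E by (auto simp: N_def)
  define x y where "x = Qs * (fw * E)" and "y = Qs * (fz * E)"
  have xy: "x \<in> carrier_mat N N" "y \<in> carrier_mat N N"
    unfolding x_def y_def using c f by (auto intro!: mult_carrier_mat[of _ N N _ N])
  let ?c = const_mat
  have cc: "?c Qs \<in> carrier_mat N N" "?c E \<in> carrier_mat N N" "?c fz \<in> carrier_mat N N" "?c fw \<in> carrier_mat N N"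
    using c f by (auto intro: const_mat_carrier)
  have "pen = ?c Qs * ((pvar \<cdot>\<^sub>m ?c fz - ?c fw) * ?c E)"
    unfolding pen_def fz_def fw_def ..
  also have "(pvar \<cdot>\<^sub>m ?c fz - ?c fw) * ?c E = pvar \<cdot>\<^sub>m ?c (fz * E) - ?c (fw * E)"
    using minus_mult_distrib_mat[OF smult_carrier_mat[OF cc(3)] cc(4,2), of pvar] mult_smult_assoc_mat[OF cc(3,2), of pvar]
      const_mat_mult[OF f(1) c(2)] const_mat_mult[OF f(2) c(2)] by simp
  also have "?c Qs * \<dots> = pvar \<cdot>\<^sub>m ?c y - ?c x"
    unfolding x_def y_def
    using mult_minus_distrib_mat[OF cc(1) smult_carrier_mat[OF const_mat_carrier[OF mult_carrier_mat[OF f(1) c(2)]]] const_mat_carrier[OF mult_carrier_mat[OF f(2) c(2)]], of pvar]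
      mult_smult_distrib[OF cc(1) const_mat_carrier[OF mult_carrier_mat[OF f(1) c(2)]], of pvar]
      const_mat_mult[OF c(1) mult_carrier_mat[OF f(1) c(2)]] const_mat_mult[OF c(1) mult_carrier_mat[OF f(2) c(2)]] by simp
  also have "\<dots> = pencil (- x) (- y)"
    unfolding pencil_def using xy by (intro eq_matI) (auto simp: const_mat_def)
  finally have "pen = pencil (- x) (- y)" .
  then show ?thesis using that[of "- x" "- y"] xy by (simp add: N_def)
qed

text \<open>The unimodular equivalence leaves the state block alone, so the constant factors \<open>U\<^sub>0\<close> and \<open>V\<^sub>0\<close> are identities.\<close>

theorem rosenbrock:
  assumes j: "1 \<le> j" "j \<le> m"
    and ham: "hamiltonian_realization n l G P A B C" and min: "minimal_realization n (2 * l) G P A B C"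
    and P: "P = matrix_polynomial n m As"
  shows "rosenbrock_strong_linearization n m (2 * l) (system_matrix P C B A (1\<^sub>m (2 * l))) G
    (system_matrix pen (block_col m j C) (block_row m j B) A (1\<^sub>m (2 * l)))"
proof -
  let ?r = "2 * l"
  define N where "N = m * n"
  obtain k where mk: "m = Suc k" using m by (cases m) auto
  have c: "P \<in> carrier_mat n n" "A \<in> carrier_mat ?r ?r" "B \<in> carrier_mat ?r n" "C \<in> carrier_mat n ?r"
    and G: "G = transfer_function P C (1\<^sub>m ?r) A B"
    using ham by (auto simp: hamiltonian_realization_def realization_def)
  define CC BB where "CC = block_col m j C" and "BB = block_row m j B"
  have cc: "CC \<in> carrier_mat N ?r" "BB \<in> carrier_mat ?r N"
    unfolding CC_def BB_def N_def using c by (auto intro: block_col_carrier block_row_carrier)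
  obtain X Y where XY: "X \<in> carrier_mat N N" "Y \<in> carrier_mat N N" "pen = pencil X Y"
    using pen_is_pencil unfolding N_def by metis
  have pc: "pen \<in> carrier_mat N N"
    unfolding XY(3) pencil_def by (rule minus_carrier_mat[OF smult_carrier_mat[OF const_mat_carrier[OF XY(2)]]])
  define D where "D = pencil A (1\<^sub>m ?r)"
  have D: "D \<in> carrier_mat ?r ?r" unfolding D_def pencil_one by (intro minus_carrier_mat) simp
  obtain U V where UV: "U \<in> all_scalars.GL N" "V \<in> all_scalars.GL N"
    "U * pen * V = dsum (1\<^sub>m ((m - 1) * n)) P"
    "U * const_mat CC = const_mat (block_col m m C)" "const_mat BB * V = const_mat (block_row m m B)"
    using unimodular_equivalence[OF c(4,3)] unfolding N_def P CC_def BB_def by metis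
  have cUV: "U \<in> carrier_mat N N" "V \<in> carrier_mat N N" using UV by auto
  have ccc: "const_mat CC \<in> carrier_mat N ?r" "const_mat BB \<in> carrier_mat ?r N" using cc by (auto intro: const_mat_carrier)
  have "diag_block_mat [U, const_mat (1\<^sub>m ?r)] * system_matrix pen CC BB A (1\<^sub>m ?r) * diag_block_mat [V, const_mat (1\<^sub>m ?r)]
      = dsum U (1\<^sub>m ?r) * four_block_mat pen (const_mat CC) (const_mat BB) D * dsum V (1\<^sub>m ?r)"
    unfolding dsum_diag_block const_mat_one system_matrix_def D_def ..
  also have "dsum U (1\<^sub>m ?r) * four_block_mat pen (const_mat CC) (const_mat BB) D
      = four_block_mat (U * pen) (U * const_mat CC) (const_mat BB) D"
    unfolding dsum_def using cUV pc ccc D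
    by (subst mult_four_block_mat[of _ N N _ ?r _ ?r _ _ N _ ?r]) auto
  also have "\<dots> * dsum V (1\<^sub>m ?r) = four_block_mat (U * pen * V) (U * const_mat CC) (const_mat BB * V) D"
    unfolding dsum_def using cUV mult_carrier_mat[OF cUV(1) pc] mult_carrier_mat[OF cUV(1) ccc(1)] ccc D
      right_mult_zero_mat[OF mult_carrier_mat[OF cUV(1) pc]] right_mult_zero_mat[OF mult_carrier_mat[OF cUV(1) ccc(1)]]
      right_mult_one_mat[OF mult_carrier_mat[OF cUV(1) ccc(1)]]
    by (subst mult_four_block_mat[of _ N N _ ?r _ ?r _ _ N _ ?r]) (auto simp del: assoc_mult_mat)
  also have "\<dots> = four_block_mat (dsum (1\<^sub>m (k * n)) P) (block_col (Suc k) (Suc k) (const_mat C)) (block_row (Suc k) (Suc k) (const_mat B)) D"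
  proof -
    have "const_mat (block_col m m C) = block_col (Suc k) (Suc k) (const_mat C)"
      unfolding const_mat_def mk by (rule comm_ring_hom.map_block_col[OF const_hom.comm_ring_hom_axioms c(4)])
    moreover have "const_mat (block_row m m B) = block_row (Suc k) (Suc k) (const_mat B)"
      unfolding const_mat_def mk by (rule comm_ring_hom.map_block_row[OF const_hom.comm_ring_hom_axioms c(3)])
    moreover have "(m - 1) * n = k * n" by (simp add: mk)
    ultimately show ?thesis by (simp only: UV(3-5))
  qed
  also have "\<dots> = dsum (1\<^sub>m (k * n)) (four_block_mat P (const_mat C) (const_mat B) D)"
    by (rule four_block_dsum_one) (use c D in \<open>auto intro: const_mat_carrier\<close>)
  also have "\<dots> = diag_block_mat [1\<^sub>m ((m - 1) * n), system_matrix P C B A (1\<^sub>m ?r)]"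
    unfolding dsum_diag_block system_matrix_def D_def mk by simp
  finally have uni: "diag_block_mat [U, const_mat (1\<^sub>m ?r)] * system_matrix pen CC BB A (1\<^sub>m ?r) * diag_block_mat [V, const_mat (1\<^sub>m ?r)]
      = diag_block_mat [1\<^sub>m ((m - 1) * n), system_matrix P C B A (1\<^sub>m ?r)]" .
  have real: "realization n ?r G P A B C" using ham by (simp add: hamiltonian_realization_def)
  obtain Phi where Phi: "Phi \<in> proper.mats n n" and GP: "G = rat_mat P + Phi"
    and TT: "transfer_function pen CC (1\<^sub>m ?r) A BB = rat_mat pen + block_both m j Phi"
    unfolding CC_def BB_def using transfer_function_split[OF real] by metis
  obtain Ol Or where O: "Ol \<in> proper.GL N" "Or \<in> proper.GL N"
    "Ol * (inverse rvar \<cdot>\<^sub>m (rat_mat pen + block_both m j Phi)) * Or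
      = dsum (1\<^sub>m ((m - 1) * n)) (inverse rvar ^ m \<cdot>\<^sub>m (rat_mat P + Phi))"
    using equivalence_at_infinity[OF Phi] unfolding N_def P by metis
  have inv1: "invertible_mat (1\<^sub>m ?r :: complex mat)"
    by (auto simp: invertible_mat_def inverts_mat_def intro!: exI[of _ "1\<^sub>m ?r"])
  have irr: "irreducible_system (m * n) ?r CC BB A (1\<^sub>m ?r)"
    unfolding CC_def BB_def by (rule irreducible_block_system[OF min ham j])
  have part_uni: "\<exists>U V U\<^sub>0 V\<^sub>0.
      unimodular (m * n) U \<and> unimodular (m * n) V \<and>
      U\<^sub>0 \<in> carrier_mat ?r ?r \<and> invertible_mat U\<^sub>0 \<and> V\<^sub>0 \<in> carrier_mat ?r ?r \<and> invertible_mat V\<^sub>0 \<and>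
      diag_block_mat [U, const_mat U\<^sub>0] * system_matrix pen CC BB A (1\<^sub>m ?r) * diag_block_mat [V, const_mat V\<^sub>0]
        = diag_block_mat [1\<^sub>m ((m - 1) * n), system_matrix P C B A (1\<^sub>m ?r)]"
    using uni inv1 all_GL_unimodular[OF UV(1)] all_GL_unimodular[OF UV(2)] one_carrier_mat[of ?r]
    unfolding N_def by blast
  have part_inf: "\<exists>Ol Or. biproper (m * n) Ol \<and> biproper (m * n) Or \<and>
      Ol * (inverse rvar \<cdot>\<^sub>m transfer_function pen CC (1\<^sub>m ?r) A BB) * Or
        = diag_block_mat [1\<^sub>m ((m - 1) * n), inverse rvar ^ m \<cdot>\<^sub>m G]"
    unfolding TT GP dsum_diag_block using O proper_GL_biproper unfolding N_def by blast
  show ?thesis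
    unfolding rosenbrock_strong_linearization_def CC_def[symmetric] BB_def[symmetric]
  proof (rule exI[of _ X], rule exI[of _ Y], rule exI[of _ CC], rule exI[of _ BB], rule exI[of _ A],
      rule exI[of _ "1\<^sub>m ?r"], intro conjI)
    show "X \<in> carrier_mat (m * n) (m * n)" "Y \<in> carrier_mat (m * n) (m * n)"
      "CC \<in> carrier_mat (m * n) ?r" "BB \<in> carrier_mat ?r (m * n)"
      using XY(1,2) cc by (simp_all only: N_def)
    show "A \<in> carrier_mat ?r ?r" "1\<^sub>m ?r \<in> carrier_mat ?r ?r" "invertible_mat (1\<^sub>m ?r :: complex mat)"
      using c(2) inv1 by simp_all
    show "system_matrix pen CC BB A (1\<^sub>m ?r) = system_matrix (pencil X Y) CC BB A (1\<^sub>m ?r)"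
      unfolding XY(3) ..
  qed (fact irr, fact part_uni, fact part_inf[unfolded XY(3)])
qed

text \<open>The summand \<open>\<Phi> = G - P\<close> is even, and a diagonal block stays in its place under transposition.\<close>

theorem even_transfer:
  assumes ham: "hamiltonian_realization n l G P A B C" and G: "even_rat_mat G" and pen: "even_poly_mat pen"
  shows "even_rat_mat (transfer_function pen (block_col m j C) (1\<^sub>m (2 * l)) A (block_row m j B))"
proof -
  let ?r = "2 * l"
  have real: "realization n ?r G P A B C" and Pe: "even_poly_mat P" and c: "P \<in> carrier_mat n n"
    using ham by (auto simp: hamiltonian_realization_def realization_def)
  obtain Phi where PhiR: "Phi \<in> proper.mats n n" and GP: "G = rat_mat P + Phi"
    and TT: "transfer_function pen (block_col m j C) (1\<^sub>m ?r) A (block_row m j B) = rat_mat pen + block_both m j Phi"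
    using transfer_function_split[OF real] by metis
  have Phi: "Phi \<in> carrier_mat n n" using PhiR by auto
  obtain X Y where XY: "X \<in> carrier_mat (m * n) (m * n)" "Y \<in> carrier_mat (m * n) (m * n)" "pen = pencil X Y"
    by (rule pen_is_pencil)
  have pc: "pen \<in> carrier_mat (m * n) (m * n)"
    unfolding XY(3) pencil_def by (rule minus_carrier_mat[OF smult_carrier_mat[OF const_mat_carrier[OF XY(2)]]])
  show ?thesis
    unfolding TT by (rule even_rat_mat_add_block[OF pc pen c Pe Phi]) (use G GP in simp)
qed

end

theorem theorem4p24:
  fixes n m l h pw pz :: nat
    and As :: "nat \<Rightarrow> complex mat"
    and A B C Q CC BB :: "complex mat"
    and P S L X T :: "complex poly mat"
    and G :: "complex poly fract mat"
    and w cw z cz :: "int list"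
    and eps :: "nat \<Rightarrow> complex"
    and s :: complex
  assumes "m \<ge> 1"
    and "\<And>i. i \<le> m \<Longrightarrow> As i \<in> carrier_mat n n"
    and "As m \<noteq> 0\<^sub>m n n"
    and P_def: "P = matrix_polynomial n m As"
    and "G \<in> carrier_mat n n"
    and "even_rat_mat G"
    and C_def: "C = transpose_mat B * transpose_mat (J_mat l)"
    and "hamiltonian_realization n l G P A B C"
    and "minimal_realization n (2 * l) G P A B C"
    and S_def: "S = system_matrix P C B A (1\<^sub>m (2 * l))"
    and "h \<le> m - 1" and "even h"
    and "simple_admissible_tuple h pw w"
    and "cw = symmetric_complement h pw"
    and "admissible_tuple (m - h - 1) pz (map (\<lambda>i. i + int m) z)"
    and "map (\<lambda>i. i + int m) cz = symmetric_complement (m - h - 1) pz"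
    and L_def: "L = (pvar \<cdot>\<^sub>m const_mat (fiedler_prod n m As z) - const_mat (fiedler_prod n m As w))
                 * const_mat (fiedler_prod n m As cw) * const_mat (fiedler_prod n m As cz)"
    and "quasi_identity n m eps Q"
    and "even_poly_mat (const_mat Q * L)"
    and s_def: "s = eps (m - i0 w)"
    and "\<not> invertible_mat (As m) \<Longrightarrow> pz = 0"
    and X_def: "X = [:s:] \<cdot>\<^sub>m (const_mat Q * L)"
    and CC_def: "CC = kronecker (e_col m (m - i0 w)) C"
    and BB_def: "BB = kronecker (transpose_mat (e_col m (m - i0 w))) B"
    and T_def: "T = system_matrix X CC BB A (1\<^sub>m (2 * l))"
  shows "hamiltonian_system_matrix (m * n) l T \<and>
         rosenbrock_strong_linearization n m (2 * l) S G T \<and>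
         even_rat_mat (transfer_function X CC (1\<^sub>m (2 * l)) A BB)"
proof -
  have m: "0 < m" and hm: "h < m" using assms(1,11) by auto
  have As: "\<And>i. i \<le> m \<Longrightarrow> As i \<in> carrier_mat n n" by fact
  obtain a where pw: "pw = 0" and w: "w = a @ [0]" and a: "distinct a" "set a = {1..int h}"
    and a': "h = 0 \<or> (\<exists>a'. a = a' @ [1, 2] \<and> set a' = {3..int h})"
    using simple_even_tuple[OF assms(13,12)] by metis
  define j where "j = m - i0 w"
  \<comment> \<open>For \<open>h = 0\<close> the tuple \<open>w\<close> is \<open>(0)\<close>; otherwise it ends with \<open>(1, 2, 0)\<close>.\<close>
  have hj: "(h = 0 \<and> a = [] \<and> j = m) \<or> (2 \<le> h \<and> j = m - 1)"
  proof (cases "h = 0")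
    case True
    then have "a = []" using a(2) by simp
    then show ?thesis using True w i0_zero by (simp add: j_def)
  next
    case False
    then obtain a'' where "a = a'' @ [1, 2]" "set a'' = {3..int h}" using a' by blast
    then have "i0 w = 1" unfolding w using i0_simple_even a(1) by blast
    moreover have "2 \<le> h" using False assms(12) by (cases h; cases "h - 1") auto
    ultimately show ?thesis by (simp add: j_def)
  qed
  have j: "1 \<le> j" "j \<le> m" using hj m hm by auto
  have zs: "distinct z" "set z = {- int m .. - int h - 1}"
  proof -
    have "distinct (map (\<lambda>i. i + int m) z)" and s: "(\<lambda>i. i + int m) ` set z = {0..int (m - h - 1)}"
      using admissible_tuple_elements[OF assms(15)] by simp_all
    then show "distinct z" by (simp add: distinct_map)
    have "set z = (\<lambda>i. i - int m) ` (\<lambda>i. i + int m) ` set z" by (simp add: image_image)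
    also have "\<dots> = {- int m .. - int h - 1}"
      unfolding s using hm by (auto simp: image_iff intro!: bexI[of _ "_ + int m"])
    finally show "set z = {- int m .. - int h - 1}" .
  qed
  have "- int m \<in> set z" unfolding zs(2) using hm by simp
  then obtain z1 z2 where z: "z = z1 @ - int m # z2" by (meson split_list)
  have pz: "pz \<le> m - h - 1" "even (m - h - 1 - pz)" using assms(15) by (auto simp: admissible_tuple_def)
  have cz: "- int m \<le> i \<and> i < - int h - 1 \<and> (pz = 0 \<longrightarrow> - int m < i)" if "i \<in> set cz" for i
  proof -
    have "i + int m \<in> set (map (\<lambda>i. i + int m) cz)" using that by simp
    then have "i + int m \<in> set (symmetric_complement (m - h - 1) pz)" unfolding assms(16) .
    from symmetric_complement_elements[OF this pz] show ?thesis using hm by auto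
  qed
  have cw: "cw = symmetric_complement h 0" using assms(14) pw by simp
  have cwr: "0 < i \<and> i < int h" if "i \<in> set cw" for i
    using symmetric_complement_elements[of i h 0] that assms(12) by (auto simp: cw)
  define E where "E = fiedlers n m As cw * fiedlers n m As cz"
  define Qs where "Qs = s \<cdot>\<^sub>m Q"
  have s: "s = eps j" by (simp add: s_def j_def)
  note Qsc = quasi_identity_scaled[OF assms(18) j, folded s, folded Qs_def]
  have czz: "(i \<noteq> 0 \<and> \<bar>i\<bar> < int m) \<or> (i = - int m \<and> invertible_mat (As m))" if "i \<in> set cz" for i
  proof (cases "pz = 0")
    case True
    then show ?thesis using cz[OF that] by auto
  next
    case False
    then have "invertible_mat (As m)" using assms(21) by blast
    then show ?thesis using cz[OF that] by auto
  qed
  have EGL: "E \<in> all_scalars.GL (m * n)"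
    unfolding E_def using As m cwr czz hm by (intro all_scalars.GL_mult fiedlers_GL) force+
  interpret S: structured_pencil n m h j As a z1 z2 E Qs
  proof
    show "0 < m" "h < m" by fact+
    show "distinct a" "set a = {1..int h}" by fact+
    show "distinct (z1 @ - int m # z2)" "set (z1 @ - int m # z2) = {- int m .. - int h - 1}"
      using zs unfolding z by simp_all
    show "E \<in> all_scalars.GL (m * n)" by fact
    show "Qs \<in> carrier_mat (m * n) (m * n)" "Qs * Qs = 1\<^sub>m (m * n)"
      by (simp_all only: Qsc(1,2))
    show "\<And>i. i \<le> m \<Longrightarrow> As i \<in> carrier_mat n n" by fact
    show "Qs * block_col m j C = block_col m j C" if "C \<in> carrier_mat n r" for C r
      using Qsc(3)[OF that] .
    show "fiedlers n m As a * block_col m m C = block_col m j C" if C: "C \<in> carrier_mat n r" for C r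
    proof (cases "h = 0")
      case True
      then show ?thesis using hj block_col_carrier[OF C, of m m] by (auto simp: fiedlers_def)
    next
      case False
      then have h2: "2 \<le> h" "j = m - 1" using hj by auto
      obtain b where b: "a = b @ [1, 2]" "set b = {3..int h}" using a' False by blast
      have cb: "fiedlers n m As b \<in> carrier_mat (m * n) (m * n)"
        using As b hm by (intro fiedlers_carrier) auto
      have c12: "fiedler n m As 1 \<in> carrier_mat (m * n) (m * n)" "fiedler n m As 2 \<in> carrier_mat (m * n) (m * n)"
        using As h2 hm by (intro fiedler_carrier; auto)+
      have cc: "block_col m m C \<in> carrier_mat (m * n) r" using C by (rule block_col_carrier)
      have "fiedlers n m As a = fiedlers n m As b * fiedlers n m As [1, 2]"
        unfolding b(1) by (rule fiedlers_append) (use As b h2 hm in auto)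
      also have "fiedlers n m As [1, 2] = fiedler n m As 1 * fiedler n m As 2"
        using c12 by (simp add: fiedlers_def)
      finally have "fiedlers n m As a * block_col m m C
          = fiedlers n m As b * (fiedler n m As 1 * (fiedler n m As 2 * block_col m m C))"
        using cb c12 cc by (simp add: assoc_mult_mat[of _ "m * n" "m * n" _ "m * n" _ r] mult_carrier_mat[of _ "m * n" "m * n" _ r] mult_carrier_mat[of _ "m * n" "m * n" _ "m * n"])
      also have "fiedler n m As 2 * block_col m m C = block_col m m C"
        by (rule fiedler_block_col) (use As C h2 hm in auto)
      also have "fiedler n m As 1 * block_col m m C = block_col m (m - 1) C"
        by (rule fiedler_one_block_col) (use As C h2 hm in auto)
      also have "fiedlers n m As b * block_col m (m - 1) C = block_col m (m - 1) C"
        by (rule fiedlers_block_col) (use As C h2 hm b in auto)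
      finally show ?thesis using h2 by simp
    qed
    show "block_row m m B * E = block_row m j B" if B: "B \<in> carrier_mat r n" for B r
    proof -
      have ccw: "fiedlers n m As cw \<in> carrier_mat (m * n) (m * n)"
        using As cwr hm by (intro fiedlers_carrier) force+
      have ccz: "fiedlers n m As cz \<in> carrier_mat (m * n) (m * n)"
        using As cz by (intro fiedlers_carrier) force+
      have cb: "block_row m i B \<in> carrier_mat r (m * n)" for i using B by (rule block_row_carrier)
      have 1: "block_row m m B * fiedlers n m As cw = block_row m j B"
      proof (cases "h = 0")
        case True
        then have "cw = []" by (simp add: cw symmetric_complement_def rev_c_def)
        then show ?thesis using True hj cb[of m] by (auto simp: fiedlers_def)
      next
        case False
        then have h2: "2 \<le> h" "j = m - 1" using hj by auto
        obtain d where d: "symmetric_complement h 0 = d @ [1]" "set d \<subseteq> {3..<int h}"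
          using symmetric_complement_even[OF assms(12) False] .
        have cd: "fiedlers n m As d \<in> carrier_mat (m * n) (m * n)"
          using As d hm by (intro fiedlers_carrier) force+
        have c1: "fiedler n m As 1 \<in> carrier_mat (m * n) (m * n)"
          using As h2 hm by (intro fiedler_carrier) auto
        have "fiedlers n m As cw = fiedlers n m As d * fiedlers n m As [1]"
          unfolding cw d(1) by (rule fiedlers_append) (use As d h2 hm in force)+
        also have "fiedlers n m As [1] = fiedler n m As 1" using c1 by (simp add: fiedlers_def)
        finally have "block_row m m B * fiedlers n m As cw = block_row m m B * fiedlers n m As d * fiedler n m As 1"
          using cd c1 cb[of m] by simp
        also have "block_row m m B * fiedlers n m As d = block_row m m B"
          by (rule fiedlers_block_row) (use As B m d hm in force)+
        also have "block_row m m B * fiedler n m As 1 = block_row m (m - 1) B"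
          by (rule fiedler_one_block_row) (use As B h2 hm in auto)
        finally show ?thesis using h2 by simp
      qed
      have 2: "block_row m j B * fiedlers n m As cz = block_row m j B"
      proof (rule fiedlers_block_row[OF As B j])
        fix i assume "i \<in> set cz"
        from cz[OF this] hj m hm show "i \<noteq> 0 \<and> - int m \<le> i \<and> i < int m \<and> int m - \<bar>i\<bar> + 1 < int j"
          by auto
      qed
      have "block_row m m B * E = block_row m m B * fiedlers n m As cw * fiedlers n m As cz"
        unfolding E_def by (rule assoc_mult_mat[symmetric, OF cb ccw ccz])
      then show ?thesis using 1 2 by simp
    qed
  qed
  have Xpen: "X = S.pen"
  proof -
    define N where "N = m * n"
    define f where "f = pvar \<cdot>\<^sub>m const_mat (fiedlers n m As z) - const_mat (fiedlers n m As w)"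
    have Qc: "Q \<in> carrier_mat N N" using quasi_identity_index(1)[OF assms(18)] by (simp add: N_def)
    have cs: "fiedlers n m As cw \<in> carrier_mat N N" "fiedlers n m As cz \<in> carrier_mat N N" "fiedlers n m As w \<in> carrier_mat N N"
      unfolding N_def using As cwr cz w a hm by (intro fiedlers_carrier; force)+
    have f: "f \<in> carrier_mat N N" unfolding f_def by (rule minus_carrier_mat[OF const_mat_carrier[OF cs(3)]])
    have ccs: "const_mat (fiedlers n m As cw) \<in> carrier_mat N N" "const_mat (fiedlers n m As cz) \<in> carrier_mat N N" "const_mat Q \<in> carrier_mat N N"
      using cs Qc by (auto intro: const_mat_carrier)
    have "L = f * const_mat E"
      unfolding L_def fiedler_prod_eq f_def[symmetric] E_def const_mat_mult[OF cs(1,2)]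
      by (rule assoc_mult_mat[OF f ccs(1,2)])
    moreover have "const_mat Qs = [:s:] \<cdot>\<^sub>m const_mat Q"
      unfolding Qs_def by (rule eq_matI) (auto simp: const_mat_def)
    moreover have "f * const_mat E \<in> carrier_mat N N"
      using f const_mat_carrier[of E N N] EGL by (auto simp: N_def intro!: mult_carrier_mat[of _ "m * n" "m * n"])
    ultimately have "X = const_mat Qs * (f * const_mat E)"
      unfolding X_def using mult_smult_assoc_mat[OF ccs(3), of "f * const_mat E" N "[:s:]"] by simp
    then show ?thesis unfolding S.pen_def f_def z w .
  qed
  have Xeven: "even_poly_mat X"
  proof -
    define M where "M = const_mat Q * L"
    have M: "transpose_mat (map_mat poly_reflect M) = M" using assms(19) by (simp add: M_def even_poly_mat_def)
    have d: "dim_row M = dim_col M" using arg_cong[OF M, of dim_row] by simp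
    have "poly_reflect (M $$ (q, p)) = M $$ (p, q)" if "p < dim_row M" "q < dim_col M" for p q
      using arg_cong[OF M, of "\<lambda>Y. Y $$ (p, q)"] that d by simp
    then show ?thesis
      unfolding X_def M_def[symmetric] even_poly_mat_def
      using d by (intro eq_matI) (auto simp: poly_reflect_smult poly_reflect_smult')
  qed
  have CB: "CC = block_col m j C" "BB = block_row m j B"
    unfolding CC_def BB_def block_col_def block_row_def j_def by simp_all
  have ham: "hamiltonian_realization n l G P A B C" and min: "minimal_realization n (2 * l) G P A B C" by fact+
  have c: "B \<in> carrier_mat (2 * l) n" "C \<in> carrier_mat n (2 * l)" and hA: "hamiltonian_mat l A"
    and JB: "J_mat l * B = transpose_mat C"
    using ham by (auto simp: hamiltonian_realization_def realization_def)
  have Xc: "X \<in> carrier_mat (m * n) (m * n)"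
  proof -
    obtain X' Y' where XY: "X' \<in> carrier_mat (m * n) (m * n)" "Y' \<in> carrier_mat (m * n) (m * n)" "X = pencil X' Y'"
      using S.pen_is_pencil unfolding Xpen by metis
    then show ?thesis
      unfolding XY(3) pencil_def by (intro minus_carrier_mat smult_carrier_mat const_mat_carrier)
  qed
  have "J_mat l * BB = transpose_mat CC"
  proof -
    have "J_mat l * BB = block_row m j (transpose_mat C)"
      unfolding CB JB[symmetric] by (rule block_row_mult[OF c(1) J_mat_carrier])
    also have "\<dots> = transpose_mat CC"
      unfolding CB using c by (subst block_row_transpose[of _ "2 * l" n]) auto
    finally show ?thesis .
  qed
  then have "hamiltonian_system_matrix (m * n) l T"
    unfolding T_def using c by (intro hamiltonian_system_matrixI[OF Xc Xeven hA])
      (auto simp: CB intro: block_col_carrier block_row_carrier)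
  moreover have "rosenbrock_strong_linearization n m (2 * l) S G T"
    unfolding T_def S_def CB Xpen by (rule S.rosenbrock[OF j ham min P_def])
  moreover have "even_rat_mat (transfer_function X CC (1\<^sub>m (2 * l)) A BB)"
    unfolding CB Xpen by (rule S.even_transfer[OF ham assms(6) Xeven[unfolded Xpen]])
  ultimately show ?thesis by blast
qed

end
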